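(* There exist $30$ pairwise non-diffeomorphic $7$-dimensional splittable flat solvmanifolds, all of them almost abelian, each carrying an invariant torsion-free $G_2$-structure and having finite cyclic holonomy group contained in $G_2$.
   Context: A solvmanifold is a compact quotient $\Gamma\backslash G$ of a simply connected solvable Lie group $G$ by a discrete cocompact subgroup (lattice) $\Gamma$. A flat almost abelian solvmanifold of dimension $7$ is $\Gamma\backslash G$ where $G=\mathbb{R}\ltimes_\phi\mathbb{R}^6$, $\phi(t)=R(at)\oplus R(bt)\oplus R(ct)$, $R(\theta)$ is the $2\times2$ rotation matrix of angle $\theta$, and $a,b,c\in\mathbb{R}$ with $a^2+b^2+c^2\ne0$; it carries the flat metric induced by the standard left-invariant product metric. The $7$-torus is included. Every lattice in such a $G$ is splittable (a semidirect product of a lattice of $\mathbb{R}$ and a lattice of $\mathbb{R}^6$). A $G_2$-structure on a $7$-manifold $M$ is a $3$-form $\varphi$ which at every point can be written in some basis $\{e^i\}$ of the cotangent space as $e^{123}+e^{145}+e^{167}+e^{246}-e^{257}-e^{347}-e^{356}$, where $e^{ijk}=e^i\wedge e^j\wedge e^k$. It induces a metric $g_\varphi$ and volume form via $g_\varphi(X,Y)\operatorname{vol}_\varphi=\frac16\iota_X\varphi\wedge\iota_Y\varphi\wedge\varphi$, and a Hodge star $\star_\varphi$. It is torsion-free if $d\varphi=0$ and $d\star_\varphi\varphi=0$. A $G_2$-structure on $\Gamma\backslash G$ is invariant if it is induced by a left-invariant $G_2$-structure on $G$. Holonomy is that of the metric $g_\varphi$. *)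

theory Defs
  imports "HOL-Analysis.Analysis" "HOL-Algebra.Elementary_Groups"
begin

section \<open>Smooth maps between open subsets of Euclidean spaces\<close>

primrec C_k_on :: "nat \<Rightarrow> 'a::euclidean_space set \<Rightarrow> ('a \<Rightarrow> 'b::euclidean_space) \<Rightarrow> bool" where
  "C_k_on 0 U f \<longleftrightarrow> continuous_on U f"
| "C_k_on (Suc k) U f \<longleftrightarrow>
     (\<forall>x\<in>U. f differentiable at x) \<and> (\<forall>v. C_k_on k U (\<lambda>x. frechet_derivative f (at x) v))"

definition smooth_on :: "'a::euclidean_space set \<Rightarrow> ('a \<Rightarrow> 'b::euclidean_space) \<Rightarrow> bool" where
  "smooth_on U f \<longleftrightarrow> (\<forall>k. C_k_on k U f)"


section \<open>Lattices and the quotients by them\<close>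

text \<open>A Lie group here is a group law on (the whole of) a Euclidean space, which serves as a global
  chart. The quotient of \<open>G\<close> by \<open>\<Gamma>\<close> is the set \<open>rcosets\<^bsub>G\<^esub> \<Gamma>\<close> of the cosets
  \<open>\<Gamma> #>\<^bsub>G\<^esub> x = \<Gamma>x\<close>, with the quotient topology.\<close>

definition coset_topology :: "'a::topological_space monoid \<Rightarrow> 'a set \<Rightarrow> 'a set topology" where
  "coset_topology G \<Gamma> = topology (\<lambda>V. V \<subseteq> rcosets\<^bsub>G\<^esub> \<Gamma> \<and>
     openin (top_of_set (carrier G)) {x \<in> carrier G. \<Gamma> #>\<^bsub>G\<^esub> x \<in> V})"

lemma openin_coset_topology:
  "openin (coset_topology G \<Gamma>) V \<longleftrightarrow> V \<subseteq> rcosets\<^bsub>G\<^esub> \<Gamma> \<and>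
     openin (top_of_set (carrier G)) {x \<in> carrier G. \<Gamma> #>\<^bsub>G\<^esub> x \<in> V}"
proof -
  have "istopology (\<lambda>V. V \<subseteq> rcosets\<^bsub>G\<^esub> \<Gamma> \<and>
     openin (top_of_set (carrier G)) {x \<in> carrier G. \<Gamma> #>\<^bsub>G\<^esub> x \<in> V})" (is "istopology ?O")
    unfolding istopology_def
  proof (intro conjI allI impI)
    fix S T assume "?O S" "?O T"
    moreover have "{x \<in> carrier G. \<Gamma> #>\<^bsub>G\<^esub> x \<in> S \<inter> T} =
        {x \<in> carrier G. \<Gamma> #>\<^bsub>G\<^esub> x \<in> S} \<inter> {x \<in> carrier G. \<Gamma> #>\<^bsub>G\<^esub> x \<in> T}" by auto
    ultimately show "S \<inter> T \<subseteq> rcosets\<^bsub>G\<^esub> \<Gamma>"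
      and "openin (top_of_set (carrier G)) {x \<in> carrier G. \<Gamma> #>\<^bsub>G\<^esub> x \<in> S \<inter> T}"
      by (auto intro: openin_Int)
  next
    fix K assume K: "\<forall>S\<in>K. ?O S"
    then show "\<Union>K \<subseteq> rcosets\<^bsub>G\<^esub> \<Gamma>" by blast
    have "{x \<in> carrier G. \<Gamma> #>\<^bsub>G\<^esub> x \<in> \<Union>K} =
        (\<Union>S\<in>K. {x \<in> carrier G. \<Gamma> #>\<^bsub>G\<^esub> x \<in> S})" by auto
    then show "openin (top_of_set (carrier G)) {x \<in> carrier G. \<Gamma> #>\<^bsub>G\<^esub> x \<in> \<Union>K}"
      using K by (auto intro: openin_Union)
  qed
  then show ?thesis
    by (simp add: coset_topology_def topology_inverse')
qed

definition is_lattice :: "'a::topological_space monoid \<Rightarrow> 'a set \<Rightarrow> bool" where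
  "is_lattice G \<Gamma> \<longleftrightarrow> subgroup \<Gamma> G \<and> discrete \<Gamma> \<and> compact_space (coset_topology G \<Gamma>)"

text \<open>The quotient of \<open>G\<close> by a discrete subgroup carries the smooth structure for which the
  projection is a local diffeomorphism. Hence a map of quotients is smooth iff it lifts locally to
  a smooth map of the groups.\<close>

definition smooth_quotient_map ::
  "'a::euclidean_space monoid \<Rightarrow> 'a set \<Rightarrow> 'b::euclidean_space monoid \<Rightarrow> 'b set \<Rightarrow>
   ('a set \<Rightarrow> 'b set) \<Rightarrow> bool" where
  "smooth_quotient_map G \<Gamma> H \<Delta> f \<longleftrightarrow>
     (\<forall>p. \<exists>U F. open U \<and> p \<in> U \<and> smooth_on U F \<and> (\<forall>x\<in>U. f (\<Gamma> #>\<^bsub>G\<^esub> x) = \<Delta> #>\<^bsub>H\<^esub> F x))"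

definition diffeomorphic_quotients ::
  "'a::euclidean_space monoid \<Rightarrow> 'a set \<Rightarrow> 'b::euclidean_space monoid \<Rightarrow> 'b set \<Rightarrow> bool" where
  "diffeomorphic_quotients G \<Gamma> H \<Delta> \<longleftrightarrow>
     (\<exists>f. bij_betw f (rcosets\<^bsub>G\<^esub> \<Gamma>) (rcosets\<^bsub>H\<^esub> \<Delta>) \<and>
          smooth_quotient_map G \<Gamma> H \<Delta> f \<and>
          smooth_quotient_map H \<Delta> G \<Gamma> (inv_into (rcosets\<^bsub>G\<^esub> \<Gamma>) f))"


section \<open>Flat almost abelian solvmanifolds of dimension 7\<close>

type_synonym R6 = "(real^2) \<times> (real^2) \<times> (real^2)"
type_synonym R7 = "real \<times> R6"

definition rotation_matrix :: "real \<Rightarrow> real^2^2" where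
  "rotation_matrix \<theta> = vector [vector [cos \<theta>, - sin \<theta>], vector [sin \<theta>, cos \<theta>]]"

definition rot_action :: "real \<Rightarrow> real \<Rightarrow> real \<Rightarrow> real \<Rightarrow> R6 \<Rightarrow> R6" where
  "rot_action a b c t = (\<lambda>(u, v, w).
     (rotation_matrix (a * t) *v u, rotation_matrix (b * t) *v v, rotation_matrix (c * t) *v w))"

definition almost_abelian :: "real \<Rightarrow> real \<Rightarrow> real \<Rightarrow> R7 monoid" where
  "almost_abelian a b c = \<lparr>carrier = UNIV,
     mult = (\<lambda>(t, x) (s, y). (t + s, x + rot_action a b c t y)), one = (0, 0)\<rparr>"

definition additive_group :: "'a::ab_group_add monoid" where
  "additive_group = \<lparr>carrier = UNIV, mult = (+), one = 0\<rparr>"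

definition splittable :: "R7 set \<Rightarrow> bool" where
  "splittable \<Gamma> \<longleftrightarrow>
     (\<exists>L N. is_lattice (additive_group :: real monoid) L \<and>
            is_lattice (additive_group :: R6 monoid) N \<and> \<Gamma> = L \<times> N)"

definition flat_almost_abelian_solvmanifold :: "real \<Rightarrow> real \<Rightarrow> real \<Rightarrow> R7 set \<Rightarrow> bool" where
  "flat_almost_abelian_solvmanifold a b c \<Gamma> \<longleftrightarrow>
     a\<^sup>2 + b\<^sup>2 + c\<^sup>2 \<noteq> 0 \<and> is_lattice (almost_abelian a b c) \<Gamma>"

lemma rotation_matrix_mult_vec:
  "rotation_matrix \<theta> *v u = vector [cos \<theta> * u$1 - sin \<theta> * u$2, sin \<theta> * u$1 + cos \<theta> * u$2]"
  by (simp add: rotation_matrix_def vec_eq_iff forall_2 matrix_vector_mult_def sum_2)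

lemma rotation_matrix_add:
  "rotation_matrix (\<theta> + \<eta>) *v u = rotation_matrix \<theta> *v (rotation_matrix \<eta> *v u)"
  by (simp add: rotation_matrix_mult_vec vec_eq_iff forall_2 cos_add sin_add algebra_simps)

lemma rotation_matrix_0 [simp]: "rotation_matrix 0 *v u = u"
  by (simp add: rotation_matrix_mult_vec vec_eq_iff forall_2)

lemma norm_rotation_matrix [simp]: "norm (rotation_matrix \<theta> *v u) = norm u"
proof -
  have "(cos \<theta> * x - sin \<theta> * y)\<^sup>2 + (sin \<theta> * x + cos \<theta> * y)\<^sup>2
      = (x\<^sup>2 + y\<^sup>2) * ((sin \<theta>)\<^sup>2 + (cos \<theta>)\<^sup>2)" for x y :: real
    by algebra
  then show ?thesis
    by (simp add: norm_vec_def L2_set_def sum_2 rotation_matrix_mult_vec)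
qed

lemma rot_action_add: "rot_action a b c (t + s) x = rot_action a b c t (rot_action a b c s x)"
  by (simp add: rot_action_def distrib_left rotation_matrix_add split: prod.split)

lemma rot_action_0 [simp]: "rot_action a b c 0 x = x"
  by (simp add: rot_action_def split: prod.split)

lemma rot_action_distrib:
  "rot_action a b c t (x + y) = rot_action a b c t x + rot_action a b c t y"
  "rot_action a b c t (x - y) = rot_action a b c t x - rot_action a b c t y"
  "rot_action a b c t (- x) = - rot_action a b c t x"
  "rot_action a b c t 0 = 0"
  by (simp_all add: rot_action_def matrix_vector_right_distrib matrix_vector_mult_diff_distrib
      zero_prod_def minus_prod_def plus_prod_def uminus_prod_def vec.neg split: prod.split)

lemma norm_rot_action [simp]: "norm (rot_action a b c t x) = norm x"
  by (simp add: rot_action_def norm_prod_def split: prod.split)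

lemma group_almost_abelian: "group (almost_abelian a b c)"
proof (rule groupI)
  fix p assume "p \<in> carrier (almost_abelian a b c)"
  obtain t x where p: "p = (t, x)" by (cases p)
  have "(- t, - rot_action a b c (- t) x) \<otimes>\<^bsub>almost_abelian a b c\<^esub> p = \<one>\<^bsub>almost_abelian a b c\<^esub>"
    by (simp add: almost_abelian_def p)
  then show "\<exists>q\<in>carrier (almost_abelian a b c).
      q \<otimes>\<^bsub>almost_abelian a b c\<^esub> p = \<one>\<^bsub>almost_abelian a b c\<^esub>"
    by (rule bexI) (simp add: almost_abelian_def)
qed (auto simp: almost_abelian_def rot_action_distrib rot_action_add)

text \<open>Left translations are Euclidean isometries, so that the left-invariant metric which is standard
  at the identity is the Euclidean metric of the chart; in particular it is flat.\<close>

lemma dist_almost_abelian_left: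
  "dist (p \<otimes>\<^bsub>almost_abelian a b c\<^esub> q) (p \<otimes>\<^bsub>almost_abelian a b c\<^esub> r) = dist q r"
proof -
  have "norm (rot_action a b c t y - rot_action a b c t z) = norm (y - z)" for t y z
    by (simp flip: rot_action_distrib)
  then show ?thesis
    by (cases p; cases q; cases r) (simp add: almost_abelian_def dist_norm norm_prod_def)
qed


section \<open>Differential forms\<close>

text \<open>A \<open>k\<close>-form on a vector space is a function on lists of vectors; only its values on lists of
  length \<open>k\<close> are relevant.\<close>

type_synonym 'a form = "'a list \<Rightarrow> real"

definition alternating :: "nat \<Rightarrow> 'a::real_vector form \<Rightarrow> bool" where
  "alternating k \<alpha> \<longleftrightarrow>
     (\<forall>vs i. length vs = k \<and> i < k \<longrightarrow> linear (\<lambda>x. \<alpha> (vs[i := x]))) \<and>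
     (\<forall>vs i j. length vs = k \<and> i < j \<and> j < k \<and> vs ! i = vs ! j \<longrightarrow> \<alpha> vs = 0)"

text \<open>\<open>wedge k l \<alpha> \<beta>\<close> is the product of a \<open>k\<close>-form and an \<open>l\<close>-form, normalised by
  \<open>(e\<^sup>1 \<and> \<dots> \<and> e\<^sup>k) (v\<^sub>1, \<dots>, v\<^sub>k) = det (e\<^sup>i v\<^sub>j)\<close>.\<close>

definition wedge :: "nat \<Rightarrow> nat \<Rightarrow> 'a form \<Rightarrow> 'a form \<Rightarrow> 'a form" where
  "wedge k l \<alpha> \<beta> vs =
     (\<Sum>\<sigma> | \<sigma> permutes {..<k + l}. of_int (sign \<sigma>) *
        \<alpha> (map (\<lambda>i. vs ! \<sigma> i) [0..<k]) * \<beta> (map (\<lambda>i. vs ! \<sigma> i) [k..<k + l])) / (fact k * fact l)"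

definition interior_product :: "'a \<Rightarrow> 'a form \<Rightarrow> 'a form" where
  "interior_product X \<alpha> vs = \<alpha> (X # vs)"

definition one_form :: "('a::real_normed_vector \<Rightarrow>\<^sub>L real) \<Rightarrow> 'a form" where
  "one_form e vs = blinfun_apply e (hd vs)"

definition differential_form :: "nat \<Rightarrow> ('a::euclidean_space \<Rightarrow> 'a form) \<Rightarrow> bool" where
  "differential_form k \<omega> \<longleftrightarrow>
     (\<forall>p. alternating k (\<omega> p)) \<and> (\<forall>vs. length vs = k \<longrightarrow> smooth_on UNIV (\<lambda>p. \<omega> p vs))"

definition exterior_derivative :: "nat \<Rightarrow> ('a::euclidean_space \<Rightarrow> 'a form) \<Rightarrow> 'a \<Rightarrow> 'a form" where
  "exterior_derivative k \<omega> p vs =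
     (\<Sum>i\<le>k. (-1) ^ i *
        frechet_derivative (\<lambda>q. \<omega> q (take i vs @ drop (Suc i) vs)) (at p) (vs ! i))"

definition closed_form :: "nat \<Rightarrow> ('a::euclidean_space \<Rightarrow> 'a form) \<Rightarrow> bool" where
  "closed_form k \<omega> \<longleftrightarrow> differential_form k \<omega> \<and>
     (\<forall>p vs. length vs = Suc k \<longrightarrow> exterior_derivative k \<omega> p vs = 0)"

definition d_left_translation :: "'a::euclidean_space monoid \<Rightarrow> 'a \<Rightarrow> 'a \<Rightarrow> 'a \<Rightarrow> 'a" where
  "d_left_translation G h p = frechet_derivative (\<lambda>q. h \<otimes>\<^bsub>G\<^esub> q) (at p)"

definition left_invariant :: "'a::euclidean_space monoid \<Rightarrow> nat \<Rightarrow> ('a \<Rightarrow> 'a form) \<Rightarrow> bool" where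
  "left_invariant G k \<omega> \<longleftrightarrow>
     (\<forall>h p vs. length vs = k \<longrightarrow> \<omega> (h \<otimes>\<^bsub>G\<^esub> p) (map (d_left_translation G h p) vs) = \<omega> p vs)"


section \<open>Inner products, volume forms and the Hodge star\<close>

definition inner_product :: "('a::real_vector \<Rightarrow> 'a \<Rightarrow> real) \<Rightarrow> bool" where
  "inner_product g \<longleftrightarrow> bilinear g \<and> (\<forall>x y. g x y = g y x) \<and> (\<forall>x. x \<noteq> 0 \<longrightarrow> g x x > 0)"

definition orthonormal_frame :: "('a::euclidean_space \<Rightarrow> 'a \<Rightarrow> real) \<Rightarrow> (nat \<Rightarrow> 'a) \<Rightarrow> bool" where
  "orthonormal_frame g E \<longleftrightarrow>
     (\<forall>i<DIM('a). \<forall>j<DIM('a). g (E i) (E j) = (if i = j then 1 else 0))"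

definition volume_form :: "('a::euclidean_space \<Rightarrow> 'a \<Rightarrow> real) \<Rightarrow> 'a form \<Rightarrow> bool" where
  "volume_form g \<nu> \<longleftrightarrow> alternating DIM('a) \<nu> \<and>
     (\<exists>E. orthonormal_frame g E \<and> \<bar>\<nu> (map E [0..<DIM('a)])\<bar> = 1)"

text \<open>The inner product on \<open>k\<close>-forms for which the products of an orthonormal coframe are orthonormal;
  the sum runs over all multi-indices and not only over the increasing ones, hence the factor
  \<open>1 / k!\<close>.\<close>

definition form_inner :: "(nat \<Rightarrow> 'a::euclidean_space) \<Rightarrow> nat \<Rightarrow> 'a form \<Rightarrow> 'a form \<Rightarrow> real" where
  "form_inner E k \<alpha> \<beta> =
     (\<Sum>is | length is = k \<and> set is \<subseteq> {..<DIM('a)}. \<alpha> (map E is) * \<beta> (map E is)) / fact k"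

text \<open>\<open>hodge_star g \<nu> k \<beta> \<psi>\<close> says that \<open>\<psi> = \<star>\<beta>\<close>, that is,
  \<open>\<alpha> \<and> \<psi> = \<langle>\<alpha>, \<beta>\<rangle> \<nu>\<close> for all \<open>k\<close>-forms \<open>\<alpha>\<close>.\<close>

definition hodge_star ::
  "('a::euclidean_space \<Rightarrow> 'a \<Rightarrow> real) \<Rightarrow> 'a form \<Rightarrow> nat \<Rightarrow> 'a form \<Rightarrow> 'a form \<Rightarrow> bool" where
  "hodge_star g \<nu> k \<beta> \<psi> \<longleftrightarrow> alternating (DIM('a) - k) \<psi> \<and>
     (\<exists>E. orthonormal_frame g E \<and>
        (\<forall>\<alpha> vs. alternating k \<alpha> \<and> length vs = DIM('a) \<longrightarrow>
           wedge k (DIM('a) - k) \<alpha> \<psi> vs = form_inner E k \<alpha> \<beta> * \<nu> vs))"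


section \<open>\<open>G\<^sub>2\<close>-structures\<close>

definition G2_model :: "(nat \<Rightarrow> 'a::real_normed_vector \<Rightarrow>\<^sub>L real) \<Rightarrow> 'a form" where
  "G2_model e vs =
     (let w = (\<lambda>i j k. wedge 1 2 (one_form (e i)) (wedge 1 1 (one_form (e j)) (one_form (e k))) vs)
      in w 1 2 3 + w 1 4 5 + w 1 6 7 + w 2 4 6 - w 2 5 7 - w 3 4 7 - w 3 5 6)"

definition G2_form :: "'a::real_normed_vector form \<Rightarrow> bool" where
  "G2_form \<alpha> \<longleftrightarrow> alternating 3 \<alpha> \<and>
     (\<exists>e. inj_on e {1..7} \<and> independent (e ` {1..7}) \<and> span (e ` {1..7}) = UNIV \<and>
          (\<forall>vs. length vs = 3 \<longrightarrow> \<alpha> vs = G2_model e vs))"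

text \<open>A left-invariant form on \<open>G\<close> is the same thing as an invariant form on the quotient of \<open>G\<close>
  by any lattice, so that invariant \<open>G\<^sub>2\<close>-structures, and whatever they determine locally, can be
  handled on \<open>G\<close>.\<close>

definition invariant_G2_structure :: "'a::euclidean_space monoid \<Rightarrow> ('a \<Rightarrow> 'a form) \<Rightarrow> bool" where
  "invariant_G2_structure G \<phi> \<longleftrightarrow>
     differential_form 3 \<phi> \<and> (\<forall>p. G2_form (\<phi> p)) \<and> left_invariant G 3 \<phi>"

text \<open>The equation determines \<open>g\<close> and \<open>\<nu>\<close> because \<open>\<nu>\<close> is a volume form of \<open>g\<close>: rescaling
  \<open>g\<close> by \<open>c > 0\<close> would rescale \<open>\<nu>\<close> by both \<open>c powr (7/2)\<close> and \<open>1/c\<close>.\<close>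

definition G2_metric ::
  "('a::euclidean_space \<Rightarrow> 'a form) \<Rightarrow> ('a \<Rightarrow> 'a \<Rightarrow> 'a \<Rightarrow> real) \<Rightarrow> ('a \<Rightarrow> 'a form) \<Rightarrow> bool" where
  "G2_metric \<phi> g \<nu> \<longleftrightarrow>
     (\<forall>p. inner_product (g p) \<and> volume_form (g p) (\<nu> p) \<and>
        (\<forall>X Y vs. length vs = 7 \<longrightarrow>
           g p X Y * \<nu> p vs =
             1/6 * wedge 2 5 (interior_product X (\<phi> p)) (wedge 2 3 (interior_product Y (\<phi> p)) (\<phi> p)) vs))"

definition torsion_free_G2 :: "('a::euclidean_space \<Rightarrow> 'a form) \<Rightarrow> bool" where
  "torsion_free_G2 \<phi> \<longleftrightarrow> closed_form 3 \<phi> \<and>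
     (\<exists>g \<nu> \<psi>. G2_metric \<phi> g \<nu> \<and> (\<forall>p. hodge_star (g p) (\<nu> p) 3 (\<phi> p) (\<psi> p)) \<and> closed_form 4 \<psi>)"

definition G2_group :: "'a::real_vector form \<Rightarrow> ('a \<Rightarrow> 'a) set" where
  "G2_group \<alpha> =
     {A. linear A \<and> bij A \<and> (\<forall>vs. length vs = 3 \<longrightarrow> \<alpha> (map A vs) = \<alpha> vs)}"


section \<open>Holonomy\<close>

text \<open>In the global chart the Levi-Civita connection is \<open>\<nabla>\<^sub>X Y = D\<^sub>X Y + C(X, Y)\<close> with
  \<open>C\<close> the Christoffel symbols; the conditions say that it is torsion-free and metric.\<close>

definition levi_civita ::
  "('a::euclidean_space \<Rightarrow> 'a \<Rightarrow> 'a \<Rightarrow> real) \<Rightarrow> ('a \<Rightarrow> 'a \<Rightarrow> 'a \<Rightarrow> 'a) \<Rightarrow> bool" where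
  "levi_civita g C \<longleftrightarrow>
     (\<forall>p. bilinear (C p)) \<and> (\<forall>p X Y. C p X Y = C p Y X) \<and>
     (\<forall>p X Y Z. frechet_derivative (\<lambda>q. g q Y Z) (at p) X = g p (C p X Y) Z + g p Y (C p X Z))"

definition parallel_along ::
  "('a::euclidean_space \<Rightarrow> 'a \<Rightarrow> 'a \<Rightarrow> 'a) \<Rightarrow> (real \<Rightarrow> 'a) \<Rightarrow> (real \<Rightarrow> 'a) \<Rightarrow> bool" where
  "parallel_along C c W \<longleftrightarrow> continuous_on {0..1} W \<and>
     (\<exists>S. finite S \<and> (\<forall>t\<in>{0..1} - S. c differentiable at t \<and>
        (W has_vector_derivative - C (c t) (vector_derivative c (at t)) (W t)) (at t)))"

text \<open>The holonomy group at \<open>\<Gamma>p\<close> of the metric induced on the quotient by a \<open>\<Gamma>\<close>-invariant metric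
  \<open>g\<close> on \<open>G\<close>. A loop at \<open>\<Gamma>p\<close> is the projection of a path from \<open>p\<close> to \<open>\<gamma>p\<close> for some \<open>\<gamma> \<in> \<Gamma>\<close>.
  The projection identifies the tangent space at \<open>\<Gamma>p\<close> with those at \<open>p\<close> and at \<open>\<gamma>p\<close>, and the latter
  two with each other by the derivative of the left translation by \<open>\<gamma>\<close>.\<close>

definition holonomy_group ::
  "'a::euclidean_space monoid \<Rightarrow> 'a set \<Rightarrow> ('a \<Rightarrow> 'a \<Rightarrow> 'a \<Rightarrow> real) \<Rightarrow> 'a \<Rightarrow> ('a \<Rightarrow> 'a) monoid" where
  "holonomy_group G \<Gamma> g p =
     \<lparr>carrier = {A. linear A \<and>
        (\<exists>\<gamma>\<in>\<Gamma>. \<exists>c C. levi_civita g C \<and> valid_path c \<and>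
           pathstart c = p \<and> pathfinish c = \<gamma> \<otimes>\<^bsub>G\<^esub> p \<and>
           (\<forall>v. \<exists>W. parallel_along C c W \<and> W 0 = v \<and> W 1 = d_left_translation G \<gamma> p (A v)))},
      mult = (\<circ>), one = id\<rparr>"

end

theory Submission
  imports Defs "HOL-Number_Theory.Cong"
begin

text \<open>With \<open>a + b + c = 0\<close> the rotations \<open>\<phi>(t)\<close> lie in \<open>SU(3)\<close>, so that the standard \<open>G\<^sub>2\<close>-form
  \<open>dt \<and> \<omega> + Re \<Omega>\<close> is left-invariant and has constant coefficients in the chart; it is therefore parallel,
  its metric is Euclidean, and the holonomy is generated by \<open>\<phi>(1)\<close>. If \<open>\<phi>(1)\<close> preserves a lattice \<open>N\<close> of
  \<open>\<real>\<^sup>6\<close> and acts on it by a matrix \<open>M\<close> of finite order \<open>m\<close>, then \<open>\<Gamma> = \<int> \<times> N\<close> is a lattice of the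
  solvable group, isomorphic to \<open>\<int> \<ltimes>\<^sub>M \<int>\<^sup>6\<close>.

  A diffeomorphism lifts to the universal covers and induces an isomorphism of the lattices. The group \<open>\<Gamma>\<close>
  determines \<open>m\<close> (the least positive \<open>m\<close> such that all \<open>m\<close>-th powers commute), the subgroup \<open>m\<int> \<times> N\<close>
  (the centraliser of the \<open>m\<close>-th powers) and the cyclic group of automorphisms by which \<open>\<Gamma>\<close> acts on it.
  Hence it determines, for all \<open>d\<close> and \<open>q\<close>, the number of fixed points of \<open>M\<^sup>d\<close> on \<open>N / q N\<close>. These
  numbers for \<open>q = 2, 3\<close>, together with \<open>m\<close>, distinguish thirty integral forms of elements of finite
  order in \<open>SU(3)\<close>.\<close>

section \<open>Lifting diffeomorphisms of quotients\<close>

text \<open>The order and the characteristic polynomial of \<open>M\<close> do not suffice: the same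
  rotation preserves inequivalent lattices, which differ in how their cyclotomic pieces are glued.
  Pieces belonging to roots of unity of orders d and e can be glued only modulo a prime p for which
  d/e is a power of p; in the examples p is 2 or 3, hence the choice of q. An isomorphism of the
  lattices need not carry \<open>M\<close> to its counterpart M'. It may mix the central direction
  with the vectors of N, and it may turn M into a power of M' with exponent prime to m. Only numbers
  that survive both changes are admissible; fixed points of powers do, because two generators of one
  cyclic group are powers of each other. The metric of a G2-form is defined by a product of seven
  covectors, a sum over 5040 permutations. The metric and the Hodge star are therefore computed with
  signed lists of indices in place of forms, and only small determinants are ever expanded. On the
  topological side a displacement bound that is uniform in the point replaces proper discontinuity,
  so that lifts can be compared by distances alone.\<close>

locale free_isometric_action = group G for G :: "'a::euclidean_space monoid" (structure) +
  fixes \<Gamma> :: "'a set" and \<epsilon> :: real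
  assumes carrier_UNIV [simp]: "carrier G = UNIV"
    and subgroup_\<Gamma>: "subgroup \<Gamma> G"
    and isometric: "dist (p \<otimes> q) (p \<otimes> r) = dist q r"
    and \<epsilon>_pos: "\<epsilon> > 0"
    and displacement: "\<gamma> \<in> \<Gamma> \<Longrightarrow> \<gamma> \<noteq> \<one> \<Longrightarrow> dist (\<gamma> \<otimes> x) x \<ge> \<epsilon>"
begin

lemma r_coset_eq_iff: "\<Gamma> #> x = \<Gamma> #> y \<longleftrightarrow> (\<exists>\<gamma>\<in>\<Gamma>. x = \<gamma> \<otimes> y)"
proof
  assume "\<Gamma> #> x = \<Gamma> #> y"
  moreover have "x \<in> \<Gamma> #> x" using subgroup.one_closed[OF subgroup_\<Gamma>] by (force simp: r_coset_def)
  ultimately show "\<exists>\<gamma>\<in>\<Gamma>. x = \<gamma> \<otimes> y" by (auto simp: r_coset_def)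
next
  assume "\<exists>\<gamma>\<in>\<Gamma>. x = \<gamma> \<otimes> y"
  then have "x \<in> \<Gamma> #> y" by (auto simp: r_coset_def)
  then show "\<Gamma> #> x = \<Gamma> #> y"
    using repr_independence[of x \<Gamma> y] subgroup_\<Gamma> by auto
qed

lemma r_coset_in_rcosets: "\<Gamma> #> x \<in> rcosets \<Gamma>"
  by (auto simp: RCOSETS_def)

lemma continuous_on_translation: "continuous_on S (\<lambda>x. g \<otimes> x)"
  by (rule continuous_on_iff[THEN iffD2]) (auto simp: isometric)

text \<open>Cancelling \<delta> by an isometry reduces the claim to the displacement bound at one
  point.\<close>

lemma translates_separated:
  assumes "\<gamma> \<in> \<Gamma>" "\<delta> \<in> \<Gamma>" "dist (\<gamma> \<otimes> x) (\<delta> \<otimes> x) < \<epsilon>"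
  shows "\<gamma> = \<delta>"
proof -
  have "dist (inv \<delta> \<otimes> \<gamma> \<otimes> x) x = dist (\<delta> \<otimes> (inv \<delta> \<otimes> \<gamma> \<otimes> x)) (\<delta> \<otimes> x)"
    by (simp add: isometric)
  also have "\<delta> \<otimes> (inv \<delta> \<otimes> \<gamma> \<otimes> x) = \<gamma> \<otimes> x"
    by (simp add: m_assoc[symmetric])
  finally have "dist (inv \<delta> \<otimes> \<gamma> \<otimes> x) x < \<epsilon>" using assms by simp
  moreover have "inv \<delta> \<otimes> \<gamma> \<in> \<Gamma>"
    using assms subgroup_\<Gamma> by (simp add: subgroup.m_closed subgroup.m_inv_closed)
  ultimately have "inv \<delta> \<otimes> \<gamma> = \<one>" using displacement by (meson linorder_not_le)
  then have "\<delta> \<otimes> (inv \<delta> \<otimes> \<gamma>) = \<delta>" by simp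
  then show ?thesis by (simp add: m_assoc[symmetric])
qed

text \<open>Uniqueness of lifts: the distance from \<open>A\<close> to the translate of
  \<open>B\<close> that meets it at 0 never lies strictly between 0 and \<epsilon>, and its range is
  connected.\<close>

lemma lifts_differ_by_translation:
  fixes A B :: "'b::real_normed_vector \<Rightarrow> 'a"
  assumes A: "continuous_on UNIV A" and B: "continuous_on UNIV B"
    and AB: "\<And>x. \<Gamma> #> A x = \<Gamma> #> B x"
  shows "\<exists>\<delta>\<in>\<Gamma>. \<forall>x. A x = \<delta> \<otimes> B x"
proof -
  have ex: "\<exists>\<gamma>\<in>\<Gamma>. A x = \<gamma> \<otimes> B x" for x using AB r_coset_eq_iff by blast
  then obtain \<delta> where \<delta>: "\<delta> \<in> \<Gamma>" "A 0 = \<delta> \<otimes> B 0" by blast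
  define h where "h x = dist (A x) (\<delta> \<otimes> B x)" for x
  have "continuous_on UNIV (\<lambda>x. \<delta> \<otimes> B x)"
    using continuous_on_compose2[OF continuous_on_translation B] by blast
  then have "continuous_on UNIV h" unfolding h_def using A by (intro continuous_intros)
  then have conn: "connected (range h)" by (rule connected_continuous_image) (rule convex_connected[OF convex_UNIV])
  have gap: "h x = 0 \<or> h x \<ge> \<epsilon>" for x
  proof -
    obtain \<gamma> where \<gamma>: "\<gamma> \<in> \<Gamma>" "A x = \<gamma> \<otimes> B x" using ex by blast
    then show ?thesis using translates_separated[OF \<gamma>(1) \<delta>(1), of "B x"] by (force simp: h_def)
  qed
  have "h x = 0" for x
  proof (rule ccontr)
    assume "h x \<noteq> 0"
    then have "h x \<ge> \<epsilon>" using gap by blast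
    moreover have "h 0 = 0" using \<delta> by (simp add: h_def)
    ultimately have "\<epsilon>/2 \<in> range h"
      using connectedD_interval[OF conn, of "h 0" "h x" "\<epsilon>/2"] \<epsilon>_pos by auto
    then obtain y where "h y = \<epsilon>/2" by auto
    with gap[of y] \<epsilon>_pos show False by auto
  qed
  with \<delta> show ?thesis by (auto simp: h_def)
qed

text \<open>The lifting theorem of the library needs a covering of a normed space. Therefore the covering of the
  quotient by \<open>G\<close> is pulled back along \<open>f\<close>, and the identity is lifted to the pull-back.\<close>

lemma global_lift:
  fixes f :: "'b::real_normed_vector \<Rightarrow> 'a set"
  assumes loc: "\<And>p. \<exists>U F. open U \<and> p \<in> U \<and> continuous_on U F \<and> (\<forall>x\<in>U. f x = \<Gamma> #> F x)"
  shows "\<exists>F. continuous_on UNIV F \<and> (\<forall>x. f x = \<Gamma> #> F x)"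
proof -
  define E where "E = {(x, y). f x = \<Gamma> #> y}"
  have "covering_space E fst UNIV"
    unfolding covering_space_def
  proof (intro conjI ballI)
    show "continuous_on E fst" by (intro continuous_intros)
    have "\<exists>y. f x = \<Gamma> #> y" for x using loc[of x] by blast
    then show "fst ` E = UNIV" by (force simp: E_def)
    fix p
    obtain U F where U: "open U" "p \<in> U" "continuous_on U F" "\<forall>x\<in>U. f x = \<Gamma> #> F x"
      using loc[of p] by blast
    \<comment> \<open>The sheet over \<open>U\<close> that belongs to \<delta> is the graph of the
      translated local lift.\<close>
    define s where "s \<delta> = (\<lambda>x. (x, \<delta> \<otimes> F x)) ` U" for \<delta>
    have cont: "continuous_on U (\<lambda>x. \<delta> \<otimes> F x)" for \<delta>
      using continuous_on_compose2[OF continuous_on_translation U(3)] by blast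
    have union: "\<Union> (s ` \<Gamma>) = E \<inter> fst -` U"
    proof (intro subset_antisym subsetI)
      fix z assume "z \<in> \<Union> (s ` \<Gamma>)"
      then obtain \<delta> x where "\<delta> \<in> \<Gamma>" "x \<in> U" "z = (x, \<delta> \<otimes> F x)" by (auto simp: s_def)
      then show "z \<in> E \<inter> fst -` U" using U(4) r_coset_eq_iff[of "\<delta> \<otimes> F x" "F x"]
        by (auto simp: E_def)
    next
      fix z assume z: "z \<in> E \<inter> fst -` U"
      obtain x y where "z = (x, y)" by (cases z)
      with z have "x \<in> U" "\<Gamma> #> y = \<Gamma> #> F x" "z = (x, y)" using U(4) by (auto simp: E_def)
      then show "z \<in> \<Union> (s ` \<Gamma>)" by (auto simp: s_def r_coset_eq_iff)
    qed
    have sep: "\<delta> = \<delta>'" if "\<delta> \<in> \<Gamma>" "\<delta>' \<in> \<Gamma>" "dist (\<delta> \<otimes> F x) (\<delta>' \<otimes> F x) < \<epsilon>" for \<delta> \<delta>' x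
      using translates_separated that by blast
    have "openin (top_of_set E) (s \<delta>)" if \<delta>: "\<delta> \<in> \<Gamma>" for \<delta>
    proof -
      \<comment> \<open>A tube of radius \<epsilon> about the graph; by \<open>sep\<close> it meets
        no other sheet.\<close>
      define W where "W = {z \<in> U \<times> UNIV. dist (snd z) (\<delta> \<otimes> F (fst z)) \<in> {..<\<epsilon>}}"
      have "continuous_on (U \<times> UNIV) (\<lambda>z. dist (snd z) (\<delta> \<otimes> F (fst z)))"
        by (intro continuous_intros continuous_on_compose2[OF cont]) auto
      then have "open W" unfolding W_def
        by (rule continuous_open_preimage[where T = "{..<\<epsilon>}", unfolded vimage_def Int_def mem_Collect_eq])
           (auto simp: U(1) open_Times)
      moreover have "s \<delta> = E \<inter> W"
      proof (intro subset_antisym subsetI)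
        fix z assume "z \<in> s \<delta>"
        then show "z \<in> E \<inter> W" using union \<delta> \<epsilon>_pos by (auto simp: s_def W_def E_def)
      next
        fix z assume z: "z \<in> E \<inter> W"
        then have "z \<in> \<Union> (s ` \<Gamma>)" unfolding union by (auto simp: W_def)
        then obtain \<delta>' x where *: "\<delta>' \<in> \<Gamma>" "x \<in> U" "z = (x, \<delta>' \<otimes> F x)" by (auto simp: s_def)
        then have "\<delta>' = \<delta>" using z sep \<delta> by (auto simp: W_def)
        then show "z \<in> s \<delta>" using * by (auto simp: s_def)
      qed
      ultimately show ?thesis by (auto simp: openin_open)
    qed
    moreover have "pairwise disjnt (s ` \<Gamma>)"
      unfolding pairwise_image
    proof (rule pairwiseI)
      fix \<delta> \<delta>' assume *: "\<delta> \<in> \<Gamma>" "\<delta>' \<in> \<Gamma>" "\<delta> \<noteq> \<delta>'"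
      show "s \<delta> \<noteq> s \<delta>' \<longrightarrow> disjnt (s \<delta>) (s \<delta>')"
        using sep[OF *(1,2)] * \<epsilon>_pos by (auto simp: disjnt_iff s_def)
    qed
    moreover have "\<exists>q. homeomorphism (s \<delta>) U fst q" for \<delta>
    proof (intro exI)
      show "homeomorphism (s \<delta>) U fst (\<lambda>x. (x, \<delta> \<otimes> F x))"
        by (intro homeomorphismI continuous_intros cont) (auto simp: s_def)
    qed
    ultimately show "\<exists>T. p \<in> T \<and> openin (top_of_set UNIV) T \<and>
        (\<exists>v. \<Union>v = E \<inter> fst -` T \<and> (\<forall>u\<in>v. openin (top_of_set E) u) \<and>
             pairwise disjnt v \<and> (\<forall>u\<in>v. \<exists>q. homeomorphism u T fst q))"
      using U union by (intro exI[of _ U] conjI exI[of _ "s ` \<Gamma>"]) auto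
  qed
  \<comment> \<open>A lift of the identity is a section of the pull-back; its second component is
    the required map.\<close>
  then obtain g where g: "continuous_on UNIV g" "g \<in> UNIV \<rightarrow> E" "\<And>y. fst (g y) = (y :: 'b)"
    by (rule covering_space_lift[where f = "\<lambda>x. x" and U = UNIV])
       (auto intro!: convex_imp_simply_connected convex_imp_locally_path_connected)
  show ?thesis
  proof (intro exI conjI allI)
    show "continuous_on UNIV (snd \<circ> g)" by (intro continuous_on_compose g continuous_intros)
    show "f x = \<Gamma> #> (snd \<circ> g) x" for x
    proof -
      have "g x \<in> E" using g(2) by auto
      then show ?thesis using g(3)[of x] by (simp add: E_def case_prod_beta)
    qed
  qed
qed

end

lemma smooth_quotient_map_lift:
  fixes G :: "'a::euclidean_space monoid" and H :: "'b::euclidean_space monoid"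
  assumes "free_isometric_action H \<Delta> \<epsilon>" and "smooth_quotient_map G \<Gamma> H \<Delta> f"
  shows "\<exists>F. continuous_on UNIV F \<and> (\<forall>x. f (\<Gamma> #>\<^bsub>G\<^esub> x) = \<Delta> #>\<^bsub>H\<^esub> F x)"
proof -
  interpret free_isometric_action H \<Delta> \<epsilon> by fact
  have "continuous_on U F" if "smooth_on U F" for U and F :: "'a \<Rightarrow> 'b"
    using that[unfolded smooth_on_def, rule_format, of 0] by simp
  then have "\<exists>U F. open U \<and> p \<in> U \<and> continuous_on U F \<and> (\<forall>x\<in>U. f (\<Gamma> #>\<^bsub>G\<^esub> x) = \<Delta> #>\<^bsub>H\<^esub> F x)" for p
    using assms(2)[unfolded smooth_quotient_map_def, rule_format, of p] by blast
  then show ?thesis by (rule global_lift)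
qed

text \<open>The isomorphism is the deck transformation rule \<open>F (\<gamma> x) = \<theta> \<gamma> (F x)\<close> of a lift \<open>F\<close>.\<close>

theorem diffeomorphic_imp_isomorphic:
  assumes "free_isometric_action G \<Gamma> \<epsilon>" and "free_isometric_action H \<Delta> \<eta>"
    and "diffeomorphic_quotients G \<Gamma> H \<Delta>"
  shows "\<exists>\<theta>. bij_betw \<theta> \<Gamma> \<Delta> \<and> (\<forall>\<gamma>\<in>\<Gamma>. \<forall>\<gamma>'\<in>\<Gamma>. \<theta> (\<gamma> \<otimes>\<^bsub>G\<^esub> \<gamma>') = \<theta> \<gamma> \<otimes>\<^bsub>H\<^esub> \<theta> \<gamma>')"
proof -
  interpret G: free_isometric_action G \<Gamma> \<epsilon> by fact
  interpret H: free_isometric_action H \<Delta> \<eta> by fact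
  obtain f where f: "bij_betw f (rcosets\<^bsub>G\<^esub> \<Gamma>) (rcosets\<^bsub>H\<^esub> \<Delta>)"
      "smooth_quotient_map G \<Gamma> H \<Delta> f"
      "smooth_quotient_map H \<Delta> G \<Gamma> (inv_into (rcosets\<^bsub>G\<^esub> \<Gamma>) f)" (is "smooth_quotient_map _ _ _ _ ?f'")
    using assms(3) unfolding diffeomorphic_quotients_def by blast
  obtain F where F: "continuous_on UNIV F" "\<And>x. f (\<Gamma> #>\<^bsub>G\<^esub> x) = \<Delta> #>\<^bsub>H\<^esub> F x"
    using smooth_quotient_map_lift[OF assms(2) f(2)] by blast
  obtain F' where F': "continuous_on UNIV F'" "\<And>y. ?f' (\<Delta> #>\<^bsub>H\<^esub> y) = \<Gamma> #>\<^bsub>G\<^esub> F' y"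
    using smooth_quotient_map_lift[OF assms(1) f(3)] by blast
  have "\<exists>\<delta>\<in>\<Delta>. \<forall>x. F (\<gamma> \<otimes>\<^bsub>G\<^esub> x) = \<delta> \<otimes>\<^bsub>H\<^esub> F x" if "\<gamma> \<in> \<Gamma>" for \<gamma>
  proof (rule H.lifts_differ_by_translation)
    show "continuous_on UNIV (\<lambda>x. F (\<gamma> \<otimes>\<^bsub>G\<^esub> x))"
      using continuous_on_compose2[OF F(1) G.continuous_on_translation] by blast
    have "\<Gamma> #>\<^bsub>G\<^esub> (\<gamma> \<otimes>\<^bsub>G\<^esub> x) = \<Gamma> #>\<^bsub>G\<^esub> x" for x using that G.r_coset_eq_iff by blast
    then show "\<Delta> #>\<^bsub>H\<^esub> F (\<gamma> \<otimes>\<^bsub>G\<^esub> x) = \<Delta> #>\<^bsub>H\<^esub> F x" for x by (metis F(2))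
  qed (fact F)
  then obtain \<theta> where \<theta>: "\<And>\<gamma>. \<gamma> \<in> \<Gamma> \<Longrightarrow> \<theta> \<gamma> \<in> \<Delta>"
      "\<And>\<gamma> x. \<gamma> \<in> \<Gamma> \<Longrightarrow> F (\<gamma> \<otimes>\<^bsub>G\<^esub> x) = \<theta> \<gamma> \<otimes>\<^bsub>H\<^esub> F x" by metis
  have "\<exists>\<gamma>\<in>\<Gamma>. \<forall>y. F' (\<delta> \<otimes>\<^bsub>H\<^esub> y) = \<gamma> \<otimes>\<^bsub>G\<^esub> F' y" if "\<delta> \<in> \<Delta>" for \<delta>
  proof (rule G.lifts_differ_by_translation)
    show "continuous_on UNIV (\<lambda>x. F' (\<delta> \<otimes>\<^bsub>H\<^esub> x))"
      using continuous_on_compose2[OF F'(1) H.continuous_on_translation] by blast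
    have "\<Delta> #>\<^bsub>H\<^esub> (\<delta> \<otimes>\<^bsub>H\<^esub> x) = \<Delta> #>\<^bsub>H\<^esub> x" for x using that H.r_coset_eq_iff by blast
    then show "\<Gamma> #>\<^bsub>G\<^esub> F' (\<delta> \<otimes>\<^bsub>H\<^esub> x) = \<Gamma> #>\<^bsub>G\<^esub> F' x" for x by (metis F'(2))
  qed (fact F')
  then obtain \<theta>' where \<theta>': "\<And>\<delta>. \<delta> \<in> \<Delta> \<Longrightarrow> \<theta>' \<delta> \<in> \<Gamma>"
      "\<And>\<delta> y. \<delta> \<in> \<Delta> \<Longrightarrow> F' (\<delta> \<otimes>\<^bsub>H\<^esub> y) = \<theta>' \<delta> \<otimes>\<^bsub>G\<^esub> F' y" by metis
  have "\<exists>\<delta>\<in>\<Gamma>. \<forall>x. F' (F x) = \<delta> \<otimes>\<^bsub>G\<^esub> x"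
  proof (rule G.lifts_differ_by_translation)
    show "continuous_on UNIV (\<lambda>x. F' (F x))"
      using continuous_on_compose2[OF F'(1) F(1)] by blast
    show "\<Gamma> #>\<^bsub>G\<^esub> F' (F x) = \<Gamma> #>\<^bsub>G\<^esub> x" for x
      by (metis F(2) F'(2) G.r_coset_in_rcosets bij_betw_inv_into_left[OF f(1)])
  qed (rule continuous_on_id)
  then obtain g where g: "g \<in> \<Gamma>" "\<And>x. F' (F x) = g \<otimes>\<^bsub>G\<^esub> x" by blast
  have "\<exists>\<delta>\<in>\<Delta>. \<forall>x. F (F' x) = \<delta> \<otimes>\<^bsub>H\<^esub> x"
  proof (rule H.lifts_differ_by_translation)
    show "continuous_on UNIV (\<lambda>x. F (F' x))"
      using continuous_on_compose2[OF F(1) F'(1)] by blast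
    show "\<Delta> #>\<^bsub>H\<^esub> F (F' x) = \<Delta> #>\<^bsub>H\<^esub> x" for x
      by (metis F(2) F'(2) H.r_coset_in_rcosets bij_betw_inv_into_right[OF f(1)])
  qed (rule continuous_on_id)
  then obtain h where h: "h \<in> \<Delta>" "\<And>x. F (F' x) = h \<otimes>\<^bsub>H\<^esub> x" by blast
  \<comment> \<open>Computing \<open>F' (F \<gamma>)\<close> in two ways shows that \<theta>'
    \<circ> \<theta> is conjugation by \<open>g\<close>.\<close>
  have 1: "\<theta>' (\<theta> \<gamma>) \<otimes>\<^bsub>G\<^esub> g = g \<otimes>\<^bsub>G\<^esub> \<gamma>" if "\<gamma> \<in> \<Gamma>" for \<gamma>
  proof -
    have "F' (F (\<gamma> \<otimes>\<^bsub>G\<^esub> \<one>\<^bsub>G\<^esub>)) = \<theta>' (\<theta> \<gamma>) \<otimes>\<^bsub>G\<^esub> F' (F \<one>\<^bsub>G\<^esub>)"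
      by (simp only: \<theta> \<theta>' that)
    then show ?thesis by (simp add: g)
  qed
  have 2: "\<theta> (\<theta>' \<delta>) \<otimes>\<^bsub>H\<^esub> h = h \<otimes>\<^bsub>H\<^esub> \<delta>" if "\<delta> \<in> \<Delta>" for \<delta>
  proof -
    have "F (F' (\<delta> \<otimes>\<^bsub>H\<^esub> \<one>\<^bsub>H\<^esub>)) = \<theta> (\<theta>' \<delta>) \<otimes>\<^bsub>H\<^esub> F (F' \<one>\<^bsub>H\<^esub>)"
      by (simp only: \<theta> \<theta>' that)
    then show ?thesis by (simp add: h)
  qed
  have hom: "\<theta> (\<gamma> \<otimes>\<^bsub>G\<^esub> \<gamma>') = \<theta> \<gamma> \<otimes>\<^bsub>H\<^esub> \<theta> \<gamma>'" if "\<gamma> \<in> \<Gamma>" "\<gamma>' \<in> \<Gamma>" for \<gamma> \<gamma>'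
  proof -
    have "\<gamma> \<otimes>\<^bsub>G\<^esub> \<gamma>' \<in> \<Gamma>" using that by (rule subgroup.m_closed[OF G.subgroup_\<Gamma>])
    then have "\<theta> (\<gamma> \<otimes>\<^bsub>G\<^esub> \<gamma>') \<otimes>\<^bsub>H\<^esub> F \<one>\<^bsub>G\<^esub> = F (\<gamma> \<otimes>\<^bsub>G\<^esub> \<gamma>' \<otimes>\<^bsub>G\<^esub> \<one>\<^bsub>G\<^esub>)" by (simp only: \<theta>)
    also have "\<dots> = F (\<gamma> \<otimes>\<^bsub>G\<^esub> (\<gamma>' \<otimes>\<^bsub>G\<^esub> \<one>\<^bsub>G\<^esub>))" by simp
    also have "\<dots> = \<theta> \<gamma> \<otimes>\<^bsub>H\<^esub> \<theta> \<gamma>' \<otimes>\<^bsub>H\<^esub> F \<one>\<^bsub>G\<^esub>" using that by (simp only: \<theta> H.m_assoc H.carrier_UNIV UNIV_I)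
    finally show ?thesis by simp
  qed
  have "inj_on \<theta> \<Gamma>"
  proof (rule inj_onI)
    fix \<gamma> \<gamma>' assume *: "\<gamma> \<in> \<Gamma>" "\<gamma>' \<in> \<Gamma>" "\<theta> \<gamma> = \<theta> \<gamma>'"
    then have "g \<otimes>\<^bsub>G\<^esub> \<gamma> = g \<otimes>\<^bsub>G\<^esub> \<gamma>'" using 1 by metis
    then show "\<gamma> = \<gamma>'" by simp
  qed
  moreover have "\<delta> \<in> \<theta> ` \<Gamma>" if \<delta>: "\<delta> \<in> \<Delta>" for \<delta>
  proof -
    \<comment> \<open>\<theta> \<circ> \<theta>' is conjugation by \<open>h\<close>, which is undone
      here beforehand, so that \<theta> (\<theta>' \<delta>') is \<delta>.\<close>
    define \<delta>' where "\<delta>' = inv\<^bsub>H\<^esub> h \<otimes>\<^bsub>H\<^esub> \<delta> \<otimes>\<^bsub>H\<^esub> h"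
    have "\<delta>' \<in> \<Delta>" unfolding \<delta>'_def
      using \<delta> h H.subgroup_\<Gamma> by (simp add: subgroup.m_closed subgroup.m_inv_closed)
    then have "\<theta> (\<theta>' \<delta>') \<otimes>\<^bsub>H\<^esub> h = h \<otimes>\<^bsub>H\<^esub> \<delta>'" by (rule 2)
    also have "\<dots> = \<delta> \<otimes>\<^bsub>H\<^esub> h" by (simp add: \<delta>'_def H.m_assoc[symmetric])
    finally have "\<theta> (\<theta>' \<delta>') = \<delta>" by simp
    then show ?thesis using \<theta>'(1)[OF \<open>\<delta>' \<in> \<Delta>\<close>] by force
  qed
  ultimately have "bij_betw \<theta> \<Gamma> \<Delta>" using \<theta>(1) by (auto simp: bij_betw_def)
  with hom show ?thesis by blast
qed

section \<open>Semidirect products of a cyclic group and \<open>\<int>\<^sup>6\<close>\<close>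

type_synonym Z6 = "int \<times> int \<times> int \<times> int \<times> int \<times> int"

text \<open>Multiples exist in every abelian group, so that congruence modulo q can be expressed
  alike in \<open>Z6\<close> and in \<open>int \<times> Z6\<close>, in a form which additive maps
  respect.\<close>

primrec nsmul :: "nat \<Rightarrow> 'a::ab_group_add \<Rightarrow> 'a" where
  "nsmul 0 x = 0"
| "nsmul (Suc k) x = nsmul k x + x"

lemma nsmul_Pair [simp]: "nsmul k (x, y) = (nsmul k x, nsmul k y)"
  by (induction k) (auto simp: zero_prod_def)

lemma nsmul_int [simp]: "nsmul k (x :: int) = int k * x"
  by (induction k) (auto simp: algebra_simps)

lemma nsmul_diff: "nsmul k (x - y) = nsmul k x - nsmul k y"
  by (induction k) auto

definition mod6 :: "int \<Rightarrow> Z6 \<Rightarrow> Z6" where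
  "mod6 q = (\<lambda>(a, b, c, d, e, f). (a mod q, b mod q, c mod q, d mod q, e mod q, f mod q))"

lemma nsmul_Z6_eq_0:
  assumes "nsmul k (x :: Z6) = 0" "k > 0" shows "x = 0"
  using assms by (cases x) (auto simp: zero_prod_def)

lemma mod6_eq_iff: "mod6 (int q) x = mod6 (int q) y \<longleftrightarrow> (\<exists>w. x - y = nsmul q w)"
  by (cases x; cases y) (auto simp: mod6_def mod_eq_dvd_iff dvd_def)

lemma mod6_mod6 [simp]: "mod6 q (mod6 q x) = mod6 q x"
  by (cases x) (simp add: mod6_def)

text \<open>The tuples with entries in \<open>{0..<q}\<close> stand for the elements of the quotient
  of \<open>Z6\<close> by its q-fold multiples.\<close>

definition fixed_residues :: "nat \<Rightarrow> (Z6 \<Rightarrow> Z6) \<Rightarrow> Z6 set" where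
  "fixed_residues q N = {x \<in> range (mod6 (int q)). mod6 (int q) (N x) = x}"

locale additive_map =
  fixes N :: "'a::ab_group_add \<Rightarrow> 'b::ab_group_add"
  assumes add: "N (x + y) = N x + N y"
begin

lemma zero [simp]: "N 0 = 0"
  using add[of 0 0] by simp

lemma diff: "N (x - y) = N x - N y"
  using add[of "x - y" y] by (simp add: algebra_simps)

lemma nsmul: "N (nsmul k x) = nsmul k (N x)"
  by (induction k) (auto simp: add)

end

lemma additive_map_funpow:
  fixes N :: "'a::ab_group_add \<Rightarrow> 'a"
  assumes "additive_map N" shows "additive_map (N ^^ k)"
  using assms by (induction k) (auto simp: additive_map_def)

lemma mod6_cong:
  assumes "additive_map N" "mod6 (int q) x = mod6 (int q) y"
  shows "mod6 (int q) (N x) = mod6 (int q) (N (y :: Z6))"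
proof -
  interpret additive_map N by fact
  obtain w where "x - y = nsmul q w" using assms(2) mod6_eq_iff by blast
  then have "N x - N y = nsmul q (N w)" by (metis diff nsmul)
  then show ?thesis using mod6_eq_iff by blast
qed

text \<open>Applied in both directions to two maps that are powers of each other, this shows that
  they have the same fixed residues.\<close>

lemma fixed_residues_funpow:
  assumes N: "additive_map N" shows "fixed_residues q N \<subseteq> fixed_residues q (N ^^ k)"
proof
  fix x assume "x \<in> fixed_residues q N"
  then have x: "x \<in> range (mod6 (int q))" "mod6 (int q) (N x) = x"
    by (auto simp: fixed_residues_def)
  then have "mod6 (int q) x = x" by auto
  then have "mod6 (int q) ((N ^^ k) x) = x"
  proof (induction k)
    case (Suc k)
    then show ?case using mod6_cong[OF N, of q "(N ^^ k) x" x] x by simp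
  qed simp
  with x show "x \<in> fixed_residues q (N ^^ k)" by (simp add: fixed_residues_def)
qed

section \<open>The semidirect product and its characteristic subgroup\<close>

locale finite_order_map = additive_map M for M :: "Z6 \<Rightarrow> Z6" +
  fixes m :: nat
  assumes m_pos: "m > 0"
    and funpow_m: "M ^^ m = id"
    and minimal: "\<And>k. 0 < k \<Longrightarrow> k < m \<Longrightarrow> M ^^ k \<noteq> id"
begin

text \<open>The reduction of the exponent modulo m provides negative powers without an inverse of
  \<open>M\<close>.\<close>

definition act :: "int \<Rightarrow> Z6 \<Rightarrow> Z6" where
  "act n = M ^^ nat (n mod int m)"

lemma funpow_mod_m: "M ^^ k = M ^^ (k mod m)"
proof -
  have "M ^^ k = M ^^ (m * (k div m) + k mod m)" by simp
  also have "\<dots> = (M ^^ m) ^^ (k div m) \<circ> M ^^ (k mod m)" by (simp only: funpow_add funpow_mult mult.commute)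
  finally show ?thesis by (simp add: funpow_m)
qed

lemma act_of_nat: "act (int k) = M ^^ k"
  by (metis act_def funpow_mod_m nat_int of_nat_mod)

lemma additive_act: "additive_map (act n)"
  unfolding act_def by (intro additive_map_funpow) unfold_locales

lemma act_zero [simp]: "act n 0 = 0"
  using additive_map.zero[OF additive_act] .

lemma act_dvd: "int m dvd n \<Longrightarrow> act n x = x"
  by (simp add: act_def)

lemma act_eq_id_iff: "(\<forall>x. act n x = x) \<longleftrightarrow> int m dvd n"
proof
  assume *: "\<forall>x. act n x = x"
  have "nat (n mod m) < m" using m_pos by (simp add: nat_less_iff)
  moreover have "M ^^ nat (n mod m) = id" using * by (auto simp: act_def)
  ultimately have "\<not> 0 < nat (n mod m)" using minimal by blast
  moreover have "n mod int m \<ge> 0" using m_pos by simp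
  ultimately show "int m dvd n" by (simp add: dvd_eq_mod_eq_0)
qed (simp add: act_dvd)

lemma act_1: "act 1 = M"
  using act_of_nat[of 1] by simp

definition mul :: "int \<times> Z6 \<Rightarrow> int \<times> Z6 \<Rightarrow> int \<times> Z6" where
  "mul = (\<lambda>(n, x) (k, y). (n + k, x + act n y))"

lemma mul_Pair [simp]: "mul (n, x) (k, y) = (n + k, x + act n y)"
  by (simp add: mul_def)

primrec pow :: "int \<times> Z6 \<Rightarrow> nat \<Rightarrow> int \<times> Z6" where
  "pow g 0 = (0, 0)"
| "pow g (Suc k) = mul (pow g k) g"

lemma fst_pow: "fst (pow g k) = int k * fst g"
  by (induction k) (auto simp: mul_def case_prod_beta algebra_simps)

lemma pow_vector: "pow (0, x) k = (0, nsmul k x)"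
  by (induction k) (auto simp: act_dvd)

lemma pow_generator: "pow (n, 0) k = (int k * n, 0)"
  by (induction k) (auto simp: algebra_simps)

definition transl :: "(int \<times> Z6) set" where
  "transl = {g. int m dvd fst g}"

text \<open>The powers of (1, 0) and (0, x) commute only if \<open>act k\<close> fixes k x, hence x,
  as \<open>Z6\<close> is torsion-free. Conversely, if m divides k, all k-th powers lie in the
  abelian subgroup on which the action is trivial.\<close>

lemma powers_commute_iff:
  assumes "k > 0"
  shows "(\<forall>g h. mul (pow g k) (pow h k) = mul (pow h k) (pow g k)) \<longleftrightarrow> m dvd k"
proof
  assume *: "\<forall>g h. mul (pow g k) (pow h k) = mul (pow h k) (pow g k)"
  have "act (int k) x = x" for x
  proof -
    have "act (int k) (nsmul k x) = nsmul k x"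
      using *[rule_format, of "(1, 0)" "(0, x)"] by (simp add: pow_vector pow_generator act_dvd)
    then have "nsmul k (act (int k) x - x) = 0"
      by (simp add: nsmul_diff additive_map.nsmul[OF additive_act])
    then show ?thesis using nsmul_Z6_eq_0 assms by fastforce
  qed
  then have "int m dvd int k" using act_eq_id_iff by blast
  then show "m dvd k" by simp
next
  assume "m dvd k"
  then have "int m dvd fst (pow g k)" for g by (simp add: fst_pow)
  then show "\<forall>g h. mul (pow g k) (pow h k) = mul (pow h k) (pow g k)"
    by (auto simp: mul_def case_prod_beta act_dvd algebra_simps)
qed

text \<open>Again by torsion-freeness: the m-th power of (0, x) is (0, m x), and an element
  commuting with it acts trivially on x. The right-hand side mentions the multiplication only, hence
  is invariant under isomorphisms.\<close>

lemma transl_iff: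
  "g \<in> transl \<longleftrightarrow> (\<forall>h. mul g (pow h m) = mul (pow h m) g)"
proof
  assume "g \<in> transl"
  then show "\<forall>h. mul g (pow h m) = mul (pow h m) g"
    by (auto simp: transl_def mul_def case_prod_beta act_dvd algebra_simps fst_pow)
next
  assume *: "\<forall>h. mul g (pow h m) = mul (pow h m) g"
  have "act (fst g) x = x" for x
  proof -
    have "act (fst g) (nsmul m x) = nsmul m x"
      using *[rule_format, of "(0, x)"] by (cases g) (simp add: pow_vector act_dvd)
    then have "nsmul m (act (fst g) x - x) = 0"
      by (simp add: nsmul_diff additive_map.nsmul[OF additive_act])
    then show ?thesis using nsmul_Z6_eq_0 m_pos by fastforce
  qed
  then have "int m dvd fst g" using act_eq_id_iff by blast
  then show "g \<in> transl" by (simp add: transl_def)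
qed

lemma mul_idem: "mul g g = g \<Longrightarrow> g = (0, 0)"
  by (cases g) (auto simp: act_dvd)

lemma generator_decomp:
  "(n, x) = mul (int m * (n div int m), x) (pow (1, 0) (nat (n mod int m)))"
  using m_pos by (simp add: pow_generator)

text \<open>An isomorphism may mix the two factors of \<open>int \<times> Z6\<close>, so that only
  fixed classes in the whole product can be compared. The first factor is fixed pointwise and
  contributes q.\<close>

lemma card_fixed_classes:
  assumes q: "q > 0" and N: "additive_map N"
  defines "r \<equiv> map_prod (\<lambda>k. k mod int q) (mod6 (int q))"
  shows "card (r ` {y. r (map_prod id N y) = r y}) = q * card (fixed_residues q N)"
proof -
  have "r ` {y. r (map_prod id N y) = r y} = {0..<int q} \<times> fixed_residues q N"
  proof (intro subset_antisym subsetI)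
    fix z assume "z \<in> r ` {y. r (map_prod id N y) = r y}"
    then obtain k x where "z = (k mod int q, mod6 (int q) x)" "mod6 (int q) (N x) = mod6 (int q) x"
      by (auto simp: r_def)
    then show "z \<in> {0..<int q} \<times> fixed_residues q N"
      using q mod6_cong[OF N, of q "mod6 (int q) x" x] by (auto simp: fixed_residues_def)
  next
    fix z assume "z \<in> {0..<int q} \<times> fixed_residues q N"
    then have "r z = z" "r (map_prod id N z) = r z"
      by (auto simp: r_def fixed_residues_def)
    then show "z \<in> r ` {y. r (map_prod id N y) = r y}"
      by (intro image_eqI[of _ _ z]) simp_all
  qed
  then show ?thesis by (simp add: card_cartesian_product)
qed

end

section \<open>What an isomorphism of semidirect products preserves\<close>

lemma pow_hom:
  assumes "finite_order_map M m" "finite_order_map M' m'"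
    and hom: "\<And>g h. \<theta> (finite_order_map.mul M m g h) = finite_order_map.mul M' m' (\<theta> g) (\<theta> h)"
  shows "\<theta> (finite_order_map.pow M m g k) = finite_order_map.pow M' m' (\<theta> g) k"
proof -
  interpret A: finite_order_map M m by fact
  interpret B: finite_order_map M' m' by fact
  have "\<theta> (0, 0) = (0, 0)"
    by (rule B.mul_idem) (simp flip: hom)
  then show ?thesis by (induction k) (simp_all add: hom)
qed

text \<open>Commutation of all m-th powers passes to the image; used in both directions, this gives
  equality of the orders.\<close>

lemma isomorphic_order_dvd:
  assumes "finite_order_map M m" "finite_order_map M' m'" and "surj \<theta>"
    and hom: "\<And>g h. \<theta> (finite_order_map.mul M m g h) = finite_order_map.mul M' m' (\<theta> g) (\<theta> h)"
  shows "m' dvd m"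
proof -
  interpret A: finite_order_map M m by fact
  interpret B: finite_order_map M' m' by fact
  note pow = pow_hom[OF assms(1,2) hom]
  have "B.mul (B.pow g m) (B.pow h m) = B.mul (B.pow h m) (B.pow g m)" for g h
  proof -
    obtain g' h' where "g = \<theta> g'" "h = \<theta> h'" using \<open>surj \<theta>\<close> by (meson surjD)
    moreover have "A.mul (A.pow g' m) (A.pow h' m) = A.mul (A.pow h' m) (A.pow g' m)"
      using A.powers_commute_iff[OF A.m_pos] dvd_refl by metis
    ultimately show ?thesis by (metis pow hom)
  qed
  then show ?thesis using B.powers_commute_iff[OF A.m_pos] by blast
qed

locale isomorphic_maps =
  A: finite_order_map M m + B: finite_order_map M' m for M M' m +
  fixes \<theta> :: "int \<times> Z6 \<Rightarrow> int \<times> Z6"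
  assumes bij: "bij \<theta>" and hom: "\<theta> (A.mul g h) = B.mul (\<theta> g) (\<theta> h)"
begin

lemmas pow = pow_hom[OF A.finite_order_map_axioms B.finite_order_map_axioms hom]

lemma transl: "\<theta> g \<in> B.transl \<longleftrightarrow> g \<in> A.transl"
proof -
  have "\<theta> g \<in> B.transl \<longleftrightarrow> (\<forall>h. B.mul (\<theta> g) (B.pow (\<theta> h) m) = B.mul (B.pow (\<theta> h) m) (\<theta> g))"
    unfolding B.transl_iff using bij by (metis bij_pointE)
  also have "\<dots> \<longleftrightarrow> g \<in> A.transl"
    unfolding A.transl_iff using bij by (simp flip: pow hom add: bij_is_inj inj_eq)
  finally show ?thesis .
qed

definition l :: int where "l = fst (\<theta> (1, 0))"

text \<open>The restriction of \<theta> to the translations, where both translation subgroups are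
  identified with \<open>int \<times> Z6\<close> by dividing the first component by m.\<close>

definition Q :: "int \<times> Z6 \<Rightarrow> int \<times> Z6" where
  "Q = (\<lambda>(k, x). map_prod (\<lambda>n. n div int m) id (\<theta> (int m * k, x)))"

lemma \<theta>_transl: "\<theta> (int m * k, x) = (int m * fst (Q (k, x)), snd (Q (k, x)))"
  using transl[of "(int m * k, x)"]
  by (cases "\<theta> (int m * k, x)") (auto simp: Q_def A.transl_def B.transl_def)

lemma Q_add: "Q (y + z) = Q y + Q z"
proof (cases y; cases z)
  fix k x k' x' assume [simp]: "y = (k, x)" "z = (k', x')"
  have "\<theta> (int m * (k + k'), x + x') = B.mul (\<theta> (int m * k, x)) (\<theta> (int m * k', x'))"
    by (simp flip: hom add: A.act_dvd distrib_left)
  then show ?thesis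
    unfolding \<theta>_transl using A.m_pos
    by (simp add: B.act_dvd prod_eq_iff flip: distrib_left)
qed

lemma bij_Q: "bij Q"
proof (rule bijI)
  show "inj Q"
  proof (rule injI)
    fix y z assume *: "Q y = Q z"
    obtain k x k' x' where [simp]: "y = (k, x)" "z = (k', x')" by (cases y; cases z) auto
    have "\<theta> (int m * k, x) = \<theta> (int m * k', x')" unfolding \<theta>_transl using * by simp
    then show "y = z" using bij A.m_pos by (simp add: bij_is_inj inj_eq)
  qed
  have "\<exists>y. Q y = (k, x)" for k x
  proof -
    obtain n x' where *: "\<theta> (n, x') = (int m * k, x)"
      using bij by (metis bij_pointE surj_pair)
    then have "(n, x') \<in> A.transl" using transl[of "(n, x')"] by (auto simp: B.transl_def)
    then obtain k' where "n = int m * k'" by (auto simp: A.transl_def)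
    then show ?thesis using * \<theta>_transl[of k' x'] A.m_pos
      by (intro exI[of _ "(k', x')"]) (auto simp: prod_eq_iff)
  qed
  then show "surj Q" by (auto simp: surj_def) metis
qed

text \<open>Conjugation by the element \<open>(1, 0)\<close> acts on the translations as \<open>M\<close>, and conjugation by its
  image acts as \<open>M'\<close> to the power \<open>l\<close>.\<close>

lemma Q_intertwines: "Q (map_prod id M y) = map_prod id (B.act l) (Q y)"
proof (cases y)
  fix k x assume [simp]: "y = (k, x)"
  obtain w where w: "\<theta> (1, 0) = (l, w)" by (cases "\<theta> (1, 0)") (simp add: l_def)
  have "A.mul (1, 0) (int m * k, x) = A.mul (int m * k, M x) (1, 0)"
    by (simp add: A.act_1 add.commute)
  then have "B.mul (\<theta> (1, 0)) (\<theta> (int m * k, x)) = B.mul (\<theta> (int m * k, M x)) (\<theta> (1, 0))"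
    by (simp only: hom[symmetric])
  then show ?thesis
    unfolding \<theta>_transl w using A.m_pos by (simp add: B.act_dvd prod_eq_iff)
qed

text \<open>The preimage of (1, 0) is a translation times a power of (1, 0), and \<theta> keeps
  translations among the translations. Comparing first components modulo m gives the inverse of
  \<open>l\<close>.\<close>

lemma l_unit: "\<exists>r. (int r * l) mod int m = 1 mod int m"
proof -
  obtain n x where *: "\<theta> (n, x) = (1, 0)" using bij by (metis bij_pointE surj_pair)
  define r where "r = nat (n mod int m)"
  have "\<theta> (n, x) = B.mul (\<theta> (int m * (n div int m), x)) (B.pow (\<theta> (1, 0)) r)"
    unfolding r_def by (subst A.generator_decomp) (simp only: hom pow)
  then have "1 = int m * fst (Q (n div int m, x)) + int r * l"
    unfolding * \<theta>_transl by (auto simp: prod_eq_iff B.mul_def case_prod_beta B.fst_pow l_def)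
  then show ?thesis by (metis mod_mult_self4)
qed

text \<open>\<open>Q\<close> is compatible with reduction modulo q and turns the action of M into
  that of the power of M' with exponent \<open>l\<close>. As \<open>l\<close> is a unit modulo m,
  that power generates the same cyclic group as M'.\<close>

lemma card_fixed_residues:
  assumes "q > 0"
  shows "card (fixed_residues q (M ^^ d)) = card (fixed_residues q (M' ^^ d))"
proof -
  define N where "N = B.act l ^^ d"
  have addN: "additive_map N" "additive_map (M ^^ d)" "additive_map (M' ^^ d)"
    unfolding N_def by (intro additive_map_funpow B.additive_act; unfold_locales)+
  define r where "r = map_prod (\<lambda>k. k mod int q) (mod6 (int q))"
  have r_eq: "r y = r z \<longleftrightarrow> (\<exists>w. y - z = nsmul q w)" for y z
    by (cases y; cases z) (auto simp: r_def mod_eq_dvd_iff mod6_eq_iff dvd_def)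
  interpret Q: additive_map Q by unfold_locales (rule Q_add)
  have rQ: "r (Q y) = r (Q z) \<longleftrightarrow> r y = r z" for y z
  proof -
    have "r (Q y) = r (Q z) \<longleftrightarrow> (\<exists>w. Q (y - z) = nsmul q (Q w))"
      unfolding r_eq Q.diff using bij_Q by (metis bij_pointE)
    also have "\<dots> \<longleftrightarrow> r y = r z"
      unfolding r_eq using bij_Q by (simp flip: Q.nsmul add: bij_is_inj inj_eq)
    finally show ?thesis .
  qed
  have QN: "Q (map_prod id (M ^^ d) y) = map_prod id N (Q y)" for y
    unfolding N_def
  proof (induction d)
    case (Suc d)
    have "Q (map_prod id (M ^^ Suc d) y) = Q (map_prod id M (map_prod id (M ^^ d) y))"
      by (simp add: prod.map_comp)
    also have "\<dots> = map_prod id (B.act l) (map_prod id (B.act l ^^ d) (Q y))"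
      by (simp only: Q_intertwines Suc)
    finally show ?case by (simp add: prod.map_comp comp_def id_def)
  qed (simp add: map_prod.identity)
  let ?A = "{y. r (map_prod id (M ^^ d) y) = r y}" and ?B = "{y. r (map_prod id N y) = r y}"
  have "?B = Q ` ?A"
  proof -
    have "Q y \<in> ?B \<longleftrightarrow> y \<in> ?A" for y by (simp flip: QN add: rQ)
    moreover obtain P where "\<And>z. Q (P z) = z" using bij_Q by (metis bij_pointE)
    ultimately show ?thesis by (metis (no_types, lifting) image_eqI subset_antisym subsetI image_subset_iff)
  qed
  \<comment> \<open>By \<open>rQ\<close>, the map which \<open>Q\<close> induces on classes modulo q
    is well defined and injective.\<close>
  moreover have "card (r ` Q ` ?A) = card (r ` ?A)"
  proof -
    have "r ` Q ` ?A = (\<lambda>z. r (Q (inv_into ?A r z))) ` r ` ?A"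
    proof -
      have "r (Q (inv_into ?A r (r y))) = r (Q y)" if "y \<in> ?A" for y
        unfolding rQ using that by (intro f_inv_into_f) auto
      then show ?thesis unfolding image_image by (intro image_cong) simp_all
    qed
    moreover have "inj_on (\<lambda>z. r (Q (inv_into ?A r z))) (r ` ?A)"
      by (rule inj_onI) (auto simp: rQ f_inv_into_f)
    ultimately show ?thesis by (simp add: card_image)
  qed
  ultimately have "q * card (fixed_residues q N) = q * card (fixed_residues q (M ^^ d))"
    by (metis A.card_fixed_classes[OF assms addN(1), folded r_def]
        A.card_fixed_classes[OF assms addN(2), folded r_def])
  then have 1: "card (fixed_residues q N) = card (fixed_residues q (M ^^ d))" using assms by simp
  have N: "N = (M' ^^ d) ^^ nat (l mod int m)"
    unfolding N_def B.act_def funpow_mult by (simp add: mult.commute)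
  \<comment> \<open>The inverse of \<open>l\<close> modulo m, by which M' is recovered from its
    power with exponent \<open>l\<close>.\<close>
  obtain j where j: "(int j * l) mod int m = 1 mod int m" using l_unit by blast
  have "M' ^^ d = N ^^ j"
  proof -
    have "N ^^ j = (M' ^^ (j * nat (l mod int m))) ^^ d"
      unfolding N funpow_mult by (simp add: ac_simps)
    also have "M' ^^ (j * nat (l mod int m)) = B.act (int j * l)"
    proof -
      have "B.act (int (j * nat (l mod int m))) = B.act (int j * l)"
        using A.m_pos by (simp add: B.act_def mod_mult_right_eq)
      then show ?thesis by (simp only: B.act_of_nat)
    qed
    also have "\<dots> = B.act 1" by (simp add: B.act_def j)
    finally show ?thesis by (simp add: B.act_1)
  qed
  then have "fixed_residues q (M' ^^ d) = fixed_residues q N"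
    using fixed_residues_funpow[OF addN(1), of q j]
      fixed_residues_funpow[OF addN(3), of q "nat (l mod int m)"] N by auto
  with 1 show ?thesis by simp
qed

end

section \<open>Wedge products of linear forms\<close>

text \<open>The wedge product of the linear forms with indices in \<open>I\<close>, as the Leibniz
  sum of a determinant.\<close>

definition det_form :: "(nat \<Rightarrow> 'a \<Rightarrow> real) \<Rightarrow> nat list \<Rightarrow> 'a form" where
  "det_form \<epsilon> I vs = (\<Sum>\<sigma> | \<sigma> permutes {..<length I}.
     of_int (sign \<sigma>) * (\<Prod>i<length I. \<epsilon> (I ! i) (vs ! \<sigma> i)))"

definition tensor_form :: "(nat \<Rightarrow> 'a \<Rightarrow> real) \<Rightarrow> nat list \<Rightarrow> 'a form" where
  "tensor_form \<epsilon> I vs = (\<Prod>i<length I. \<epsilon> (I ! i) (vs ! i))"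

lemma sign_compose_lessThan:
  fixes p q :: "nat \<Rightarrow> nat"
  shows "p permutes {..<n} \<Longrightarrow> q permutes {..<n} \<Longrightarrow> sign (p \<circ> q) = sign p * sign q"
  by (intro sign_compose permutes_imp_permutation) auto

lemma sum_sign_permute_right:
  fixes F :: "nat \<Rightarrow> nat \<Rightarrow> real"
  assumes \<pi>: "\<pi> permutes {..<n}"
  shows "(\<Sum>\<sigma> | \<sigma> permutes {..<n}. of_int (sign \<sigma>) * (\<Prod>i<n. F i (\<sigma> (\<pi> i)))) =
    of_int (sign \<pi>) * (\<Sum>\<sigma> | \<sigma> permutes {..<n}. of_int (sign \<sigma>) * (\<Prod>i<n. F i (\<sigma> i)))"
    (is "?L = _ * ?R")
proof -
  have [simp]: "real_of_int (sign \<pi>) * real_of_int (sign \<pi>) = 1" by (simp flip: of_int_mult)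
  have "of_int (sign \<pi>) * ?R = of_int (sign \<pi>) * (\<Sum>\<sigma> | \<sigma> permutes {..<n}.
      of_int (sign (\<sigma> \<circ> \<pi>)) * (\<Prod>i<n. F i ((\<sigma> \<circ> \<pi>) i)))"
    by (subst sum_permutations_compose_right[OF \<pi>]) simp
  also have "\<dots> = (\<Sum>\<sigma> | \<sigma> permutes {..<n}.
      of_int (sign \<pi> * sign \<pi>) * of_int (sign \<sigma>) * (\<Prod>i<n. F i (\<sigma> (\<pi> i))))"
    unfolding sum_distrib_left
    by (intro sum.cong refl) (simp add: sign_compose_lessThan[OF _ \<pi>] ac_simps)
  finally show ?thesis by simp
qed

lemma sign_transposition_sum_zero:
  fixes F :: "(nat \<Rightarrow> nat) \<Rightarrow> real"
  assumes "i < n" "j < n" "i \<noteq> j"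
    and F: "\<And>\<sigma>. F (Transposition.transpose i j \<circ> \<sigma>) = F \<sigma>"
  shows "(\<Sum>\<sigma> | \<sigma> permutes {..<n}. of_int (sign \<sigma>) * F \<sigma>) = 0" (is "?S = 0")
proof -
  have t: "Transposition.transpose i j permutes {..<n}" using assms by (intro permutes_swap_id) auto
  have "?S = (\<Sum>\<sigma> | \<sigma> permutes {..<n}. of_int (sign (Transposition.transpose i j \<circ> \<sigma>)) * F (Transposition.transpose i j \<circ> \<sigma>))"
    by (rule setum_permutations_compose_left[OF t])
  also have "\<dots> = (\<Sum>\<sigma> | \<sigma> permutes {..<n}. - (of_int (sign \<sigma>) * F \<sigma>))"
    using t assms by (intro sum.cong refl)
      (simp add: sign_compose_lessThan[OF t] F sign_swap_id)
  also have "\<dots> = - ?S" by (simp add: sum_negf)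
  finally show ?thesis by simp
qed

lemma alternating_det_form:
  assumes "\<And>i. linear (\<epsilon> i)" and "length I = k"
  shows "alternating k (det_form \<epsilon> I)"
  unfolding alternating_def
proof (intro conjI allI impI; elim conjE)
  fix vs :: "'a list" and r assume vs: "length vs = k" "r < k"
  have "linear (\<lambda>x. \<Prod>i<k. \<epsilon> (I ! i) (vs[r := x] ! \<sigma> i))" if \<sigma>: "\<sigma> permutes {..<k}" for \<sigma>
  proof -
    \<comment> \<open>The only factor of the product into which the argument in slot
      \<open>r\<close> enters.\<close>
    define s where "s = inv_into UNIV \<sigma> r"
    have s: "\<sigma> s = r" "s < k"
      using \<sigma> vs permutes_inverses(1) permutes_in_image[OF permutes_inv[OF \<sigma>], of r]
      by (auto simp: s_def)
    have "(\<Prod>i<k. \<epsilon> (I ! i) (vs[r := x] ! \<sigma> i)) =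
        (\<Prod>i\<in>{..<k} - {s}. \<epsilon> (I ! i) (vs ! \<sigma> i)) *\<^sub>R \<epsilon> (I ! s) x" for x
    proof -
      have "\<epsilon> (I ! i) (vs[r := x] ! \<sigma> i) = \<epsilon> (I ! i) (vs ! \<sigma> i)" if "i \<noteq> s" for i
        using that s permutes_inj[OF \<sigma>] by (metis inj_eq nth_list_update_neq)
      then show ?thesis
        using s vs by (subst prod.remove[of _ s]) (auto simp: mult.commute)
    qed
    then show ?thesis by (simp only: linear_compose_scale_right[OF assms(1)])
  qed
  then have "linear (\<lambda>x. of_int (sign \<sigma>) *\<^sub>R (\<Prod>i<k. \<epsilon> (I ! i) (vs[r := x] ! \<sigma> i)))"
    if "\<sigma> permutes {..<k}" for \<sigma>
    using that by (intro linear_compose_scale_right)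
  then show "linear (\<lambda>x. det_form \<epsilon> I (vs[r := x]))"
    unfolding det_form_def assms(2) by (intro linear_compose_sum) (auto simp: finite_permutations)
next
  fix vs :: "'a list" and i j assume vs: "length vs = k" "i < j" "j < k" "vs ! i = vs ! j"
  have *: "vs ! (Transposition.transpose i j \<circ> \<sigma>) s = vs ! \<sigma> s" for \<sigma> :: "nat \<Rightarrow> nat" and s
    using vs by (simp add: Transposition.transpose_def)
  show "det_form \<epsilon> I vs = 0"
    unfolding det_form_def assms(2) using vs
    by (intro sign_transposition_sum_zero[where i = i and j = j]) (simp_all only: *)
qed

lemma det_form_swap: "det_form \<epsilon> (P @ x # y # R) vs = - det_form \<epsilon> (P @ y # x # R) vs"
proof -
  let ?n = "length (P @ x # y # R)" and ?I = "P @ x # y # R" and ?J = "P @ y # x # R"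
  let ?t = "Transposition.transpose (length P) (Suc (length P))"
  have t: "?t permutes {..<?n}" by (intro permutes_swap_id) auto
  have nth: "?J ! i = ?I ! ?t i" for i
    by (auto simp: Transposition.transpose_def nth_append nth_Cons split: nat.splits)
  have prod: "(\<Prod>i<?n. \<epsilon> (?I ! i) (vs ! \<sigma> (?t i))) = (\<Prod>i<?n. \<epsilon> (?J ! i) (vs ! \<sigma> i))" for \<sigma>
    by (rule prod.reindex_bij_witness[of _ ?t ?t])
       (use t in \<open>auto simp: nth permutes_in_image simp flip: lessThan_iff\<close>)
  have "det_form \<epsilon> ?J vs = (\<Sum>\<sigma> | \<sigma> permutes {..<?n}. of_int (sign \<sigma>) * (\<Prod>i<?n. \<epsilon> (?I ! i) (vs ! \<sigma> (?t i))))"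
    unfolding prod by (simp add: det_form_def)
  also have "\<dots> = of_int (sign ?t) * det_form \<epsilon> ?I vs"
    unfolding det_form_def by (rule sum_sign_permute_right[OF t])
  finally show ?thesis by (simp add: sign_swap_id)
qed

lemma det_form_repeated: "det_form \<epsilon> (P @ x # x # R) vs = 0"
  using det_form_swap[of \<epsilon> P x x R vs] by simp

text \<open>Insertion sort that keeps track of the sign; a repeated index yields the sign 0, since
  the product vanishes.\<close>

primrec insert_sign :: "nat \<Rightarrow> nat list \<Rightarrow> int \<times> nat list" where
  "insert_sign x [] = (1, [x])"
| "insert_sign x (y # ys) = (if x < y then (1, x # y # ys) else if x = y then (0, x # y # ys)
     else let (s, zs) = insert_sign x ys in (- s, y # zs))"

primrec sort_sign :: "nat list \<Rightarrow> int \<times> nat list" where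
  "sort_sign [] = (1, [])"
| "sort_sign (x # xs) = (let (s, ys) = sort_sign xs; (t, zs) = insert_sign x ys in (s * t, zs))"

text \<open>The prefix collects the entries that have been passed already, which lets the induction
  proceed behind them by adjacent exchanges.\<close>

lemma det_form_insert_sign:
  "det_form \<epsilon> (P @ x # ys) vs =
     of_int (fst (insert_sign x ys)) * det_form \<epsilon> (P @ snd (insert_sign x ys)) vs"
proof (induction ys arbitrary: P)
  case (Cons y ys)
  show ?case
    using det_form_swap[of \<epsilon> P x y ys vs] Cons[of "P @ [y]"] det_form_repeated[of \<epsilon> P x ys vs]
    by (auto simp: case_prod_beta Let_def)
qed simp

lemma det_form_sort_sign:
  "det_form \<epsilon> (P @ xs) vs =
     of_int (fst (sort_sign xs)) * det_form \<epsilon> (P @ snd (sort_sign xs)) vs"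
proof (induction xs arbitrary: P)
  case (Cons x xs)
  show ?case
    using Cons[of "P @ [x]"] det_form_insert_sign[of \<epsilon> P x "snd (sort_sign xs)" vs]
    by (simp add: case_prod_beta Let_def)
qed simp

lemma wedge_cong:
  assumes "\<And>ws. length ws = k \<Longrightarrow> \<alpha> ws = \<alpha>' ws" "\<And>ws. length ws = l \<Longrightarrow> \<beta> ws = \<beta>' ws"
  shows "wedge k l \<alpha> \<beta> vs = wedge k l \<alpha>' \<beta>' vs"
  unfolding wedge_def using assms by (intro arg_cong2[where f = divide] sum.cong) auto

lemma wedge_sum_left:
  "wedge k l (\<lambda>ws. \<Sum>t\<in>A. c t * \<alpha> t ws) \<beta> vs = (\<Sum>t\<in>A. c t * wedge k l (\<alpha> t) \<beta> vs)"
  unfolding wedge_def sum_divide_distrib sum_distrib_left sum_distrib_right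
  by (subst sum.swap) (simp add: ac_simps)

lemma wedge_sum_right:
  "wedge k l \<alpha> (\<lambda>ws. \<Sum>t\<in>A. c t * \<beta> t ws) vs = (\<Sum>t\<in>A. c t * wedge k l \<alpha> (\<beta> t) vs)"
  unfolding wedge_def sum_divide_distrib sum_distrib_left sum_distrib_right
  by (subst sum.swap) (simp add: ac_simps)

text \<open>\<tau> on the first k positions and \<rho>, shifted by k, on the others form one
  permutation of all positions; reindexing by it costs the product of the two signs.\<close>

lemma sum_sign_blocks:
  assumes \<tau>: "\<tau> permutes {..<k}" and \<rho>: "\<rho> permutes {..<l}"
    and len: "length I = k" "length J = l"
  shows "(\<Sum>\<sigma> | \<sigma> permutes {..<k + l}. of_int (sign \<sigma>) *
      ((\<Prod>i<k. \<epsilon> (I ! i) (vs ! \<sigma> (\<tau> i))) * (\<Prod>j<l. \<epsilon> (J ! j) (vs ! \<sigma> (k + \<rho> j))))) =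
    of_int (sign \<tau>) * of_int (sign \<rho>) * det_form \<epsilon> (I @ J) vs"
proof -
  define \<rho>' where "\<rho>' = map_permutation {..<l} ((+) k) \<rho>"
  have bij: "bij_betw ((+) k) {..<l} {k..<k + l}"
    by (rule bij_betwI[of _ _ _ "\<lambda>i. i - k"]) auto
  then have \<rho>': "\<rho>' permutes {k..<k + l}"
    unfolding \<rho>'_def using \<rho> by (rule map_permutation_permutes)
  have sign_\<rho>': "sign \<rho>' = sign \<rho>"
    unfolding \<rho>'_def using \<rho> by (intro sign_map_permutation) auto
  have \<rho>'_shift: "\<rho>' (k + j) = k + \<rho> j" if "j < l" for j
    unfolding \<rho>'_def using that by (intro map_permutation_apply) auto
  have perms: "\<tau> permutes {..<k + l}" "\<rho>' permutes {..<k + l}"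
    using \<tau> \<rho>' by (auto elim!: permutes_subset)
  define \<pi> where "\<pi> = \<tau> \<circ> \<rho>'"
  have \<pi>: "\<pi> permutes {..<k + l}" unfolding \<pi>_def using perms by (intro permutes_compose)
  have sign_\<pi>: "sign \<pi> = sign \<tau> * sign \<rho>"
    unfolding \<pi>_def by (simp add: sign_compose_lessThan[OF perms] sign_\<rho>')
  have \<pi>_left: "\<pi> i = \<tau> i" if "i < k" for i
    using permutes_not_in[OF \<rho>', of i] that by (simp add: \<pi>_def)
  have \<pi>_right: "\<pi> (k + j) = k + \<rho> j" if "j < l" for j
    using permutes_not_in[OF \<tau>, of "k + \<rho> j"] that by (simp add: \<pi>_def \<rho>'_shift)
  have "(\<Prod>i<k + l. \<epsilon> ((I @ J) ! i) (vs ! \<sigma> (\<pi> i))) =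
      (\<Prod>i<k. \<epsilon> (I ! i) (vs ! \<sigma> (\<tau> i))) * (\<Prod>j<l. \<epsilon> (J ! j) (vs ! \<sigma> (k + \<rho> j)))" for \<sigma>
  proof -
    have "(\<Prod>i<k + l. \<epsilon> ((I @ J) ! i) (vs ! \<sigma> (\<pi> i))) =
        (\<Prod>i\<in>{..<k}. \<epsilon> ((I @ J) ! i) (vs ! \<sigma> (\<pi> i))) * (\<Prod>i\<in>{k..<k + l}. \<epsilon> ((I @ J) ! i) (vs ! \<sigma> (\<pi> i)))"
      by (subst prod.union_disjoint[symmetric]) (auto intro!: prod.cong)
    also have "(\<Prod>i\<in>{k..<k + l}. \<epsilon> ((I @ J) ! i) (vs ! \<sigma> (\<pi> i))) =
        (\<Prod>j<l. \<epsilon> ((I @ J) ! (k + j)) (vs ! \<sigma> (\<pi> (k + j))))"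
      using bij by (rule prod.reindex_bij_betw[symmetric])
    finally show ?thesis by (simp add: \<pi>_left \<pi>_right len nth_append)
  qed
  then show ?thesis
    using sum_sign_permute_right[OF \<pi>, of "\<lambda>i s. \<epsilon> ((I @ J) ! i) (vs ! s)"] len
    by (simp add: det_form_def sign_\<pi>)
qed

text \<open>After both determinants are expanded, all pairs of permutations contribute the same
  amount, and there are as many pairs as the normalisation divides by.\<close>

lemma wedge_det_form:
  assumes len: "length I = k" "length J = l"
  shows "wedge k l (det_form \<epsilon> I) (det_form \<epsilon> J) vs = det_form \<epsilon> (I @ J) vs"
proof -
  let ?S = "\<lambda>n. {\<sigma>. \<sigma> permutes {..<n::nat}}"
  have "(\<Sum>\<sigma>\<in>?S (k + l). of_int (sign \<sigma>) * det_form \<epsilon> I (map (\<lambda>i. vs ! \<sigma> i) [0..<k]) *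
        det_form \<epsilon> J (map (\<lambda>i. vs ! \<sigma> i) [k..<k + l])) =
      (\<Sum>\<sigma>\<in>?S (k + l). \<Sum>\<tau>\<in>?S k. \<Sum>\<rho>\<in>?S l. of_int (sign \<tau>) * of_int (sign \<rho>) * (of_int (sign \<sigma>) *
        ((\<Prod>i<k. \<epsilon> (I ! i) (vs ! \<sigma> (\<tau> i))) * (\<Prod>j<l. \<epsilon> (J ! j) (vs ! \<sigma> (k + \<rho> j))))))"
  proof (intro sum.cong refl)
    fix \<sigma>
    have I: "det_form \<epsilon> I (map (\<lambda>i. vs ! \<sigma> i) [0..<k]) =
        (\<Sum>\<tau>\<in>?S k. of_int (sign \<tau>) * (\<Prod>i<k. \<epsilon> (I ! i) (vs ! \<sigma> (\<tau> i))))"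
      unfolding det_form_def len
    proof (intro sum.cong refl arg_cong2[where f = "(*)"] prod.cong)
      fix \<tau> i assume "\<tau> \<in> ?S k" "i \<in> {..<k}"
      then have "\<tau> i < k" using permutes_in_image[of \<tau> "{..<k}" i] by simp
      then show "\<epsilon> (I ! i) (map (\<lambda>i. vs ! \<sigma> i) [0..<k] ! \<tau> i) = \<epsilon> (I ! i) (vs ! \<sigma> (\<tau> i))" by simp
    qed
    have J: "det_form \<epsilon> J (map (\<lambda>i. vs ! \<sigma> i) [k..<k + l]) =
        (\<Sum>\<rho>\<in>?S l. of_int (sign \<rho>) * (\<Prod>j<l. \<epsilon> (J ! j) (vs ! \<sigma> (k + \<rho> j))))"
      unfolding det_form_def len
    proof (intro sum.cong refl arg_cong2[where f = "(*)"] prod.cong)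
      fix \<rho> i assume "\<rho> \<in> ?S l" "i \<in> {..<l}"
      then have "\<rho> i < l" using permutes_in_image[of \<rho> "{..<l}" i] by simp
      then show "\<epsilon> (J ! i) (map (\<lambda>i. vs ! \<sigma> i) [k..<k + l] ! \<rho> i) = \<epsilon> (J ! i) (vs ! \<sigma> (k + \<rho> i))" by simp
    qed
    show "of_int (sign \<sigma>) * det_form \<epsilon> I (map (\<lambda>i. vs ! \<sigma> i) [0..<k]) *
        det_form \<epsilon> J (map (\<lambda>i. vs ! \<sigma> i) [k..<k + l]) =
      (\<Sum>\<tau>\<in>?S k. \<Sum>\<rho>\<in>?S l. of_int (sign \<tau>) * of_int (sign \<rho>) * (of_int (sign \<sigma>) *
        ((\<Prod>i<k. \<epsilon> (I ! i) (vs ! \<sigma> (\<tau> i))) * (\<Prod>j<l. \<epsilon> (J ! j) (vs ! \<sigma> (k + \<rho> j))))))"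
      unfolding I J sum_distrib_left sum_distrib_right by (subst sum.swap) (simp add: ac_simps)
  qed
  also have "\<dots> = (\<Sum>\<tau>\<in>?S k. \<Sum>\<rho>\<in>?S l. of_int (sign \<tau>) * of_int (sign \<rho>) *
      (\<Sum>\<sigma>\<in>?S (k + l). of_int (sign \<sigma>) *
        ((\<Prod>i<k. \<epsilon> (I ! i) (vs ! \<sigma> (\<tau> i))) * (\<Prod>j<l. \<epsilon> (J ! j) (vs ! \<sigma> (k + \<rho> j))))))"
    unfolding sum_distrib_left
    by (rule trans[OF sum.swap], intro sum.cong[OF refl], rule sum.swap)
  also have "\<dots> = (\<Sum>\<tau>\<in>?S k. \<Sum>\<rho>\<in>?S l. of_int (sign \<tau>) * of_int (sign \<rho>) *
      (of_int (sign \<tau>) * of_int (sign \<rho>) * det_form \<epsilon> (I @ J) vs))"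
    by (intro sum.cong refl arg_cong2[where f = "(*)"] sum_sign_blocks len) auto
  also have "\<dots> = (\<Sum>\<tau>\<in>?S k. \<Sum>\<rho>\<in>?S l. det_form \<epsilon> (I @ J) vs)"
  proof (intro sum.cong refl)
    fix \<tau> \<rho> :: "nat \<Rightarrow> nat"
    have "of_int (sign \<tau>) * of_int (sign \<rho>) * (of_int (sign \<tau>) * of_int (sign \<rho>) * x) =
        of_int ((sign \<tau> * sign \<tau>) * (sign \<rho> * sign \<rho>)) * x" for x :: real
      by (simp only: of_int_mult ac_simps)
    then show "of_int (sign \<tau>) * of_int (sign \<rho>) *
      (of_int (sign \<tau>) * of_int (sign \<rho>) * det_form \<epsilon> (I @ J) vs) = det_form \<epsilon> (I @ J) vs" by simp
  qed
  also have "\<dots> = fact k * fact l * det_form \<epsilon> (I @ J) vs"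
    by (simp add: card_permutations)
  finally show ?thesis by (simp add: wedge_def)
qed

text \<open>A tensor is a determinant of which only the identity permutation is kept; the
  normalisation is therefore cancelled only in part, and 1/k! remains.\<close>

lemma wedge_tensor_det_form:
  assumes len: "length I = k" "length J = l"
  shows "wedge k l (tensor_form \<epsilon> I) (det_form \<epsilon> J) vs = det_form \<epsilon> (I @ J) vs / fact k"
proof -
  let ?S = "\<lambda>n. {\<sigma>. \<sigma> permutes {..<n::nat}}"
  have "(\<Sum>\<sigma>\<in>?S (k + l). of_int (sign \<sigma>) * tensor_form \<epsilon> I (map (\<lambda>i. vs ! \<sigma> i) [0..<k]) *
        det_form \<epsilon> J (map (\<lambda>i. vs ! \<sigma> i) [k..<k + l])) =
      (\<Sum>\<sigma>\<in>?S (k + l). \<Sum>\<rho>\<in>?S l. of_int (sign \<rho>) * (of_int (sign \<sigma>) *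
        ((\<Prod>i<k. \<epsilon> (I ! i) (vs ! \<sigma> (id i))) * (\<Prod>j<l. \<epsilon> (J ! j) (vs ! \<sigma> (k + \<rho> j))))))"
  proof (intro sum.cong refl)
    fix \<sigma>
    have J: "det_form \<epsilon> J (map (\<lambda>i. vs ! \<sigma> i) [k..<k + l]) =
        (\<Sum>\<rho>\<in>?S l. of_int (sign \<rho>) * (\<Prod>j<l. \<epsilon> (J ! j) (vs ! \<sigma> (k + \<rho> j))))"
      unfolding det_form_def len
    proof (intro sum.cong refl arg_cong2[where f = "(*)"] prod.cong)
      fix \<rho> i assume "\<rho> \<in> ?S l" "i \<in> {..<l}"
      then have "\<rho> i < l" using permutes_in_image[of \<rho> "{..<l}" i] by simp
      then show "\<epsilon> (J ! i) (map (\<lambda>i. vs ! \<sigma> i) [k..<k + l] ! \<rho> i) = \<epsilon> (J ! i) (vs ! \<sigma> (k + \<rho> i))" by simp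
    qed
    have I: "tensor_form \<epsilon> I (map (\<lambda>i. vs ! \<sigma> i) [0..<k]) = (\<Prod>i<k. \<epsilon> (I ! i) (vs ! \<sigma> (id i)))"
      unfolding tensor_form_def len by (intro prod.cong) auto
    show "of_int (sign \<sigma>) * tensor_form \<epsilon> I (map (\<lambda>i. vs ! \<sigma> i) [0..<k]) *
        det_form \<epsilon> J (map (\<lambda>i. vs ! \<sigma> i) [k..<k + l]) =
      (\<Sum>\<rho>\<in>?S l. of_int (sign \<rho>) * (of_int (sign \<sigma>) *
        ((\<Prod>i<k. \<epsilon> (I ! i) (vs ! \<sigma> (id i))) * (\<Prod>j<l. \<epsilon> (J ! j) (vs ! \<sigma> (k + \<rho> j))))))"
      unfolding I J sum_distrib_left sum_distrib_right by (simp add: ac_simps)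
  qed
  also have "\<dots> = (\<Sum>\<rho>\<in>?S l. of_int (sign \<rho>) * (of_int (sign (id :: nat \<Rightarrow> nat)) * of_int (sign \<rho>) * det_form \<epsilon> (I @ J) vs))"
    by (rule trans[OF sum.swap], unfold sum_distrib_left[symmetric],
        intro sum.cong refl arg_cong2[where f = "(*)"] sum_sign_blocks len) (auto simp: permutes_def)
  also have "\<dots> = (\<Sum>\<rho>\<in>?S l. of_int (sign \<rho> * sign \<rho>) * det_form \<epsilon> (I @ J) vs)"
    by (simp add: ac_simps del: sign_idempotent)
  also have "\<dots> = fact l * det_form \<epsilon> (I @ J) vs"
    by (simp add: card_permutations)
  finally show ?thesis by (simp add: wedge_def)
qed

section \<open>The constant \<open>G\<^sub>2\<close>-structure\<close>

text \<open>Formal integer combinations of monomials make the exterior algebra executable.\<close>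

definition list_form :: "(nat \<Rightarrow> 'a \<Rightarrow> real) \<Rightarrow> (int \<times> nat list) list \<Rightarrow> 'a form" where
  "list_form \<epsilon> L vs = (\<Sum>(s, I)\<leftarrow>L. of_int s * det_form \<epsilon> I vs)"

definition list_wedge :: "(int \<times> nat list) list \<Rightarrow> (int \<times> nat list) list \<Rightarrow> (int \<times> nat list) list" where
  "list_wedge A B = concat (map (\<lambda>(s, I). map (\<lambda>(t, J). (s * t, I @ J)) B) A)"

lemma list_form_simps [simp]:
  "list_form \<epsilon> [] vs = 0"
  "list_form \<epsilon> ((s, I) # L) vs = of_int s * det_form \<epsilon> I vs + list_form \<epsilon> L vs"
  "list_form \<epsilon> (A @ B) vs = list_form \<epsilon> A vs + list_form \<epsilon> B vs"
  by (simp_all add: list_form_def)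

lemma wedge_linear_left:
  "wedge k l (\<lambda>_. 0) \<beta> vs = 0"
  "wedge k l (\<lambda>ws. c * \<alpha> ws + \<alpha>' ws) \<beta> vs = c * wedge k l \<alpha> \<beta> vs + wedge k l \<alpha>' \<beta> vs"
  by (simp_all add: wedge_def sum_distrib_left sum.distrib add_divide_distrib algebra_simps)

lemma wedge_linear_right:
  "wedge k l \<alpha> (\<lambda>_. 0) vs = 0"
  "wedge k l \<alpha> (\<lambda>ws. c * \<beta> ws + \<beta>' ws) vs = c * wedge k l \<alpha> \<beta> vs + wedge k l \<alpha> \<beta>' vs"
  by (simp_all add: wedge_def sum_distrib_left sum.distrib add_divide_distrib algebra_simps)

definition has_degree :: "nat \<Rightarrow> (int \<times> nat list) list \<Rightarrow> bool" where
  "has_degree k L \<longleftrightarrow> list_all (\<lambda>(s, I). length I = k) L"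

text \<open>The factor \<open>c\<close> serves two cases: 1 for a monomial \<open>det_form\<close>,
  and 1/k! for a tensor.\<close>

lemma wedge_list_form_right:
  assumes "has_degree l B" and "\<And>J. length J = l \<Longrightarrow> wedge k l \<alpha> (det_form \<epsilon> J) vs = c * det_form \<epsilon> (I @ J) vs"
  shows "wedge k l \<alpha> (list_form \<epsilon> B) vs = c * list_form \<epsilon> (list_wedge [(1, I)] B) vs"
  using assms(1)
proof (induction B)
  case (Cons b B)
  obtain t J where b: "b = (t, J)" by (cases b)
  have "list_form \<epsilon> (b # B) = (\<lambda>ws. of_int t * det_form \<epsilon> J ws + list_form \<epsilon> B ws)"
    by (simp add: b fun_eq_iff)
  then have "wedge k l \<alpha> (list_form \<epsilon> (b # B)) vs =
      of_int t * wedge k l \<alpha> (det_form \<epsilon> J) vs + wedge k l \<alpha> (list_form \<epsilon> B) vs"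
    by (simp only: wedge_linear_right)
  moreover have "list_form \<epsilon> (list_wedge [(1, I)] (b # B)) vs =
      of_int t * det_form \<epsilon> (I @ J) vs + list_form \<epsilon> (list_wedge [(1, I)] B) vs"
    by (simp add: b list_wedge_def)
  ultimately show ?case
    using Cons assms(2)[of J] by (simp only: has_degree_def b list.pred_inject prod.case distrib_left mult.left_commute)
qed (simp add: list_form_def[abs_def] wedge_linear_right list_wedge_def)

lemma list_form_scale_wedge:
  "list_form \<epsilon> (list_wedge [(s, I)] B) vs = of_int s * list_form \<epsilon> (list_wedge [(1, I)] B) vs"
  by (induction B) (auto simp: list_wedge_def algebra_simps)

lemma wedge_list_form:
  assumes "has_degree k A" "has_degree l B"
  shows "wedge k l (list_form \<epsilon> A) (list_form \<epsilon> B) vs = list_form \<epsilon> (list_wedge A B) vs"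
  using assms(1)
proof (induction A)
  case (Cons a A)
  obtain s I where a: "a = (s, I)" by (cases a)
  have "list_form \<epsilon> (a # A) = (\<lambda>ws. of_int s * det_form \<epsilon> I ws + list_form \<epsilon> A ws)"
    by (simp add: a fun_eq_iff)
  then have "wedge k l (list_form \<epsilon> (a # A)) (list_form \<epsilon> B) vs =
      of_int s * wedge k l (det_form \<epsilon> I) (list_form \<epsilon> B) vs + wedge k l (list_form \<epsilon> A) (list_form \<epsilon> B) vs"
    by (simp only: wedge_linear_left)
  moreover have "wedge k l (det_form \<epsilon> I) (list_form \<epsilon> B) vs = 1 * list_form \<epsilon> (list_wedge [(1, I)] B) vs"
    using Cons.prems by (intro wedge_list_form_right assms) (auto simp: a has_degree_def wedge_det_form)
  moreover have "list_wedge (a # A) B = list_wedge [(s, I)] B @ list_wedge A B"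
    by (simp add: a list_wedge_def)
  ultimately show ?case
    using Cons by (simp add: wedge_linear_left has_degree_def list_form_scale_wedge[of _ s])
qed (simp add: list_form_def[abs_def] wedge_linear_left list_wedge_def)

section \<open>Normal forms of sums of monomials\<close>

primrec add_term :: "int \<Rightarrow> nat list \<Rightarrow> (int \<times> nat list) list \<Rightarrow> (int \<times> nat list) list" where
  "add_term s I [] = [(s, I)]"
| "add_term s I (a # L) = (case a of (t, J) \<Rightarrow>
     if I = J then (if s + t = 0 then L else (s + t, J) # L) else (t, J) # add_term s I L)"

primrec collect :: "(int \<times> nat list) list \<Rightarrow> (int \<times> nat list) list" where
  "collect [] = []"
| "collect (a # L) = (case a of (s, I) \<Rightarrow> case sort_sign I of (t, J) \<Rightarrow>
     if t = 0 then collect L else add_term (s * t) J (collect L))"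

lemma list_wedge_single:
  "list_form \<epsilon> (list_wedge [(1, P)] ((s, I) # L)) vs =
     of_int s * det_form \<epsilon> (P @ I) vs + list_form \<epsilon> (list_wedge [(1, P)] L) vs"
  by (simp add: list_wedge_def)

lemma list_form_add_term:
  "list_form \<epsilon> (list_wedge [(1, P)] (add_term s I L)) vs =
     list_form \<epsilon> (list_wedge [(1, P)] ((s, I) # L)) vs"
proof (induction L)
  case (Cons a L)
  obtain t J where [simp]: "a = (t, J)" by (cases a)
  show ?case
  proof (cases "I = J \<and> s + t = 0")
    case True
    then have "s = - t" by simp
    with True show ?thesis by (simp add: list_wedge_single)
  next
    case False
    with Cons show ?thesis by (auto simp: list_wedge_single distrib_right)
  qed
qed simp

text \<open>With a prefix, collecting is justified also below further factors, so that intermediate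
  products can be kept short.\<close>

lemma list_form_collect_prefix:
  "list_form \<epsilon> (list_wedge [(1, P)] (collect L)) vs = list_form \<epsilon> (list_wedge [(1, P)] L) vs"
proof (induction L)
  case (Cons a L)
  obtain s I where [simp]: "a = (s, I)" by (cases a)
  show ?case
    using Cons det_form_sort_sign[of \<epsilon> P I vs]
    by (auto simp: list_wedge_single list_form_add_term split: prod.split)
qed simp

lemma list_wedge_unit: "list_wedge [(1, [])] L = L"
  by (induction L) (auto simp: list_wedge_def)

lemma list_form_collect: "list_form \<epsilon> (collect L) vs = list_form \<epsilon> L vs"
  using list_form_collect_prefix[of \<epsilon> "[]" L vs] by (simp only: list_wedge_unit)

lemma list_wedge_Cons_index:
  "list_wedge [(1, a # I)] L = list_wedge [(1, [a])] (list_wedge [(1, I)] L)"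
  by (induction L) (auto simp: list_wedge_def)

definition G2_terms :: "(int \<times> nat list) list" where
  "G2_terms = [(1, [1, 2, 3]), (1, [1, 4, 5]), (1, [1, 6, 7]), (1, [2, 4, 6]),
     (-1, [2, 5, 7]), (-1, [3, 4, 7]), (-1, [3, 5, 6])]"

text \<open>The complements of the index triples of \<open>G2_terms\<close>, with the signs for
  which the product of corresponding terms is the volume form.\<close>

definition G2_star_terms :: "(int \<times> nat list) list" where
  "G2_star_terms = [(1, [4, 5, 6, 7]), (1, [2, 3, 6, 7]), (1, [2, 3, 4, 5]), (1, [1, 3, 5, 7]),
     (-1, [1, 3, 4, 6]), (-1, [1, 2, 5, 6]), (-1, [1, 2, 4, 7])]"

text \<open>The interior product with the basis vector of index \<open>a\<close>, for monomials of
  degree 3; the signs are those of expanding a determinant along its first argument.\<close>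

definition contract :: "nat \<Rightarrow> (int \<times> nat list) list \<Rightarrow> (int \<times> nat list) list" where
  "contract a L = concat (map (\<lambda>(s, I).
     (if I ! 0 = a then [(s, [I ! 1, I ! 2])] else []) @
     (if I ! 1 = a then [(- s, [I ! 0, I ! 2])] else []) @
     (if I ! 2 = a then [(s, [I ! 0, I ! 1])] else [])) L)"

text \<open>Meant for increasing index triples: basis vectors then pair only with the monomial that
  has their sorted indices.\<close>

definition evaluate3 :: "(int \<times> nat list) list \<Rightarrow> nat \<Rightarrow> nat \<Rightarrow> nat \<Rightarrow> int" where
  "evaluate3 L a b c = (\<Sum>(s, I)\<leftarrow>L. case sort_sign [a, b, c] of (t, J) \<Rightarrow> if I = J then s * t else 0)"

text \<open>The metric identity on all 49 pairs of basis vectors. The coefficient 6 cancels the 1/6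
  of the definition, so that the basis is orthonormal.\<close>

lemma G2_metric_computation:
  "list_all (\<lambda>b. let B = collect (list_wedge (contract b G2_terms) G2_terms) in
     list_all (\<lambda>a. collect (list_wedge (contract a G2_terms) B) =
       (if a = b then [(6, [1..<8])] else [])) [1..<8]) [1..<8]"
  by code_simp

text \<open>The Hodge identity on all 343 basis triples. The three factors are put in front one at a
  time, with collecting in between.\<close>

lemma G2_star_computation:
  "list_all (\<lambda>c. let C = collect (list_wedge [(1, [c])] G2_star_terms) in
     list_all (\<lambda>b. let B = collect (list_wedge [(1, [b])] C) in
       list_all (\<lambda>a. collect (list_wedge [(1, [a])] B) =
         (let s = evaluate3 G2_terms a b c in if s = 0 then [] else [(s, [1..<8])]))
       [1..<8]) [1..<8]) [1..<8]"
  by code_simp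

lemma permutes_lessThan_Suc_sum:
  fixes f :: "(nat \<Rightarrow> nat) \<Rightarrow> real"
  shows "(\<Sum>\<sigma> | \<sigma> permutes {..<Suc n}. f \<sigma>) =
    (\<Sum>b\<le>n. \<Sum>\<sigma> | \<sigma> permutes {..<n}. f (Transposition.transpose n b \<circ> \<sigma>))"
  using sum_over_permutations_insert[of "{..<n}" n f]
  by (simp add: lessThan_Suc lessThan_Suc_atMost[symmetric])

lemma sign_transpose_compose:
  assumes "\<sigma> permutes {..<n :: nat}" "a < N" "b < N" "n \<le> N"
  shows "sign (Transposition.transpose a b \<circ> \<sigma>) = (if a = b then 1 else -1) * sign \<sigma>"
  using sign_compose_lessThan[of "Transposition.transpose a b" N \<sigma>] permutes_subset[OF assms(1)] assms
  by (auto simp: sign_swap_id permutes_swap_id)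

lemma det_form_1: "det_form \<epsilon> [i] [u] = \<epsilon> i u"
  by (simp add: det_form_def permutes_lessThan_Suc_sum sign_swap_id sign_id)

lemma det_form_2: "det_form \<epsilon> [i, j] [u, v] = \<epsilon> i u * \<epsilon> j v - \<epsilon> i v * \<epsilon> j u"
  by (simp add: det_form_def permutes_lessThan_Suc_sum sign_swap_id sign_id numeral_2_eq_2
      prod.lessThan_Suc sum.atMost_Suc sign_transpose_compose)

lemma det_form_3: "det_form \<epsilon> [i, j, k] [u, v, w] =
    \<epsilon> i u * (\<epsilon> j v * \<epsilon> k w - \<epsilon> j w * \<epsilon> k v) - \<epsilon> i v * (\<epsilon> j u * \<epsilon> k w - \<epsilon> j w * \<epsilon> k u)
    + \<epsilon> i w * (\<epsilon> j u * \<epsilon> k v - \<epsilon> j v * \<epsilon> k u)"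
  by (simp add: det_form_def permutes_lessThan_Suc_sum sign_swap_id sign_id numeral_2_eq_2
      prod.lessThan_Suc sum.atMost_Suc sign_transpose_compose sign_compose_lessThan[of _ 3]
      permutes_swap_id algebra_simps)

lemma det_form_expand_first: "det_form \<epsilon> [i, j, k] [u, v, w] =
    \<epsilon> i u * det_form \<epsilon> [j, k] [v, w] - \<epsilon> j u * det_form \<epsilon> [i, k] [v, w] + \<epsilon> k u * det_form \<epsilon> [i, j] [v, w]"
  by (simp add: det_form_2 det_form_3 algebra_simps)

lemma det_form_dual_basis:
  assumes "\<And>i j. i \<in> set I \<Longrightarrow> j \<in> set I \<Longrightarrow> \<epsilon> i (E j) = (if i = j then 1 else 0)" "distinct I"
  shows "det_form \<epsilon> I (map E I) = 1"
proof -
  have "(\<Prod>i<length I. \<epsilon> (I ! i) (map E I ! \<sigma> i)) = (if \<sigma> = id then 1 else 0)"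
    if \<sigma>: "\<sigma> permutes {..<length I}" for \<sigma>
  proof -
    have *: "\<epsilon> (I ! i) (map E I ! \<sigma> i) = (if \<sigma> i = i then 1 else 0)" if "i < length I" for i
      using that permutes_in_image[OF \<sigma>, of i] assms by (auto simp: nth_eq_iff_index_eq)
    have eq: "(\<Prod>i<length I. \<epsilon> (I ! i) (map E I ! \<sigma> i)) =
        (\<Prod>i<length I. if \<sigma> i = i then 1 else 0)"
      by (intro prod.cong refl *) auto
    have "(\<Prod>i<length I. if \<sigma> i = i then 1 else 0 :: real) = (if \<sigma> = id then 1 else 0)"
    proof (cases "\<sigma> = id")
      case False
      then obtain i where i: "\<sigma> i \<noteq> i" by (auto simp: fun_eq_iff)
      then have "i < length I" using permutes_not_in[OF \<sigma>, of i] by auto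
      then show ?thesis using False i by auto
    qed simp
    with eq show ?thesis by (rule trans)
  qed
  then have "det_form \<epsilon> I (map E I) =
      (\<Sum>\<sigma> | \<sigma> permutes {..<length I}. of_int (sign \<sigma>) * (if \<sigma> = id then 1 else 0))"
    unfolding det_form_def by (intro sum.cong) auto
  also have "\<dots> = 1"
    by (subst sum.remove[of _ id]) (auto simp: permutes_id finite_permutations sign_id)
  finally show ?thesis .
qed

lemma alternating_list_form:
  assumes "\<And>i. linear (\<epsilon> i)" "has_degree k L"
  shows "alternating k (list_form \<epsilon> L)"
  using assms(2)
proof (induction L)
  case Nil
  then show ?case by (simp add: alternating_def linear_zero)
next
  case (Cons a L)
  obtain s I where a: "a = (s, I)" by (cases a)
  have "alternating k (det_form \<epsilon> I)" "alternating k (list_form \<epsilon> L)"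
    using Cons by (auto simp: a has_degree_def intro!: alternating_det_form assms)
  moreover have "linear (\<lambda>x. of_int s * f x)" if "linear f" for f :: "'a \<Rightarrow> real"
    using linear_compose_scale_right[OF that, of "of_int s"] by simp
  ultimately show ?case
    unfolding alternating_def a list_form_simps by (auto intro!: linear_compose_add)
qed

section \<open>Coordinates, coframe and the forms with constant coefficients\<close>

definition basis7 :: "nat \<Rightarrow> R7" where
  "basis7 i = [(1, 0), (0, axis 1 1, 0, 0), (0, axis 2 1, 0, 0), (0, 0, axis 1 1, 0),
     (0, 0, axis 2 1, 0), (0, 0, 0, axis 1 1), (0, 0, 0, axis 2 1)] ! (i - 1)"

definition coord :: "nat \<Rightarrow> R7 \<Rightarrow> real" where
  "coord i x = basis7 i \<bullet> x"

lemma coord_simps [simp]: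
  "coord (Suc 0) (t, u, v, w) = t" "coord 1 (t, u, v, w) = t" "coord 2 (t, u, v, w) = u $ 1" "coord 3 (t, u, v, w) = u $ 2"
  "coord 4 (t, u, v, w) = v $ 1" "coord 5 (t, u, v, w) = v $ 2" "coord 6 (t, u, v, w) = w $ 1"
  "coord 7 (t, u, v, w) = w $ 2"
  by (simp_all add: coord_def basis7_def inner_axis' zero_prod_def nth_Cons')

lemma atLeastAtMost_1_7: "{1..7} = {1, 2, 3, 4, 5, 6, 7::nat}"
  by auto

lemma coord_basis7:
  "i \<in> {1..7} \<Longrightarrow> j \<in> {1..7} \<Longrightarrow> coord i (basis7 j) = (if i = j then 1 else 0)"
  unfolding atLeastAtMost_1_7 by (auto simp: coord_def basis7_def zero_prod_def inner_axis_axis)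

lemma linear_coord: "linear (coord i)"
  unfolding coord_def by (simp add: bounded_linear_inner_right bounded_linear.linear)

lemma sum_coord_basis7: "(\<Sum>i\<in>{1..7}. coord i x *\<^sub>R basis7 i) = x"
  unfolding atLeastAtMost_1_7
  by (cases x) (auto simp: basis7_def vec_eq_iff forall_2 axis_def zero_prod_def)

lemma inner_sum_coord: "x \<bullet> y = (\<Sum>i\<in>{1..7}. coord i x * coord i y)"
proof -
  have "x \<bullet> y = (\<Sum>i\<in>{1..7}. coord i x *\<^sub>R basis7 i) \<bullet> y" by (simp only: sum_coord_basis7)
  then show ?thesis by (simp add: inner_sum_left coord_def)
qed

definition G2_constant_form :: "R7 form" where
  "G2_constant_form = list_form coord G2_terms"

definition G2_star_constant_form :: "R7 form" where
  "G2_star_constant_form = list_form coord G2_star_terms"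

definition volume7 :: "R7 form" where
  "volume7 = det_form coord [1, 2, 3, 4, 5, 6, 7]"

lemma alternating_constant_forms:
  "alternating 3 G2_constant_form" "alternating 4 G2_star_constant_form" "alternating 7 volume7"
  unfolding G2_constant_form_def G2_star_constant_form_def volume7_def
  by (auto intro!: alternating_list_form alternating_det_form linear_coord
      simp: has_degree_def G2_terms_def G2_star_terms_def)

lemma smooth_on_const: "smooth_on U (\<lambda>x. c)"
proof -
  have "C_k_on k U (\<lambda>x. c)" for k
    by (induction k arbitrary: c) (auto simp: frechet_derivative_const)
  then show ?thesis by (simp add: smooth_on_def)
qed

lemma closed_constant_form:
  assumes "alternating k \<alpha>" shows "closed_form k (\<lambda>p. \<alpha>)"
  using assms by (simp add: closed_form_def differential_form_def smooth_on_const
      exterior_derivative_def frechet_derivative_const)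

lemma length_2_conv: "length vs = 2 \<longleftrightarrow> (\<exists>x y. vs = [x, y])"
  by (auto simp: numeral_2_eq_2 length_Suc_conv)

lemma length_3_conv: "length vs = 3 \<longleftrightarrow> (\<exists>x y z. vs = [x, y, z])"
  by (auto simp: numeral_3_eq_3 length_Suc_conv)

lemma wedge_one_forms:
  "wedge 1 2 (one_form (blinfun_inner_right (basis7 i)))
     (wedge 1 1 (one_form (blinfun_inner_right (basis7 j))) (one_form (blinfun_inner_right (basis7 k)))) vs =
   det_form coord [i, j, k] vs"
proof -
  have 1: "one_form (blinfun_inner_right (basis7 i)) ws = det_form coord [i] ws" if "length ws = 1" for i ws
    using that by (auto simp: one_form_def length_Suc_conv det_form_1 coord_def)
  have "wedge 1 1 (one_form (blinfun_inner_right (basis7 j))) (one_form (blinfun_inner_right (basis7 k))) ws =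
      det_form coord [j, k] ws" for ws
  proof -
    have "wedge 1 1 (one_form (blinfun_inner_right (basis7 j))) (one_form (blinfun_inner_right (basis7 k))) ws =
        wedge 1 1 (det_form coord [j]) (det_form coord [k]) ws"
      by (intro wedge_cong 1)
    then show ?thesis using wedge_det_form[of "[j]" 1 "[k]" 1 coord ws] by simp
  qed
  then have "wedge 1 2 (one_form (blinfun_inner_right (basis7 i)))
     (wedge 1 1 (one_form (blinfun_inner_right (basis7 j))) (one_form (blinfun_inner_right (basis7 k)))) vs =
     wedge 1 2 (det_form coord [i]) (det_form coord [j, k]) vs"
    by (intro wedge_cong 1) auto
  then show ?thesis using wedge_det_form[of "[i]" 1 "[j, k]" 2 coord vs] by simp
qed

lemma G2_form_constant: "G2_form G2_constant_form"
proof -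
  let ?e = "\<lambda>i. blinfun_inner_right (basis7 i)"
  have e: "blinfun_apply (?e i) (basis7 j) = (if i = j then 1 else 0)" if "i \<in> {1..7}" "j \<in> {1..7}" for i j
    using coord_basis7[OF that] by (simp add: coord_def)
  have inj: "inj_on ?e {1..7}"
  proof (rule inj_onI)
    fix i j :: nat assume "i \<in> {1..7}" "j \<in> {1..7}" "?e i = ?e j"
    then show "i = j" using e[of i i] e[of j i] by (auto split: if_splits)
  qed
  have "independent (?e ` {1..7})"
  proof (rule independent_if_scalars_zero)
    fix f x assume f: "(\<Sum>y\<in>?e ` {1..7}. f y *\<^sub>R y) = 0" and "x \<in> ?e ` {1..7}"
    then obtain j where j: "x = ?e j" "j \<in> {1..7}" by blast
    have "0 = (\<Sum>i\<in>{1..7}. f (?e i) *\<^sub>R ?e i) (basis7 j)"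
      using f inj by (simp add: sum.reindex)
    also have "\<dots> = (\<Sum>i\<in>{1..7}. if i = j then f (?e i) else 0)"
      unfolding blinfun.sum_left by (intro sum.cong refl) (use e j in \<open>simp add: blinfun.scaleR_left\<close>)
    finally show "f x = 0" using j by simp
  qed simp
  moreover have "x \<in> span (?e ` {1..7})" for x
  proof -
    have "x = (\<Sum>i\<in>{1..7}. x (basis7 i) *\<^sub>R ?e i)"
    proof (rule blinfun_eqI)
      fix v
      have "x v = x (\<Sum>i\<in>{1..7}. coord i v *\<^sub>R basis7 i)" by (simp only: sum_coord_basis7)
      also have "\<dots> = (\<Sum>i\<in>{1..7}. x (basis7 i) *\<^sub>R ?e i) v"
        by (simp add: blinfun.sum_left blinfun.sum_right blinfun.scaleR_left blinfun.scaleR_right coord_def mult.commute)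
      finally show "x v = (\<Sum>i\<in>{1..7}. x (basis7 i) *\<^sub>R ?e i) v" .
    qed
    also have "\<dots> \<in> span (?e ` {1..7})" by (intro span_sum span_scale span_base) auto
    finally show ?thesis .
  qed
  moreover have "G2_constant_form vs = G2_model ?e vs" for vs
    unfolding G2_model_def Let_def wedge_one_forms
    by (simp add: G2_constant_form_def G2_terms_def)
  ultimately show ?thesis
    unfolding G2_form_def using inj alternating_constant_forms(1) by blast
qed

text \<open>By linearity in \<open>X\<close>, each index of a monomial contributes to exactly one
  summand, that of the basis vector with this index.\<close>

lemma interior_product_list_form:
  assumes "list_all (\<lambda>(s, I). length I = 3 \<and> set I \<subseteq> {1..7}) L" and "length ws = 2"
  shows "interior_product X (list_form coord L) ws =
    (\<Sum>a\<in>{1..7}. coord a X * list_form coord (contract a L) ws)"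
  using assms(1)
proof (induction L)
  case (Cons t L)
  obtain v w where ws: "ws = [v, w]" using assms(2) by (auto simp: length_2_conv)
  obtain s i j k where t: "t = (s, [i, j, k])" and ijk: "i \<in> {1..7}" "j \<in> {1..7}" "k \<in> {1..7}"
  proof (cases t)
    case (Pair s I)
    then obtain i j k where "I = [i, j, k]" using Cons.prems length_3_conv[of I] by auto
    with Pair show ?thesis using Cons.prems by (intro that[of s i j k]) auto
  qed
  have single: "(\<Sum>a\<in>{1..7}. coord a X * list_form coord (if n = a then [(r, J)] else []) ws) =
      of_int r * coord n X * det_form coord J ws" if "n \<in> {1..7}" for n r J
  proof -
    have "(\<Sum>a\<in>{1..7}. coord a X * list_form coord (if n = a then [(r, J)] else []) ws) =
        (\<Sum>a\<in>{1..7}. if n = a then of_int r * coord n X * det_form coord J ws else 0)"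
      by (intro sum.cong) auto
    then show ?thesis using that by simp
  qed
  have "contract a (t # L) = (if i = a then [(s, [j, k])] else []) @ (if j = a then [(- s, [i, k])] else [])
      @ (if k = a then [(s, [i, j])] else []) @ contract a L" for a
    by (simp add: contract_def t)
  then have "(\<Sum>a\<in>{1..7}. coord a X * list_form coord (contract a (t # L)) ws) =
      of_int s * coord i X * det_form coord [j, k] ws + (of_int (- s) * coord j X * det_form coord [i, k] ws
      + (of_int s * coord k X * det_form coord [i, j] ws + interior_product X (list_form coord L) ws))"
    using Cons by (simp only: list_form_simps(3) distrib_left sum.distrib single ijk list.pred_inject)
  then show ?case
    by (simp add: interior_product_def t ws det_form_expand_first algebra_simps)
qed (simp add: interior_product_def contract_def)

lemma interior_product_G2:
  "length ws = 2 \<Longrightarrow> interior_product X G2_constant_form ws =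
    (\<Sum>a\<in>{1..7}. coord a X * list_form coord (contract a G2_terms) ws)"
  unfolding G2_constant_form_def by (rule interior_product_list_form) (auto simp: G2_terms_def)

text \<open>Both sides are bilinear in \<open>X\<close> and \<open>Y\<close>, which leaves the
  evaluated case of basis vectors.\<close>

lemma G2_metric_identity:
  "(X \<bullet> Y) * volume7 vs =
    1/6 * wedge 2 5 (interior_product X G2_constant_form)
      (wedge 2 3 (interior_product Y G2_constant_form) G2_constant_form) vs"
proof -
  define B where "B b = collect (list_wedge (contract b G2_terms) G2_terms)" for b
  have deg: "has_degree 2 (contract a G2_terms)" "has_degree 3 G2_terms" for a
    by (auto simp: has_degree_def contract_def G2_terms_def)
  have up: "[1..<8] = [1, 2, 3, 4, 5, 6, 7::nat]" by (simp add: upt_rec)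
  have comp: "collect (list_wedge (contract a G2_terms) (B b)) = (if a = b then [(6, [1, 2, 3, 4, 5, 6, 7])] else [])"
    if "a \<in> {1..7}" "b \<in> {1..7}" for a b
  proof -
    have "a \<in> set [1..<8]" "b \<in> set [1..<8]" using that by auto
    then show ?thesis
      using G2_metric_computation unfolding list_all_iff Let_def B_def[symmetric] up by blast
  qed
  have "wedge 2 3 (interior_product Y G2_constant_form) G2_constant_form us =
      (\<Sum>b\<in>{1..7}. coord b Y * list_form coord (B b) us)" for us
  proof -
    have "wedge 2 3 (interior_product Y G2_constant_form) G2_constant_form us =
        wedge 2 3 (\<lambda>ws. \<Sum>a\<in>{1..7}. coord a Y * list_form coord (contract a G2_terms) ws) G2_constant_form us"
      by (intro wedge_cong interior_product_G2 refl)
    then show ?thesis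
      by (simp add: wedge_sum_left G2_constant_form_def wedge_list_form deg B_def list_form_collect)
  qed
  then have "wedge 2 5 (interior_product X G2_constant_form)
      (wedge 2 3 (interior_product Y G2_constant_form) G2_constant_form) vs =
    wedge 2 5 (\<lambda>ws. \<Sum>a\<in>{1..7}. coord a X * list_form coord (contract a G2_terms) ws)
      (\<lambda>us. \<Sum>b\<in>{1..7}. coord b Y * list_form coord (B b) us) vs"
    by (intro wedge_cong interior_product_G2)
  also have "\<dots> = (\<Sum>a\<in>{1..7}. coord a X * (\<Sum>b\<in>{1..7}. coord b Y *
      wedge 2 5 (list_form coord (contract a G2_terms)) (list_form coord (B b)) vs))"
    by (simp only: wedge_sum_left wedge_sum_right)
  also have "\<dots> = (\<Sum>a\<in>{1..7}. coord a X * (\<Sum>b\<in>{1..7}. coord b Y * (if a = b then 6 * volume7 vs else 0)))"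
  proof (intro sum.cong refl arg_cong2[where f = "(*)"])
    fix a b :: nat assume ab: "a \<in> {1..7}" "b \<in> {1..7}"
    have "has_degree 5 (B b)"
      using ab(2) unfolding atLeastAtMost_1_7
      by (auto simp: B_def has_degree_def contract_def G2_terms_def list_wedge_def)
    then have "wedge 2 5 (list_form coord (contract a G2_terms)) (list_form coord (B b)) vs =
        list_form coord (collect (list_wedge (contract a G2_terms) (B b))) vs"
      by (simp add: wedge_list_form deg list_form_collect)
    then show "wedge 2 5 (list_form coord (contract a G2_terms)) (list_form coord (B b)) vs =
        (if a = b then 6 * volume7 vs else 0)"
      by (simp add: comp[OF ab] volume7_def)
  qed
  also have "\<dots> = 6 * (X \<bullet> Y) * volume7 vs"
    by (simp add: inner_sum_coord sum_distrib_left sum_distrib_right sum.delta ac_simps if_distrib cong: if_cong)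
  finally show ?thesis by simp
qed

section \<open>Holonomy\<close>

lemma linear_rot_action: "linear (rot_action a b c t)"
proof (rule linearI)
  show "rot_action a b c t (x + y) = rot_action a b c t x + rot_action a b c t y" for x y
    by (rule rot_action_distrib)
  show "rot_action a b c t (r *\<^sub>R x) = r *\<^sub>R rot_action a b c t x" for r x
    by (simp add: rot_action_def matrix_vector_mult_scaleR split: prod.split)
qed

definition rotate7 :: "real \<Rightarrow> real \<Rightarrow> real \<Rightarrow> real \<Rightarrow> R7 \<Rightarrow> R7" where
  "rotate7 a b c s = (\<lambda>(t, x). (t, rot_action a b c s x))"

lemma linear_rotate7: "linear (rotate7 a b c s)"
  by (rule linearI)
     (simp_all add: rotate7_def case_prod_beta rot_action_distrib linear_cmul[OF linear_rot_action] prod_eq_iff)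

lemma rotate7_add: "rotate7 a b c (s + t) = rotate7 a b c s \<circ> rotate7 a b c t"
  by (auto simp: rotate7_def rot_action_add)

lemma rotate7_0: "rotate7 a b c 0 = id"
  by (auto simp: rotate7_def)

lemma rotate7_minus: "rotate7 a b c (- s) (rotate7 a b c s x) = x"
  "rotate7 a b c s (rotate7 a b c (- s) x) = x"
  by (simp_all add: rotate7_def case_prod_beta flip: rot_action_add)

lemma bij_rotate7: "bij (rotate7 a b c s)"
  by (rule o_bij[of "rotate7 a b c (- s)"]) (auto simp: fun_eq_iff rotate7_minus)

text \<open>In the chart a left translation is affine; its differential is its linear part, the same
  at every point.\<close>

lemma d_left_translation_almost_abelian:
  "d_left_translation (almost_abelian a b c) h p = rotate7 a b c (fst h)"
proof -
  obtain s y where h: "h = (s, y)" by (cases h)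
  have "(\<lambda>q. h \<otimes>\<^bsub>almost_abelian a b c\<^esub> q) = (\<lambda>q. h + rotate7 a b c s q)"
    by (auto simp: h almost_abelian_def rotate7_def fun_eq_iff)
  moreover have "((\<lambda>q. h + rotate7 a b c s q) has_derivative rotate7 a b c s) (at p)"
    using linear_rotate7[of a b c s, unfolded linear_conv_bounded_linear]
    by (auto intro!: derivative_eq_intros bounded_linear_imp_has_derivative)
  ultimately show ?thesis
    by (simp add: d_left_translation_def frechet_derivative_at[symmetric] h)
qed

text \<open>For a constant metric, \<open>C p X Y \<bullet> Z\<close> is symmetric in the first two
  arguments and skew in the last two; alternating the two rules around all orders returns its
  negative.\<close>

lemma levi_civita_constant_metric:
  assumes "levi_civita (\<lambda>p. (\<bullet>)) C"
  shows "C p X Y = 0"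
proof -
  have sym: "C p X Y = C p Y X" for X Y using assms by (simp add: levi_civita_def)
  have skew: "C p X Y \<bullet> Z = - (C p X Z \<bullet> Y)" for X Y Z
    using assms by (simp add: levi_civita_def frechet_derivative_const inner_commute eq_neg_iff_add_eq_0)
  have "C p X Y \<bullet> Z = 0" for Z
    using skew[of X Y Z] skew[of Z X Y] skew[of Y Z X] sym[of X Z] sym[of Z Y] sym[of X Y] by simp
  then show ?thesis using inner_eq_zero_iff by blast
qed

lemma levi_civita_euclidean: "levi_civita (\<lambda>p :: 'a::euclidean_space. (\<bullet>)) (\<lambda>p X Y. 0)"
  by (simp add: levi_civita_def frechet_derivative_const bilinear_def linear_zero)

lemma parallel_along_flat:
  assumes "parallel_along (\<lambda>p X Y. 0) c W" shows "W 1 = W 0"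
proof -
  obtain S where "continuous_on {0..1} W" "finite S"
      "\<And>t. t \<in> {0..1} - S \<Longrightarrow> (W has_vector_derivative 0) (at t)"
    using assms by (auto simp: parallel_along_def)
  then have "W 1 = W 0"
    by (intro has_derivative_zero_unique_strong_interval[of S 0 1 W "W 0" 1])
       (auto simp: has_vector_derivative_def intro: has_derivative_at_withinI)
  then show ?thesis .
qed

text \<open>Parallel transport is the identity in the chart, so that only the identification of the
  tangent spaces at p and \<gamma>p is left: the holonomy of the loop is the inverse of the
  differential of \<gamma>.\<close>

lemma carrier_holonomy_group:
  assumes "\<Gamma> = range real_of_int \<times> N" and "N \<noteq> {}"
  shows "carrier (holonomy_group (almost_abelian a b c) \<Gamma> (\<lambda>p. (\<bullet>)) p) =
    range (\<lambda>n. rotate7 a b c (of_int n))" (is "?H = ?R")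
proof (intro subset_antisym subsetI)
  fix A assume "A \<in> ?H"
  then have "\<exists>\<gamma>\<in>\<Gamma>. \<exists>c' C. levi_civita (\<lambda>p. (\<bullet>)) C \<and>
      (\<forall>v. \<exists>W. parallel_along C c' W \<and> W 0 = v \<and> W 1 = rotate7 a b c (fst \<gamma>) (A v))"
    unfolding holonomy_group_def d_left_translation_almost_abelian partial_object.simps by blast
  then obtain \<gamma> c' C where *: "\<gamma> \<in> \<Gamma>" "levi_civita (\<lambda>p. (\<bullet>)) C"
      "\<And>v. \<exists>W. parallel_along C c' W \<and> W 0 = v \<and> W 1 = rotate7 a b c (fst \<gamma>) (A v)"
    by blast
  have "C = (\<lambda>p X Y. 0)" using levi_civita_constant_metric[OF *(2)] by (auto simp: fun_eq_iff)
  then have "rotate7 a b c (fst \<gamma>) (A v) = v" for v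
    using *(3)[of v] parallel_along_flat by metis
  then have "A v = rotate7 a b c (- fst \<gamma>) v" for v by (metis rotate7_minus(1))
  moreover obtain n where "fst \<gamma> = real_of_int n" using *(1) assms by auto
  ultimately have "A = rotate7 a b c (of_int (- n))" by (auto simp: fun_eq_iff)
  then show "A \<in> ?R" by blast
next
  fix A assume "A \<in> ?R"
  then obtain n where A: "A = rotate7 a b c (of_int n)" by blast
  obtain y where "y \<in> N" using assms(2) by blast
  \<comment> \<open>The sign compensates for this inverse. Any vector of \<open>N\<close> will do,
    since the differential depends on the first component only.\<close>
  define \<gamma> where "\<gamma> = (real_of_int (- n), y)"
  have "real_of_int (- n) \<in> range real_of_int" by blast
  then have "\<gamma> \<in> \<Gamma>" using assms(1) \<open>y \<in> N\<close> by (simp only: \<gamma>_def mem_Times_iff fst_conv snd_conv)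
  moreover have "\<exists>W. parallel_along (\<lambda>p X Y. 0) (linepath p q) W \<and> W 0 = v \<and> W 1 = v" for q v :: R7
    by (intro exI[of _ "\<lambda>_. v"]) (auto simp: parallel_along_def linepath_def intro!: exI[of _ "{}"] derivative_intros)
  ultimately have par: "\<gamma> \<in> \<Gamma>" "\<forall>v. \<exists>W. parallel_along (\<lambda>p X Y. 0) (linepath p q) W \<and>
      W 0 = v \<and> W 1 = rotate7 a b c (fst \<gamma>) (A v)" for q
    by (simp_all only: A \<gamma>_def fst_conv of_int_minus rotate7_minus) blast+
  have "linear A" unfolding A by (rule linear_rotate7)
  with par have "linear A \<and> (\<exists>\<gamma>\<in>\<Gamma>. \<exists>c' C. levi_civita (\<lambda>p. (\<bullet>)) C \<and> valid_path c' \<and>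
      pathstart c' = p \<and> pathfinish c' = \<gamma> \<otimes>\<^bsub>almost_abelian a b c\<^esub> p \<and>
      (\<forall>v. \<exists>W. parallel_along C c' W \<and> W 0 = v \<and> W 1 = rotate7 a b c (fst \<gamma>) (A v)))"
    by (intro conjI bexI[OF _ par(1)] exI[of _ "\<lambda>p X Y. 0"]
        exI[of _ "linepath p (\<gamma> \<otimes>\<^bsub>almost_abelian a b c\<^esub> p)"] levi_civita_euclidean valid_path_linepath
        pathstart_linepath pathfinish_linepath par(2))
  then show "A \<in> ?H"
    by (simp only: holonomy_group_def d_left_translation_almost_abelian partial_object.simps mem_Collect_eq)
qed

lemma rotate7_period:
  assumes m: "m > 0" "\<And>x. rot_action a b c (real m) x = x"
  shows "rotate7 a b c (of_int n) = rotate7 a b c (real (nat (n mod int m)))"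
proof -
  let ?K = "rotate7 a b c"
  have period: "?K (real (m * j)) = id" for j
  proof (induction j)
    case (Suc j)
    have "?K (real m) = id" using m(2) by (auto simp: rotate7_def)
    then show ?case using Suc rotate7_add[of a b c "real m" "real (m * j)"] by simp
  qed (simp add: rotate7_0)
  define j where "j = nat \<bar>n div int m\<bar>"
  have r: "real (nat (n mod int m)) = of_int (n mod int m)" using m(1) by simp
  show ?thesis
  proof (cases "n div int m \<ge> 0")
    case True
    then have "n = n mod int m + int (m * j)" by (simp add: j_def)
    then have "of_int n = real (nat (n mod int m)) + real (m * j)"
      unfolding r by (metis of_int_add of_int_of_nat_eq)
    then show ?thesis using rotate7_add period by simp
  next
    case False
    then have "n + int (m * j) = n mod int m" by (simp add: j_def minus_mult_div_eq_mod)
    then have "of_int n + real (m * j) = real (nat (n mod int m))"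
      unfolding r by (metis of_int_add of_int_of_nat_eq)
    then show ?thesis using rotate7_add[of a b c "of_int n" "real (m * j)"] period by simp
  qed
qed

lemma holonomy_finite_cyclic:
  fixes p :: R7
  assumes \<Gamma>: "\<Gamma> = range real_of_int \<times> N" "N \<noteq> {}"
    and m: "m > 0" "\<And>x. rot_action a b c (real m) x = x"
  defines "Hol \<equiv> holonomy_group (almost_abelian a b c) \<Gamma> (\<lambda>p. (\<bullet>)) p"
  shows "finite (carrier Hol) \<and> cyclic_group Hol"
proof -
  let ?K = "rotate7 a b c"
  have carr: "carrier Hol = range (\<lambda>n. ?K (of_int n))"
    unfolding Hol_def by (rule carrier_holonomy_group[OF \<Gamma>])
  have mult: "x \<otimes>\<^bsub>Hol\<^esub> y = x \<circ> y" and one: "\<one>\<^bsub>Hol\<^esub> = id" for x y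
    by (simp_all add: Hol_def holonomy_group_def)
  note red = rotate7_period[OF m]
  have "nat (n mod int m) < m" for n using m(1) by (simp add: nat_less_iff)
  then have "carrier Hol \<subseteq> (\<lambda>k. ?K (real k)) ` {..<m}"
    unfolding carr using red by (auto simp: image_iff Bex_def)
  then have fin: "finite (carrier Hol)" by (rule finite_subset) auto
  have "group Hol"
  proof (rule groupI)
    fix x y z assume "x \<in> carrier Hol" "y \<in> carrier Hol"
    then obtain n k where "x = ?K (of_int n)" "y = ?K (of_int k)" by (auto simp: carr)
    then have "x \<otimes>\<^bsub>Hol\<^esub> y = ?K (of_int (n + k))" by (simp add: mult rotate7_add)
    then show "x \<otimes>\<^bsub>Hol\<^esub> y \<in> carrier Hol" unfolding carr by blast
  next
    have "\<one>\<^bsub>Hol\<^esub> = ?K (of_int 0)" by (simp add: one rotate7_0)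
    then show "\<one>\<^bsub>Hol\<^esub> \<in> carrier Hol" unfolding carr by blast
  next
    fix x assume "x \<in> carrier Hol"
    then obtain n where x: "x = ?K (of_int n)" by (auto simp: carr)
    show "\<exists>y\<in>carrier Hol. y \<otimes>\<^bsub>Hol\<^esub> x = \<one>\<^bsub>Hol\<^esub>"
    proof
      show "?K (of_int (- n)) \<in> carrier Hol" unfolding carr by blast
      show "?K (of_int (- n)) \<otimes>\<^bsub>Hol\<^esub> x = \<one>\<^bsub>Hol\<^esub>"
        by (auto simp: x mult one fun_eq_iff rotate7_minus)
    qed
  qed (simp_all add: mult one comp_assoc)
  then interpret group Hol .
  have gen: "?K 1 \<in> carrier Hol" unfolding carr by (rule range_eqI[of _ _ 1]) simp
  have pow: "?K 1 [^]\<^bsub>Hol\<^esub> (k :: nat) = ?K (real k)" for k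
    by (induction k) (simp_all add: one rotate7_0 mult rotate7_add[symmetric] add.commute)
  have "carrier Hol = range (\<lambda>n :: int. ?K 1 [^]\<^bsub>Hol\<^esub> n)"
  proof (intro subset_antisym subsetI)
    fix x assume "x \<in> carrier Hol"
    then obtain n where "x = ?K (real (nat (n mod int m)))" by (auto simp: carr red)
    then have "x = ?K 1 [^]\<^bsub>Hol\<^esub> int (nat (n mod int m))" by (simp only: int_pow_int pow)
    then show "x \<in> range (\<lambda>n :: int. ?K 1 [^]\<^bsub>Hol\<^esub> n)" by blast
  qed (use gen in auto)
  then have "cyclic_group Hol" unfolding cyclic_group using gen by blast
  with fin show ?thesis by blast
qed

section \<open>Torsion-freeness and invariance\<close>

text \<open>All 343 triples occur, as in the sum of \<open>form_inner\<close>; the 1/3! there will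
  come from \<open>wedge_tensor_det_form\<close>.\<close>

lemma linear3_expand:
  assumes "alternating 3 \<alpha>" and "length ws = 3"
  shows "\<alpha> ws = (\<Sum>a\<in>{1..7}. \<Sum>b\<in>{1..7}. \<Sum>c\<in>{1..7}.
    \<alpha> [basis7 a, basis7 b, basis7 c] * tensor_form coord [a, b, c] ws)"
proof -
  obtain x y z where ws: "ws = [x, y, z]" using assms(2) by (auto simp: length_3_conv)
  have lin: "linear (\<lambda>x. \<alpha> [x, v, w])" "linear (\<lambda>y. \<alpha> [u, y, w])" "linear (\<lambda>z. \<alpha> [u, v, z])" for u v w
    using assms(1)[unfolded alternating_def, THEN conjunct1, rule_format, of "[u, v, w]" 0]
      assms(1)[unfolded alternating_def, THEN conjunct1, rule_format, of "[u, v, w]" 1]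
      assms(1)[unfolded alternating_def, THEN conjunct1, rule_format, of "[u, v, w]" 2]
    by (simp_all add: numeral_2_eq_2)
  have expand: "f u = (\<Sum>a\<in>{1..7}. coord a u * f (basis7 a))" if "linear f" for f :: "R7 \<Rightarrow> real" and u
  proof -
    have "f u = f (\<Sum>a\<in>{1..7}. coord a u *\<^sub>R basis7 a)" by (simp only: sum_coord_basis7)
    then show ?thesis by (simp only: linear_sum[OF that] linear_cmul[OF that] real_scaleR_def)
  qed
  have "\<alpha> [x, y, z] = (\<Sum>a\<in>{1..7}. coord a x * (\<Sum>b\<in>{1..7}. coord b y *
      (\<Sum>c\<in>{1..7}. coord c z * \<alpha> [basis7 a, basis7 b, basis7 c])))"
    by (subst expand[OF lin(1)], subst expand[OF lin(2)], subst expand[OF lin(3)]) (rule refl)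
  then show ?thesis
    unfolding ws sum_distrib_left
    by (simp add: tensor_form_def numeral_3_eq_3 lessThan_Suc ac_simps)
qed

text \<open>For increasing i, j, k the determinant is that of a matrix of zeros and ones; comparing
  a, b, c pairwise settles every case.\<close>

lemma det_form_3_sort_sign:
  assumes \<delta>: "\<And>m n. m \<in> {i, j, k} \<Longrightarrow> n \<in> {a, b, c} \<Longrightarrow> \<epsilon> m (E n) = (if m = n then 1 else 0)"
    and ijk: "i < j" "j < k"
  shows "det_form \<epsilon> [i, j, k] [E a, E b, E c] =
    (case sort_sign [a, b, c] of (t, J) \<Rightarrow> if [i, j, k] = J then of_int t else 0)"
proof -
  have \<delta>': "\<epsilon> i (E a) = of_bool (i = a)" "\<epsilon> i (E b) = of_bool (i = b)" "\<epsilon> i (E c) = of_bool (i = c)"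
    "\<epsilon> j (E a) = of_bool (j = a)" "\<epsilon> j (E b) = of_bool (j = b)" "\<epsilon> j (E c) = of_bool (j = c)"
    "\<epsilon> k (E a) = of_bool (k = a)" "\<epsilon> k (E b) = of_bool (k = b)" "\<epsilon> k (E c) = of_bool (k = c)"
    by (simp_all add: \<delta>)
  show ?thesis
    unfolding det_form_3 \<delta>'
    by (rule linorder_cases[of a b]; rule linorder_cases[of b c]; rule linorder_cases[of a c];
        use ijk in \<open>simp; linarith?\<close>; use ijk in \<open>auto simp: of_bool_def\<close>)
qed

lemma evaluate3_G2:
  assumes "a \<in> {1..7}" "b \<in> {1..7}" "c \<in> {1..7}"
  shows "G2_constant_form [basis7 a, basis7 b, basis7 c] = of_int (evaluate3 G2_terms a b c)"
proof -
  have "det_form coord [i, j, k] [basis7 a, basis7 b, basis7 c] =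
      (case sort_sign [a, b, c] of (t, J) \<Rightarrow> if [i, j, k] = J then of_int t else 0)"
    if "i < j" "j < k" "i \<in> {1..7}" "j \<in> {1..7}" "k \<in> {1..7}" for i j k
    using that assms by (intro det_form_3_sort_sign coord_basis7) auto
  then show ?thesis
    unfolding G2_constant_form_def evaluate3_def
    by (simp add: G2_terms_def case_prod_beta)
qed

lemma wedge_tensor_G2_star:
  assumes "a \<in> {1..7}" "b \<in> {1..7}" "c \<in> {1..7}"
  shows "wedge 3 4 (tensor_form coord [a, b, c]) G2_star_constant_form vs =
    of_int (evaluate3 G2_terms a b c) * volume7 vs / 6"
proof -
  let ?w = "\<lambda>i L. list_wedge [(1, [i])] L"
  have up: "[1..<8] = [1, 2, 3, 4, 5, 6, 7::nat]" by (simp add: upt_rec)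
  have mem: "a \<in> set [1..<8]" "b \<in> set [1..<8]" "c \<in> set [1..<8]" using assms by auto
  have comp: "collect (?w a (collect (?w b (collect (?w c G2_star_terms))))) =
      (let s = evaluate3 G2_terms a b c in if s = 0 then [] else [(s, [1, 2, 3, 4, 5, 6, 7])])"
    using G2_star_computation[unfolded list_all_iff Let_def, rule_format, OF mem(3,2,1)]
    unfolding Let_def up .
  have "wedge 3 4 (tensor_form coord [a, b, c]) G2_star_constant_form vs =
      1/6 * list_form coord (list_wedge [(1, [a, b, c])] G2_star_terms) vs"
    unfolding G2_star_constant_form_def
    by (rule wedge_list_form_right) (auto simp: has_degree_def G2_star_terms_def wedge_tensor_det_form fact_numeral)
  \<comment> \<open>Splitting off single factors gives the expression the shape in which it was
    evaluated.\<close>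
  also have "list_wedge [(1, [a, b, c])] G2_star_terms = ?w a (?w b (?w c G2_star_terms))"
    using list_wedge_Cons_index[of a "[b, c]"] list_wedge_Cons_index[of b "[c]"] by simp
  also have "list_form coord \<dots> vs = list_form coord (collect (?w a (collect (?w b (collect (?w c G2_star_terms)))))) vs"
    using list_form_collect_prefix[of coord "[a, b]"] list_wedge_Cons_index[of a "[b]"]
    by (simp only: list_form_collect list_form_collect_prefix)
  finally show ?thesis by (simp add: comp Let_def volume7_def)
qed

lemma sum_lists_length_3:
  fixes f :: "nat list \<Rightarrow> real"
  shows "(\<Sum>is | length is = 3 \<and> set is \<subseteq> {..<7}. f (map Suc is)) =
    (\<Sum>a\<in>{1..7}. \<Sum>b\<in>{1..7}. \<Sum>c\<in>{1..7}. f [a, b, c])"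
proof -
  have "(\<Sum>is | length is = 3 \<and> set is \<subseteq> {..<7}. f (map Suc is)) =
      (\<Sum>(a, b, c)\<in>{1..7} \<times> {1..7} \<times> {1..7}. f [a, b, c])"
    by (rule sum.reindex_bij_witness[of _ "\<lambda>(a, b, c). [a - 1, b - 1, c - 1]"
          "\<lambda>is. (Suc (is ! 0), Suc (is ! 1), Suc (is ! 2))"])
       (auto simp: length_3_conv)
  then show ?thesis by (simp add: sum.cartesian_product)
qed

text \<open>Frames are numbered from 0, whereas the model form numbers its coframe from 1.\<close>

definition frame7 :: "nat \<Rightarrow> R7" where
  "frame7 i = basis7 (Suc i)"

lemma orthonormal_frame7: "orthonormal_frame (\<bullet>) frame7"
  using coord_basis7 by (auto simp: orthonormal_frame_def frame7_def coord_def)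

lemma hodge_star_G2: "hodge_star (\<bullet>) volume7 3 G2_constant_form G2_star_constant_form"
proof -
  have "wedge 3 4 \<alpha> G2_star_constant_form vs = form_inner frame7 3 \<alpha> G2_constant_form * volume7 vs"
    if \<alpha>: "alternating 3 \<alpha>" for \<alpha> vs
  proof -
    let ?S = "{1..7::nat}"
    \<comment> \<open>The factors 1 bring the iterated sum into the shape of
      \<open>wedge_sum_left\<close>.\<close>
    have "wedge 3 4 \<alpha> G2_star_constant_form vs = wedge 3 4 (\<lambda>ws. \<Sum>a\<in>?S. 1 * (\<Sum>b\<in>?S. 1 * (\<Sum>c\<in>?S.
        \<alpha> [basis7 a, basis7 b, basis7 c] * tensor_form coord [a, b, c] ws))) G2_star_constant_form vs"
      by (rule wedge_cong) (simp_all add: linear3_expand[OF \<alpha>])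
    also have "\<dots> = (\<Sum>a\<in>?S. 1 * (\<Sum>b\<in>?S. 1 * (\<Sum>c\<in>?S. \<alpha> [basis7 a, basis7 b, basis7 c] *
        wedge 3 4 (tensor_form coord [a, b, c]) G2_star_constant_form vs)))"
      by (simp only: wedge_sum_left)
    also have "\<dots> = (\<Sum>a\<in>?S. 1 * (\<Sum>b\<in>?S. 1 * (\<Sum>c\<in>?S. \<alpha> [basis7 a, basis7 b, basis7 c] *
        (G2_constant_form [basis7 a, basis7 b, basis7 c] * volume7 vs / 6))))"
      by (intro sum.cong refl arg_cong2[where f = "(*)"]) (simp only: wedge_tensor_G2_star evaluate3_G2)
    also have "\<dots> = (\<Sum>a\<in>?S. \<Sum>b\<in>?S. \<Sum>c\<in>?S. \<alpha> (map basis7 [a, b, c]) *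
        G2_constant_form (map basis7 [a, b, c])) / 6 * volume7 vs"
      by (simp add: sum_divide_distrib sum_distrib_right mult.assoc)
    also have "\<dots> = form_inner frame7 3 \<alpha> G2_constant_form * volume7 vs"
      using sum_lists_length_3[of "\<lambda>J. \<alpha> (map basis7 J) * G2_constant_form (map basis7 J)"]
      by (simp add: form_inner_def frame7_def[abs_def] comp_def fact_numeral)
    finally show ?thesis .
  qed
  then show ?thesis
    using alternating_constant_forms(2) orthonormal_frame7 by (auto simp: hodge_star_def)
qed

lemma volume_form_volume7: "volume_form (\<bullet>) volume7"
proof -
  have "map frame7 [0..<7] = map basis7 [1, 2, 3, 4, 5, 6, 7]"
    by (simp add: frame7_def upt_rec numeral_eq_Suc)
  moreover have "volume7 (map basis7 [1, 2, 3, 4, 5, 6, 7]) = 1"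
    unfolding volume7_def by (rule det_form_dual_basis) (auto simp: coord_basis7)
  ultimately have "volume7 (map frame7 [0..<7]) = 1" by simp
  then show ?thesis
    using alternating_constant_forms(3) orthonormal_frame7 unfolding volume_form_def by auto
qed

lemma inner_product_inner: "inner_product ((\<bullet>) :: 'a::euclidean_space \<Rightarrow> _)"
  by (simp add: inner_product_def inner_commute bilinear_def bounded_linear.linear
      bounded_linear_inner_right bounded_linear_inner_left)

lemma G2_metric_constant: "G2_metric (\<lambda>p. G2_constant_form) (\<lambda>p. (\<bullet>)) (\<lambda>p. volume7)"
  unfolding G2_metric_def
  using inner_product_inner volume_form_volume7 G2_metric_identity by blast

lemma torsion_free_constant: "torsion_free_G2 (\<lambda>p. G2_constant_form)"
  unfolding torsion_free_G2_def
  by (intro conjI exI[of _ "\<lambda>p. (\<bullet>)"] exI[of _ "\<lambda>p. volume7"] exI[of _ "\<lambda>p. G2_star_constant_form"] allI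
      closed_constant_form alternating_constant_forms G2_metric_constant hodge_star_G2)

text \<open>In the complex coordinates \<open>z\<^sub>1 = x\<^sub>2 + i x\<^sub>3\<close>, \<open>z\<^sub>2 = x\<^sub>4 + i x\<^sub>5\<close>, \<open>z\<^sub>3 = x\<^sub>6 + i x\<^sub>7\<close> the form is
  \<open>e\<^sup>1 \<and> \<omega> + Re (dz\<^sub>1 \<and> dz\<^sub>2 \<and> dz\<^sub>3)\<close>, which diagonal matrices in \<open>SU(3)\<close> preserve.\<close>

definition zcoord :: "nat \<Rightarrow> R7 \<Rightarrow> complex" where
  "zcoord k x = Complex (coord k x) (coord (Suc k) x)"

definition kaehler :: "R7 \<Rightarrow> R7 \<Rightarrow> real" where
  "kaehler x y = (\<Sum>k\<in>{2, 4, 6}. Im (cnj (zcoord k x) * zcoord k y))"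

definition holomorphic_volume :: "R7 \<Rightarrow> R7 \<Rightarrow> R7 \<Rightarrow> complex" where
  "holomorphic_volume x y z =
     zcoord 2 x * (zcoord 4 y * zcoord 6 z - zcoord 4 z * zcoord 6 y)
   - zcoord 2 y * (zcoord 4 x * zcoord 6 z - zcoord 4 z * zcoord 6 x)
   + zcoord 2 z * (zcoord 4 x * zcoord 6 y - zcoord 4 y * zcoord 6 x)"

lemma G2_constant_form_complex:
  "G2_constant_form [x, y, z] = coord 1 x * kaehler y z - coord 1 y * kaehler x z + coord 1 z * kaehler x y
     + Re (holomorphic_volume x y z)"
  by (simp add: G2_constant_form_def G2_terms_def det_form_3 kaehler_def holomorphic_volume_def zcoord_def
      algebra_simps)

lemma coord_1_rotate7: "coord 1 (rotate7 a b c s x) = coord 1 x"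
  by (cases x) (simp add: rotate7_def rot_action_def split: prod.split)

lemma zcoord_rotate7:
  "zcoord 2 (rotate7 a b c s x) = cis (a * s) * zcoord 2 x"
  "zcoord 4 (rotate7 a b c s x) = cis (b * s) * zcoord 4 x"
  "zcoord 6 (rotate7 a b c s x) = cis (c * s) * zcoord 6 x"
  by (cases x; simp add: zcoord_def rotate7_def rot_action_def rotation_matrix_mult_vec complex_eq_iff)+

lemma G2_constant_form_rotate7:
  assumes "a + b + c = 0" and "length vs = 3"
  shows "G2_constant_form (map (rotate7 a b c s) vs) = G2_constant_form vs"
proof -
  obtain x y z where vs: "vs = [x, y, z]" using assms(2) by (auto simp: length_3_conv)
  have kaehler: "kaehler (rotate7 a b c s u) (rotate7 a b c s v) = kaehler u v" for u v
  proof -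
    have *: "cnj (cis t) * cnj p * (cis t * q) = cnj p * q" for t p q
    proof -
      have "cnj (cis t) * cnj p * (cis t * q) = (cnj (cis t) * cis t) * (cnj p * q)" by (simp only: ac_simps)
      then show ?thesis by (simp add: cis_cnj cis_mult)
    qed
    show ?thesis by (simp add: kaehler_def zcoord_rotate7 * del: times_complex.sel)
  qed
  \<comment> \<open>Every term of \<open>holomorphic_volume\<close> contains one coordinate of each
    plane and acquires exactly this factor.\<close>
  have "cis (a * s) * (cis (b * s) * cis (c * s)) = 1"
    using assms(1) by (simp add: cis_mult add.assoc flip: distrib_right)
  then have "cis (a * s) * u * (cis (b * s) * v * (cis (c * s) * w)) = u * (v * w)" for u v w
    by (metis (no_types, lifting) mult.assoc mult.commute mult.left_commute mult_1)
  then have "holomorphic_volume (rotate7 a b c s x) (rotate7 a b c s y) (rotate7 a b c s z) =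
      holomorphic_volume x y z"
    by (simp only: holomorphic_volume_def zcoord_rotate7 right_diff_distrib)
  then show ?thesis by (simp add: vs G2_constant_form_complex coord_1_rotate7 kaehler del: One_nat_def)
qed

theorem invariant_G2_structure_constant:
  assumes "a + b + c = 0"
  shows "invariant_G2_structure (almost_abelian a b c) (\<lambda>p. G2_constant_form)"
  using assms alternating_constant_forms(1)
  by (simp add: invariant_G2_structure_def differential_form_def smooth_on_const G2_form_constant
      left_invariant_def d_left_translation_almost_abelian G2_constant_form_rotate7)

lemma rotate7_in_G2_group:
  assumes "a + b + c = 0"
  shows "rotate7 a b c s \<in> G2_group G2_constant_form"
  using assms by (simp add: G2_group_def linear_rotate7 bij_rotate7 G2_constant_form_rotate7)

section \<open>Lattices\<close>

lemma (in free_isometric_action) discrete_\<Gamma>: "discrete \<Gamma>"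
proof (rule discreteI)
  fix \<gamma> assume \<gamma>: "\<gamma> \<in> \<Gamma>"
  have "\<delta> = \<gamma>" if "\<delta> \<in> \<Gamma>" "dist \<gamma> \<delta> < \<epsilon>" for \<delta>
    using translates_separated[OF \<gamma> that(1), of \<one>] that by simp
  then show "\<gamma> isolated_in \<Gamma>"
    using \<gamma> \<epsilon>_pos unfolding isolated_in_dist_Ex_iff by blast
qed

text \<open>The projection is continuous and maps the compact set of representatives onto the
  quotient.\<close>

lemma compact_space_coset_topology:
  fixes G :: "'a::topological_space monoid" (structure)
  assumes "group G" "carrier G = UNIV" "subgroup \<Gamma> G" "compact K"
    and cover: "\<And>x. \<exists>\<gamma>\<in>\<Gamma>. \<exists>k\<in>K. x = \<gamma> \<otimes> k"
  shows "compact_space (coset_topology G \<Gamma>)"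
proof -
  interpret group G by fact
  have mem: "\<Gamma> #> x \<in> rcosets \<Gamma>" for x using assms(2) by (auto simp: RCOSETS_def)
  then have "openin (coset_topology G \<Gamma>) (rcosets \<Gamma>)"
    by (simp add: openin_coset_topology assms(2))
  moreover have "V \<subseteq> rcosets \<Gamma>" if "openin (coset_topology G \<Gamma>) V" for V
    using that by (simp add: openin_coset_topology)
  ultimately have top: "topspace (coset_topology G \<Gamma>) = rcosets \<Gamma>"
    by (metis openin_topspace openin_subset subset_antisym)
  have cont: "continuous_map euclidean (coset_topology G \<Gamma>) (\<lambda>x. \<Gamma> #> x)"
    unfolding continuous_map_def top using mem by (auto simp: openin_coset_topology assms(2))
  have "compactin (coset_topology G \<Gamma>) ((\<lambda>x. \<Gamma> #> x) ` K)"
    using assms(4) by (intro image_compactin[OF _ cont]) simp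
  moreover have "(\<lambda>x. \<Gamma> #> x) ` K = rcosets \<Gamma>"
  proof (intro subset_antisym subsetI)
    fix V assume "V \<in> rcosets \<Gamma>"
    then obtain x where V: "V = \<Gamma> #> x" by (auto simp: RCOSETS_def)
    obtain \<gamma> k where "\<gamma> \<in> \<Gamma>" "k \<in> K" "x = \<gamma> \<otimes> k" using cover by blast
    moreover from this have "\<Gamma> #> k = \<Gamma> #> x"
      using repr_independence[of x \<Gamma> k] assms(2,3) by (auto simp: r_coset_def)
    ultimately show "V \<in> (\<lambda>x. \<Gamma> #> x) ` K" using V by blast
  qed (use mem in auto)
  ultimately show ?thesis by (simp add: compact_space_def top)
qed

lemma is_latticeI:
  assumes "free_isometric_action G \<Gamma> \<epsilon>" "compact K"
    and "\<And>x. \<exists>\<gamma>\<in>\<Gamma>. \<exists>k\<in>K. x = \<gamma> \<otimes>\<^bsub>G\<^esub> k"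
  shows "is_lattice G \<Gamma>"
proof -
  interpret free_isometric_action G \<Gamma> \<epsilon> by fact
  show ?thesis
    unfolding is_lattice_def
    using subgroup_\<Gamma> discrete_\<Gamma> compact_space_coset_topology[OF group_axioms carrier_UNIV subgroup_\<Gamma> assms(2,3)]
    by blast
qed

lemma group_additive_group: "group (additive_group :: 'a::ab_group_add monoid)"
proof (rule groupI)
  show "\<exists>y\<in>carrier additive_group. y \<otimes>\<^bsub>additive_group\<^esub> x = \<one>\<^bsub>additive_group\<^esub>" for x :: 'a
    by (rule bexI[of _ "- x"]) (auto simp: additive_group_def)
qed (auto simp: additive_group_def add.assoc)

lemma free_isometric_additive_group:
  fixes L :: "'a::euclidean_space set"
  assumes "0 \<in> L" "\<And>x y. x \<in> L \<Longrightarrow> y \<in> L \<Longrightarrow> x - y \<in> L"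
    and "\<epsilon> > 0" "\<And>x. x \<in> L \<Longrightarrow> x \<noteq> 0 \<Longrightarrow> norm x \<ge> \<epsilon>"
  shows "free_isometric_action additive_group L \<epsilon>"
proof -
  interpret group "additive_group :: 'a monoid" by (rule group_additive_group)
  have neg: "- x \<in> L" if "x \<in> L" for x using assms(2)[OF assms(1) that] by simp
  have "subgroup L (additive_group :: 'a monoid)"
  proof (rule subgroupI)
    fix x assume x: "x \<in> L"
    have "inv\<^bsub>additive_group\<^esub> x = - x" by (rule inv_equality) (auto simp: additive_group_def)
    then show "inv\<^bsub>additive_group\<^esub> x \<in> L" using neg x by simp
  next
    fix x y assume "x \<in> L" "y \<in> L"
    then show "x \<otimes>\<^bsub>additive_group\<^esub> y \<in> L"
      using assms(2)[OF _ neg, of x y] by (simp add: additive_group_def)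
  qed (use assms(1) in \<open>auto simp: additive_group_def\<close>)
  then show ?thesis
    unfolding free_isometric_action_def free_isometric_action_axioms_def
    using assms(3,4) group_additive_group
    by (intro conjI allI impI) (auto simp: additive_group_def dist_norm)
qed

lemma is_lattice_integers: "is_lattice (additive_group :: real monoid) (range of_int)"
proof (rule is_latticeI)
  show "free_isometric_action (additive_group :: real monoid) (range of_int) 1"
  proof (rule free_isometric_additive_group)
    show "x - y \<in> range of_int" if "x \<in> range of_int" "y \<in> range of_int" for x y :: real
      using that by (auto simp flip: of_int_diff)
    show "(0::real) \<in> range of_int" by (rule range_eqI[of _ _ 0]) simp
  qed auto
  show "compact {0..1::real}" by simp
  show "\<exists>\<gamma>\<in>range of_int. \<exists>k\<in>{0..1}. x = \<gamma> \<otimes>\<^bsub>additive_group\<^esub> k" for x :: real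
  proof (rule bexI, rule bexI)
    show "x = of_int \<lfloor>x\<rfloor> \<otimes>\<^bsub>additive_group\<^esub> frac x" by (simp add: additive_group_def frac_def)
  qed (auto simp: less_imp_le[OF frac_lt_1])
qed

section \<open>Integral lattices with a rotation\<close>

type_synonym R6_coordinates = "real \<times> real \<times> real \<times> real \<times> real \<times> real"

definition real6 :: "Z6 \<Rightarrow> R6_coordinates" where
  "real6 = (\<lambda>(p, q, r, s, t, u). (of_int p, of_int q, of_int r, of_int s, of_int t, of_int u))"

lemma real6_add: "real6 (x + y) = real6 x + real6 y"
  by (cases x; cases y) (simp add: real6_def)

lemma additive_real6: "additive_map real6"
  by unfold_locales (rule real6_add)

lemma real6_eq_0_iff: "real6 x = 0 \<longleftrightarrow> x = 0"
  by (cases x) (simp add: real6_def zero_prod_def)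

lemma norm_real6:
  assumes "x \<noteq> 0" shows "norm (real6 x) \<ge> 1"
proof -
  obtain p q r s t u where x: "x = (p, q, r, s, t, u)" by (cases x)
  have sq: "(real_of_int n)\<^sup>2 \<ge> 1" if "n \<noteq> 0" for n
  proof -
    have "\<bar>real_of_int n\<bar> \<ge> 1" using that by linarith
    then show ?thesis using one_le_power[of "\<bar>real_of_int n\<bar>" 2] by simp
  qed
  have "p \<noteq> 0 \<or> q \<noteq> 0 \<or> r \<noteq> 0 \<or> s \<noteq> 0 \<or> t \<noteq> 0 \<or> u \<noteq> 0"
    using assms by (auto simp: x zero_prod_def)
  then have "1 \<le> (real_of_int p)\<^sup>2 + ((real_of_int q)\<^sup>2 + ((real_of_int r)\<^sup>2 + ((real_of_int s)\<^sup>2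
      + ((real_of_int t)\<^sup>2 + (real_of_int u)\<^sup>2))))"
    using sq[of p] sq[of q] sq[of r] sq[of s] sq[of t] sq[of u]
    by (smt (verit) zero_le_power2)
  then show ?thesis by (simp add: x real6_def norm_prod_def)
qed

lemma real6_fundamental_domain: "\<exists>x. \<exists>k \<in> cbox (0, 0, 0, 0, 0, 0) (1, 1, 1, 1, 1, 1). y = real6 x + k"
proof -
  obtain p q r s t u where y: "y = (p, q, r, s, t, u)" by (cases y)
  have "y = real6 (\<lfloor>p\<rfloor>, \<lfloor>q\<rfloor>, \<lfloor>r\<rfloor>, \<lfloor>s\<rfloor>, \<lfloor>t\<rfloor>, \<lfloor>u\<rfloor>) + (frac p, frac q, frac r, frac s, frac t, frac u)"
    by (simp add: y real6_def frac_def)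
  moreover have "(frac p, frac q, frac r, frac s, frac t, frac u) \<in> cbox (0, 0, 0, 0, 0, 0) (1, 1, 1, 1, 1, 1)"
    by (auto simp: cbox_Pair_eq intro: less_imp_le frac_lt_1)
  ultimately show ?thesis by blast
qed

text \<open>\<open>P\<close> passes from coordinates in a lattice basis to coordinates in the three
  rotation planes. Equivariance is required at integer points only, where it can be checked without
  extending \<open>M\<close> to real vectors.\<close>

locale rotation_lattice = finite_order_map M m for M m +
  fixes a b c :: real and P :: "R6_coordinates \<Rightarrow> R6"
  assumes linear_P: "linear P" and kernel_P: "P y = 0 \<Longrightarrow> y = 0"
    and equivariant: "rot_action a b c 1 (P (real6 x)) = P (real6 (M x))"
    and nontrivial: "a\<^sup>2 + b\<^sup>2 + c\<^sup>2 \<noteq> 0"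
begin

definition N :: "R6 set" where "N = range (\<lambda>x. P (real6 x))"

definition \<Gamma> :: "R7 set" where "\<Gamma> = range of_int \<times> N"

definition embed :: "int \<times> Z6 \<Rightarrow> R7" where
  "embed = (\<lambda>(n, x). (of_int n, P (real6 x)))"

lemma inj_P: "inj P"
  using linear_injective_0[OF linear_P] kernel_P by blast

lemma surj_P: "surj P"
proof -
  have "dim (range P) = dim (UNIV :: R6_coordinates set)"
    by (intro eucl.dim_image_eq linear_P) (auto intro: inj_on_subset[OF inj_P])
  then have "dim (range P) = DIM(R6)" by simp
  moreover have "subspace (range P)" by (intro linear_subspace_image linear_P subspace_UNIV)
  ultimately show ?thesis by (metis dim_eq_full span_eq_iff)
qed

lemma P_real6_add: "P (real6 (x + y)) = P (real6 x) + P (real6 y)"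
  by (simp add: real6_add linear_add[OF linear_P])

lemma P_real6_diff: "P (real6 (x - y)) = P (real6 x) - P (real6 y)"
  by (simp add: additive_map.diff[OF additive_real6] linear_diff[OF linear_P])

lemma P_real6_0: "P (real6 0) = 0"
  by (metis P_real6_diff diff_self)

lemma rot_action_of_nat: "rot_action a b c (real k) (P (real6 x)) = P (real6 ((M ^^ k) x))"
proof (induction k)
  case (Suc k)
  then show ?case using rot_action_add[of a b c 1 "real k"] equivariant by simp
qed simp

text \<open>The rotation at time m fixes every lattice vector, and the lattice vectors span.\<close>

lemma rot_action_m: "rot_action a b c (real m) x = x"
proof -
  have lin: "linear (\<lambda>y. rot_action a b c (real m) (P y) - P y)"
    by (intro linear_compose_sub linear_P linear_compose[OF linear_P linear_rot_action, unfolded comp_def])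
  have int: "rot_action a b c (real m) (P (real6 x)) - P (real6 x) = 0" for x
    by (simp add: rot_action_of_nat funpow_m)
  have unit: "rot_action a b c (real m) (P (r *\<^sub>R real6 x)) - P (r *\<^sub>R real6 x) = 0" for r x
    using linear_cmul[OF lin, of r "real6 x"] int by simp
  obtain y where x: "x = P y" using surj_P by blast
  obtain p q r s t u where y: "y = (p, q, r, s, t, u)" by (cases y)
  have "y = p *\<^sub>R real6 (1, 0, 0, 0, 0, 0) + (q *\<^sub>R real6 (0, 1, 0, 0, 0, 0) + (r *\<^sub>R real6 (0, 0, 1, 0, 0, 0)
      + (s *\<^sub>R real6 (0, 0, 0, 1, 0, 0) + (t *\<^sub>R real6 (0, 0, 0, 0, 1, 0) + u *\<^sub>R real6 (0, 0, 0, 0, 0, 1)))))"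
    by (simp add: y real6_def)
  then have "rot_action a b c (real m) (P y) - P y = 0"
    by (simp only: linear_add[OF lin] unit add_0)
  then show ?thesis by (simp add: x)
qed

lemma rot_action_of_int: "rot_action a b c (of_int n) (P (real6 x)) = P (real6 (act n x))"
proof -
  have "rot_action a b c (of_int n) z = rot_action a b c (real (nat (n mod int m))) z" for z
    using rotate7_period[OF m_pos rot_action_m, of n] by (auto simp: rotate7_def dest: fun_cong[of _ _ "(0, z)"])
  then show ?thesis unfolding act_def by (simp only: rot_action_of_nat)
qed

lemma embed_mul: "embed (mul g h) = embed g \<otimes>\<^bsub>almost_abelian a b c\<^esub> embed h"
  by (cases g; cases h)
     (simp only: embed_def mul_Pair prod.case almost_abelian_def monoid.simps rot_action_of_int P_real6_add of_int_add)

lemma inj_embed: "inj embed"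
proof (rule injI)
  fix g h assume *: "embed g = embed h"
  then have "fst g = fst h" "P (real6 (snd g)) = P (real6 (snd h))"
    by (simp_all add: embed_def case_prod_beta)
  moreover from this have "real6 (snd g - snd h) = 0" by (intro kernel_P) (simp add: P_real6_diff)
  then have "snd g - snd h = 0" by (simp only: real6_eq_0_iff)
  ultimately show "g = h" by (intro prod_eqI) simp_all
qed

lemma range_embed: "range embed = \<Gamma>"
proof (intro subset_antisym subsetI)
  fix p assume "p \<in> \<Gamma>"
  then have "fst p \<in> range of_int" "snd p \<in> range (\<lambda>x. P (real6 x))"
    by (simp_all only: \<Gamma>_def N_def mem_Times_iff)
  then obtain n x where "fst p = of_int n" "snd p = P (real6 x)" by (elim rangeE)
  then have "p = embed (n, x)" by (simp add: embed_def prod_eq_iff)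
  then show "p \<in> range embed" by blast
next
  fix p assume "p \<in> range embed"
  then obtain g where p: "p = embed g" by (rule rangeE)
  have "(of_int (fst g), P (real6 (snd g))) \<in> \<Gamma>" unfolding \<Gamma>_def N_def by (intro SigmaI rangeI)
  then show "p \<in> \<Gamma>" by (simp only: p embed_def case_prod_beta)
qed

text \<open>An injective linear map shrinks norms by a bounded factor only, and a non-zero integer
  vector has norm at least 1.\<close>

lemma norm_bounded_below: "\<exists>B>0. \<forall>x. x \<noteq> 0 \<longrightarrow> norm (P (real6 x)) \<ge> B"
proof -
  obtain B where B: "B > 0" "\<And>y. B * norm y \<le> norm (P y)"
    using linear_inj_bounded_below_pos[OF linear_P inj_P] by blast
  have "B \<le> norm (P (real6 x))" if "x \<noteq> 0" for x
    using B(2)[of "real6 x"] mult_left_mono[OF norm_real6[OF that], of B] B(1) by linarith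
  then show ?thesis using B(1) by blast
qed

lemma subgroup_\<Gamma>: "subgroup \<Gamma> (almost_abelian a b c)"
proof -
  interpret group "almost_abelian a b c" by (rule group_almost_abelian)
  show ?thesis
    unfolding range_embed[symmetric]
  proof (rule subgroupI)
    fix p assume "p \<in> range embed"
    then obtain n x where p: "p = embed (n, x)" by auto
    have "embed (- n, - act (- n) x) \<otimes>\<^bsub>almost_abelian a b c\<^esub> p = embed (mul (- n, - act (- n) x) (n, x))"
      by (simp only: p embed_mul)
    also have "\<dots> = \<one>\<^bsub>almost_abelian a b c\<^esub>"
      by (simp add: embed_def P_real6_0 almost_abelian_def)
    finally have "inv\<^bsub>almost_abelian a b c\<^esub> p = embed (- n, - act (- n) x)"
      by (intro inv_equality) (auto simp: almost_abelian_def)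
    then show "inv\<^bsub>almost_abelian a b c\<^esub> p \<in> range embed" by simp
  next
    fix p q assume "p \<in> range embed" "q \<in> range embed"
    then show "p \<otimes>\<^bsub>almost_abelian a b c\<^esub> q \<in> range embed" by (auto simp flip: embed_mul)
  qed (auto simp: almost_abelian_def)
qed

text \<open>An element with non-zero first component moves every point by at least 1 in that
  direction; any other element is a plain translation by a lattice vector, whose length is bounded
  below.\<close>

lemma free_isometric: "\<exists>\<epsilon>. free_isometric_action (almost_abelian a b c) \<Gamma> \<epsilon>"
proof -
  obtain B where B: "B > 0" "\<And>x. x \<noteq> 0 \<Longrightarrow> norm (P (real6 x)) \<ge> B" using norm_bounded_below by blast
  have "free_isometric_action (almost_abelian a b c) \<Gamma> (min 1 B)"
    unfolding free_isometric_action_def free_isometric_action_axioms_def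
  proof (intro conjI allI impI group_almost_abelian subgroup_\<Gamma> dist_almost_abelian_left)
    show "carrier (almost_abelian a b c) = UNIV" by (simp add: almost_abelian_def)
    show "min 1 B > 0" using B(1) by simp
    fix \<gamma> p :: R7 assume \<gamma>: "\<gamma> \<in> \<Gamma>" "\<gamma> \<noteq> \<one>\<^bsub>almost_abelian a b c\<^esub>"
    then obtain n x where n: "\<gamma> = (of_int n, P (real6 x))" by (auto simp: \<Gamma>_def N_def)
    obtain s y where p: "p = (s, y)" by (cases p)
    have d: "dist (\<gamma> \<otimes>\<^bsub>almost_abelian a b c\<^esub> p) p =
        norm (real_of_int n, P (real6 x) + rot_action a b c (of_int n) y - y)"
      by (simp add: n p almost_abelian_def dist_norm)
    show "min 1 B \<le> dist (\<gamma> \<otimes>\<^bsub>almost_abelian a b c\<^esub> p) p"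
    proof (cases "n = 0")
      case True
      have "x \<noteq> 0" using \<gamma>(2) n True P_real6_0 by (auto simp: almost_abelian_def)
      then have "B \<le> dist (\<gamma> \<otimes>\<^bsub>almost_abelian a b c\<^esub> p) p"
        unfolding d using B(2) True by (simp add: norm_Pair)
      then show ?thesis by simp
    next
      case False
      then have "1 \<le> \<bar>real_of_int n\<bar>" by linarith
      also have "\<dots> \<le> dist (\<gamma> \<otimes>\<^bsub>almost_abelian a b c\<^esub> p) p"
        unfolding d using norm_fst_le[of "real_of_int n"] by (simp add: real_norm_def)
      finally show ?thesis by simp
    qed
  qed
  then show ?thesis by blast
qed

definition fundamental_domain :: "R6 set" where
  "fundamental_domain = P ` cbox (0, 0, 0, 0, 0, 0) (1, 1, 1, 1, 1, 1)"

lemma compact_fundamental_domain: "compact fundamental_domain"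
  unfolding fundamental_domain_def
  by (intro compact_continuous_image linear_continuous_on compact_cbox)
     (use linear_P linear_conv_bounded_linear in blast)

lemma fundamental_domain: "\<exists>x. \<exists>k\<in>fundamental_domain. y = P (real6 x) + k"
proof -
  obtain z where y: "y = P z" using surj_P by blast
  obtain x k where "k \<in> cbox (0, 0, 0, 0, 0, 0) (1, 1, 1, 1, 1, 1)" "z = real6 x + k"
    using real6_fundamental_domain by blast
  then have "P k \<in> fundamental_domain" "y = P (real6 x) + P k"
    by (auto simp: y fundamental_domain_def linear_add[OF linear_P])
  then show ?thesis by blast
qed

lemma is_lattice_N: "is_lattice (additive_group :: R6 monoid) N"
proof -
  obtain B where B: "B > 0" "\<And>x. x \<noteq> 0 \<Longrightarrow> norm (P (real6 x)) \<ge> B" using norm_bounded_below by blast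
  show ?thesis
  proof (rule is_latticeI[OF _ compact_fundamental_domain])
    show "free_isometric_action (additive_group :: R6 monoid) N B"
    proof (rule free_isometric_additive_group)
      show "0 \<in> N" unfolding N_def by (rule range_eqI[of _ _ 0]) (simp only: P_real6_0)
      show "x - y \<in> N" if "x \<in> N" "y \<in> N" for x y
        using that by (auto simp: N_def simp flip: P_real6_diff)
      show "B \<le> norm x" if x: "x \<in> N" "x \<noteq> 0" for x
      proof -
        obtain v where v: "x = P (real6 v)" using x(1) unfolding N_def by (rule rangeE)
        with x(2) P_real6_0 have "v \<noteq> 0" by metis
        then show ?thesis using B(2) v by metis
      qed
    qed (fact B)
    show "\<exists>\<gamma>\<in>N. \<exists>k\<in>fundamental_domain. x = \<gamma> \<otimes>\<^bsub>additive_group\<^esub> k" for x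
      using fundamental_domain[of x] by (auto simp: N_def additive_group_def)
  qed
qed

lemma splittable_\<Gamma>: "splittable \<Gamma>"
  unfolding splittable_def \<Gamma>_def using is_lattice_integers is_lattice_N by blast

lemma flat_solvmanifold: "flat_almost_abelian_solvmanifold a b c \<Gamma>"
  unfolding flat_almost_abelian_solvmanifold_def
proof
  obtain \<epsilon> where \<epsilon>: "free_isometric_action (almost_abelian a b c) \<Gamma> \<epsilon>" using free_isometric by blast
  obtain B where B: "\<And>k. k \<in> fundamental_domain \<Longrightarrow> norm k \<le> B"
    using compact_imp_bounded[OF compact_fundamental_domain] by (auto simp: bounded_iff)
  show "is_lattice (almost_abelian a b c) \<Gamma>"
  proof (rule is_latticeI[OF \<epsilon>])
    show "compact ({0..1::real} \<times> cball (0 :: R6) B)" by (intro compact_Times) auto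
    fix p :: R7
    obtain s y where p: "p = (s, y)" by (cases p)
    obtain x k where k: "k \<in> fundamental_domain" "y = P (real6 x) + k" using fundamental_domain by blast
    \<comment> \<open>Multiplication by an element with first component \<lfloor>s\<rfloor> rotates
      the second factor, which is undone in advance. The rotated vector may leave the fundamental
      domain but keeps its norm, hence the ball as compact set.\<close>
    define k' where "k' = rot_action a b c (- of_int \<lfloor>s\<rfloor>) k"
    have "rot_action a b c (of_int \<lfloor>s\<rfloor>) k' = k" unfolding k'_def by (simp flip: rot_action_add)
    then have "p = (of_int \<lfloor>s\<rfloor>, P (real6 x)) \<otimes>\<^bsub>almost_abelian a b c\<^esub> (frac s, k')"
      by (simp add: p almost_abelian_def k(2) frac_def)
    moreover have "(frac s, k') \<in> {0..1} \<times> cball 0 B"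
      using B[OF k(1)] by (auto simp: k'_def less_imp_le[OF frac_lt_1])
    moreover have "(of_int \<lfloor>s\<rfloor>, P (real6 x)) \<in> \<Gamma>" by (auto simp: \<Gamma>_def N_def)
    ultimately show "\<exists>\<gamma>\<in>\<Gamma>. \<exists>k\<in>{0..1} \<times> cball 0 B. p = \<gamma> \<otimes>\<^bsub>almost_abelian a b c\<^esub> k" by blast
  qed
qed (fact nontrivial)

end

lemma diffeomorphic_imp_isomorphic_maps:
  assumes "rotation_lattice M m a b c P" "rotation_lattice M' m' a' b' c' P'"
    and "diffeomorphic_quotients (almost_abelian a b c) (rotation_lattice.\<Gamma> P)
      (almost_abelian a' b' c') (rotation_lattice.\<Gamma> P')"
  shows "m = m' \<and> (\<exists>\<theta>. isomorphic_maps M M' m \<theta>)"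
proof -
  interpret A: rotation_lattice M m a b c P by fact
  interpret B: rotation_lattice M' m' a' b' c' P' by fact
  obtain \<theta> where \<theta>: "bij_betw \<theta> A.\<Gamma> B.\<Gamma>"
    "\<And>\<gamma> \<gamma>'. \<gamma> \<in> A.\<Gamma> \<Longrightarrow> \<gamma>' \<in> A.\<Gamma> \<Longrightarrow>
      \<theta> (\<gamma> \<otimes>\<^bsub>almost_abelian a b c\<^esub> \<gamma>') = \<theta> \<gamma> \<otimes>\<^bsub>almost_abelian a' b' c'\<^esub> \<theta> \<gamma>'"
    using diffeomorphic_imp_isomorphic[OF _ _ assms(3)] A.free_isometric B.free_isometric by metis
  define \<Theta> where "\<Theta> g = inv_into UNIV B.embed (\<theta> (A.embed g))" for g
  have bijA: "bij_betw A.embed UNIV A.\<Gamma>" and bijB: "bij_betw B.embed UNIV B.\<Gamma>"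
    using A.inj_embed A.range_embed B.inj_embed B.range_embed by (auto simp: bij_betw_def)
  have inA: "A.embed g \<in> A.\<Gamma>" for g using A.range_embed by auto
  have embed: "B.embed (\<Theta> g) = \<theta> (A.embed g)" for g
    unfolding \<Theta>_def using bij_betw_inv_into_right[OF bijB] bij_betw_apply[OF \<theta>(1) inA] by blast
  have "bij (inv_into UNIV B.embed \<circ> (\<theta> \<circ> A.embed))"
    by (intro bij_betw_trans[OF bij_betw_trans[OF bijA \<theta>(1)] bij_betw_inv_into[OF bijB]])
  then have bij: "bij \<Theta>" by (simp add: \<Theta>_def[abs_def] comp_def)
  have hom: "\<Theta> (A.mul g h) = B.mul (\<Theta> g) (\<Theta> h)" for g h
  proof -
    have "B.embed (\<Theta> (A.mul g h)) = B.embed (B.mul (\<Theta> g) (\<Theta> h))"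
      by (simp only: embed A.embed_mul B.embed_mul \<theta>(2) inA)
    then show ?thesis using B.inj_embed by (simp add: inj_eq)
  qed
  have hom': "inv_into UNIV \<Theta> (B.mul g h) = A.mul (inv_into UNIV \<Theta> g) (inv_into UNIV \<Theta> h)" for g h
    using hom bij by (metis bij_inv_eq_iff)
  have "m' dvd m"
    using isomorphic_order_dvd[OF A.finite_order_map_axioms B.finite_order_map_axioms bij_is_surj[OF bij] hom] .
  moreover have "m dvd m'"
    using isomorphic_order_dvd[OF B.finite_order_map_axioms A.finite_order_map_axioms
        bij_is_surj[OF bij_imp_bij_inv[OF bij]] hom'] .
  ultimately have eq: "m = m'" by (metis dvd_antisym)
  have "isomorphic_maps M M' m \<Theta>"
    unfolding isomorphic_maps_def isomorphic_maps_axioms_def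
    using A.finite_order_map_axioms B.finite_order_map_axioms bij hom eq by auto
  with eq show ?thesis by blast
qed

section \<open>Thirty lattices\<close>

definition vec6 :: "real \<Rightarrow> real \<Rightarrow> real \<Rightarrow> real \<Rightarrow> real \<Rightarrow> real \<Rightarrow> R6" where
  "vec6 u1 u2 v1 v2 w1 w2 = (vector [u1, u2], vector [v1, v2], vector [w1, w2])"

lemma vec6_eq_iff [simp]:
  "vec6 p q r s t u = vec6 p' q' r' s' t' u' \<longleftrightarrow> p = p' \<and> q = q' \<and> r = r' \<and> s = s' \<and> t = t' \<and> u = u'"
  by (auto simp: vec6_def vec_eq_iff forall_2)

lemma vec6_eq_0_iff [simp]:
  "vec6 p q r s t u = 0 \<longleftrightarrow> p = 0 \<and> q = 0 \<and> r = 0 \<and> s = 0 \<and> t = 0 \<and> u = 0"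
  by (auto simp: vec6_def vec_eq_iff forall_2 zero_prod_def)

lemma vec6_add [simp]:
  "vec6 p q r s t u + vec6 p' q' r' s' t' u' = vec6 (p + p') (q + q') (r + r') (s + s') (t + t') (u + u')"
  by (auto simp: vec6_def vec_eq_iff forall_2)

lemma vec6_scaleR [simp]:
  "k *\<^sub>R vec6 p q r s t u = vec6 (k * p) (k * q) (k * r) (k * s) (k * t) (k * u)"
  by (auto simp: vec6_def vec_eq_iff forall_2)

lemma rot_action_vec6 [simp]:
  "rot_action a b c 1 (vec6 p q r s t u) =
     vec6 (cos a * p - sin a * q) (sin a * p + cos a * q)
       (cos b * r - sin b * s) (sin b * r + cos b * s) (cos c * t - sin c * u) (sin c * t + cos c * u)"
  by (simp add: rot_action_def vec6_def rotation_matrix_mult_vec)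

text \<open>Opaque names for the irrational entries: with their squares as rewrite rules, the
  equivariance of a lattice becomes polynomial arithmetic.\<close>

definition half_sqrt2 :: real where "half_sqrt2 = sqrt 2 / 2"

definition half_sqrt3 :: real where "half_sqrt3 = sqrt 3 / 2"

lemma half_sqrt_squares [simp]:
  "half_sqrt2 * half_sqrt2 = 1 / 2" "half_sqrt2 * (half_sqrt2 * x) = x / 2"
  "half_sqrt3 * half_sqrt3 = 3 / 4" "half_sqrt3 * (half_sqrt3 * x) = 3 * x / 4"
  by (simp_all add: half_sqrt2_def half_sqrt3_def)

lemma cos_sin_values:
  "cos (pi / 3) = 1 / 2" "sin (pi / 3) = half_sqrt3"
  "cos (2 * pi / 3) = - 1 / 2" "sin (2 * pi / 3) = half_sqrt3"
  "cos (4 * pi / 3) = - 1 / 2" "sin (4 * pi / 3) = - half_sqrt3"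
  "cos (pi / 4) = half_sqrt2" "sin (pi / 4) = half_sqrt2"
  "cos (3 * pi / 4) = - half_sqrt2" "sin (3 * pi / 4) = half_sqrt2"
  "cos (pi / 6) = half_sqrt3" "sin (pi / 6) = 1 / 2"
  "cos (5 * pi / 6) = - half_sqrt3" "sin (5 * pi / 6) = 1 / 2"
proof -
  have "4 * pi / 3 = pi / 3 + pi" "3 * pi / 4 = pi - pi / 4" "5 * pi / 6 = pi - pi / 6" by simp_all
  then show "cos (4 * pi / 3) = - 1 / 2" "sin (4 * pi / 3) = - half_sqrt3"
    "cos (3 * pi / 4) = - half_sqrt2" "sin (3 * pi / 4) = half_sqrt2"
    "cos (5 * pi / 6) = - half_sqrt3" "sin (5 * pi / 6) = 1 / 2"
    by (simp_all only: cos_periodic_pi sin_periodic_pi cos_pi_minus sin_pi_minus)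
      (simp_all add: half_sqrt2_def half_sqrt3_def cos_60 sin_60 cos_45 sin_45 cos_30 sin_30)
qed (simp_all add: half_sqrt2_def half_sqrt3_def cos_60 sin_60 cos_45 sin_45 cos_30 sin_30 cos_120 sin_120)

section \<open>Executable test for the order of an integral map\<close>

definition unit6 :: "Z6 list" where
  "unit6 = [(1, 0, 0, 0, 0, 0), (0, 1, 0, 0, 0, 0), (0, 0, 1, 0, 0, 0),
     (0, 0, 0, 1, 0, 0), (0, 0, 0, 0, 1, 0), (0, 0, 0, 0, 0, 1)]"

text \<open>Basis vectors suffice, since an additive map that fixes them is the identity.\<close>

definition has_order :: "(Z6 \<Rightarrow> Z6) \<Rightarrow> nat \<Rightarrow> bool" where
  "has_order M m \<longleftrightarrow> list_all (\<lambda>e. (M ^^ m) e = e) unit6 \<and>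
     list_all (\<lambda>k. list_ex (\<lambda>e. (M ^^ k) e \<noteq> e) unit6) [1..<m]"

lemma additive_map_eq_id:
  assumes N: "additive_map (N :: Z6 \<Rightarrow> Z6)" and unit: "list_all (\<lambda>e. N e = e) unit6"
  shows "N = id"
proof
  fix x :: Z6
  interpret N: additive_map N by fact
  have scale: "N (a * p, a * q, a * r, a * s, a * t, a * u) = (a * p, a * q, a * r, a * s, a * t, a * u)"
    if e: "N (p, q, r, s, t, u) = (p, q, r, s, t, u)" for a p q r s t u
  proof (cases "a \<ge> 0")
    case True
    then show ?thesis using N.nsmul[of "nat a" "(p, q, r, s, t, u)"] e by simp
  next
    case False
    then show ?thesis
      using N.diff[of "(0, 0, 0, 0, 0, 0)" "nsmul (nat (- a)) (p, q, r, s, t, u)"] N.nsmul[of "nat (- a)" "(p, q, r, s, t, u)"] e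
        N.zero[unfolded zero_prod_def]
      by simp
  qed
  obtain p q r s t u where x: "x = (p, q, r, s, t, u)" by (cases x)
  \<comment> \<open>Even the zeros are written as multiples, so that each summand matches
    \<open>scale\<close>.\<close>
  have "x = (p * 1, p * 0, p * 0, p * 0, p * 0, p * 0) + ((q * 0, q * 1, q * 0, q * 0, q * 0, q * 0)
      + ((r * 0, r * 0, r * 1, r * 0, r * 0, r * 0) + ((s * 0, s * 0, s * 0, s * 1, s * 0, s * 0)
      + ((t * 0, t * 0, t * 0, t * 0, t * 1, t * 0) + (u * 0, u * 0, u * 0, u * 0, u * 0, u * 1)))))"
    by (simp add: x)
  moreover have "N \<dots> = \<dots>"
    unfolding N.add using unit by (simp only: unit6_def list.pred_inject scale)
  ultimately show "N x = id x" by simp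
qed

type_synonym lattice_data =
  "nat \<times> real \<times> real \<times> real \<times> (Z6 \<Rightarrow> Z6) \<times> (R6_coordinates \<Rightarrow> R6)"

fun valid_lattice :: "lattice_data \<Rightarrow> bool" where
  "valid_lattice (m, a, b, c, M, P) \<longleftrightarrow> rotation_lattice M m a b c P \<and> a + b + c = 0"

lemma valid_latticeI:
  assumes add: "\<And>x y. M (x + y) = M x + M y" and m: "m > 0" "has_order M m"
    and P: "linear P" "\<And>p q r s t u. P (p, q, r, s, t, u) = 0 \<Longrightarrow> p = 0 \<and> q = 0 \<and> r = 0 \<and> s = 0 \<and> t = 0 \<and> u = 0"
    and eq: "\<And>p q r s t u. rot_action a b c 1 (P (real6 (p, q, r, s, t, u))) = P (real6 (M (p, q, r, s, t, u)))"
    and "a + b + c = 0" "a \<noteq> 0"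
  shows "valid_lattice (m, a, b, c, M, P)"
proof -
  have M: "additive_map M" by unfold_locales (rule add)
  have "M ^^ m = id"
    using m(2) additive_map_eq_id[OF additive_map_funpow[OF M]] by (simp add: has_order_def)
  moreover have "M ^^ k \<noteq> id" if "0 < k" "k < m" for k
  proof -
    have "k \<in> set [1..<m]" using that by simp
    then obtain e where "(M ^^ k) e \<noteq> e" using m(2) unfolding has_order_def list_all_iff list_ex_iff by blast
    then show ?thesis by (metis id_apply)
  qed
  moreover have "y = 0" if "P y = 0" for y
    using that P(2) by (cases y) (auto simp: zero_prod_def)
  moreover have "rot_action a b c 1 (P (real6 x)) = P (real6 (M x))" for x
    using eq by (cases x) simp
  moreover have "a\<^sup>2 + b\<^sup>2 + c\<^sup>2 \<noteq> 0"
    using \<open>a \<noteq> 0\<close> by (smt (verit) zero_less_power2 zero_le_power2)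
  ultimately show ?thesis
    using M m(1) P(1) assms(7)
    by (simp add: rotation_lattice_def rotation_lattice_axioms_def finite_order_map_def finite_order_map_axioms_def)
qed

section \<open>Counting fixed residues by linear algebra\<close>

fun dot :: "int list \<Rightarrow> int list \<Rightarrow> int" where
  "dot (a # r) (y # x) = a * y + dot r x"
| "dot _ _ = 0"

lemma dot_diff_scale:
  assumes "length r = length x" "length r' = length x"
  shows "[dot (map2 (\<lambda>a b. (a - k * b) mod q) r r') x = dot r x - k * dot r' x] (mod q)"
  using assms
proof (induction x arbitrary: r r')
  case (Cons y x)
  obtain a s b s' where r: "r = a # s" "r' = b # s'" using Cons.prems by (cases r; cases r') auto
  have "[(a - k * b) mod q * y + dot (map2 (\<lambda>a b. (a - k * b) mod q) s s') x =
      (a - k * b) * y + (dot s x - k * dot s' x)] (mod q)"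
    using Cons by (intro cong_add cong_mult) (auto simp: r)
  then show ?case by (simp add: r algebra_simps)
qed simp

definition solutions :: "int \<Rightarrow> nat \<Rightarrow> int list list \<Rightarrow> int list set" where
  "solutions q n rs = {x. length x = n \<and> set x \<subseteq> {0..<q} \<and> (\<forall>r\<in>set rs. q dvd dot r x)}"

text \<open>Gaussian elimination over \<open>\<int>/q\<close> for \<open>q = 2, 3\<close>, where every unit is its own inverse.\<close>

primrec count_solutions :: "nat \<Rightarrow> nat \<Rightarrow> int list list \<Rightarrow> nat" where
  "count_solutions q 0 rs = 1"
| "count_solutions q (Suc n) rs = (case find (\<lambda>r. hd r mod int q \<noteq> 0) rs of
     None \<Rightarrow> q * count_solutions q n (map tl rs)
   | Some r \<Rightarrow> count_solutions q n
       (map (\<lambda>r'. map2 (\<lambda>a b. (a - hd r' * hd r * b) mod int q) (tl r') (tl r)) rs))"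

text \<open>Without a pivot the first unknown is free and contributes the factor q. With a pivot it
  is determined by the others, and elimination turns the pivot row itself into zero, so that the row
  may stay in the list.\<close>

lemma card_solutions:
  assumes q: "q = 2 \<or> q = 3"
  shows "\<forall>r\<in>set rs. length r = n \<Longrightarrow> card (solutions (int q) n rs) = count_solutions q n rs"
proof (induction n arbitrary: rs)
  case 0
  then have "solutions (int q) 0 rs = {[]}" by (auto simp: solutions_def)
  then show ?case by simp
next
  case (Suc n)
  have dot: "dot r (y # x) = hd r * y + dot (tl r) x" if "r \<in> set rs" for r x y
    using Suc.prems that by (cases r) auto
  have tl: "length (tl r) = n" if "r \<in> set rs" for r using Suc.prems that by simp
  show ?case
  proof (cases "find (\<lambda>r. hd r mod int q \<noteq> 0) rs")
    case None
    then have zero: "int q dvd hd r" if "r \<in> set rs" for r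
      using that by (auto simp: find_None_iff dvd_eq_mod_eq_0)
    have "solutions (int q) (Suc n) rs = (\<lambda>(y, x). y # x) ` ({0..<int q} \<times> solutions (int q) n (map tl rs))"
    proof (intro subset_antisym subsetI)
      fix z assume z: "z \<in> solutions (int q) (Suc n) rs"
      then obtain y x where [simp]: "z = y # x" by (cases z) (auto simp: solutions_def)
      have "int q dvd dot (tl r) x" if "r \<in> set rs" for r
        using z that zero[OF that] dot[OF that, of y x] by (auto simp: solutions_def dvd_add_right_iff)
      then show "z \<in> (\<lambda>(y, x). y # x) ` ({0..<int q} \<times> solutions (int q) n (map tl rs))"
        using z by (auto simp: solutions_def intro!: image_eqI[of _ _ "(y, x)"])
    next
      fix z assume "z \<in> (\<lambda>(y, x). y # x) ` ({0..<int q} \<times> solutions (int q) n (map tl rs))"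
      then show "z \<in> solutions (int q) (Suc n) rs"
        using zero dot by (auto simp: solutions_def)
    qed
    moreover have "inj_on (\<lambda>(y, x). y # x) A" for A :: "(int \<times> int list) set" by (auto simp: inj_on_def)
    moreover have "card (solutions (int q) n (map tl rs)) = count_solutions q n (map tl rs)"
      by (rule Suc.IH) (use tl in auto)
    ultimately show ?thesis using None by (simp add: card_image card_cartesian_product)
  next
    case (Some r)
    then have r: "r \<in> set rs" "hd r mod int q \<noteq> 0" by (auto simp: find_Some_iff)
    define c where "c = hd r"
    define f where "f r' = map2 (\<lambda>a b. (a - hd r' * c * b) mod int q) (tl r') (tl r)" for r'
    have "(c mod int q)\<^sup>2 mod int q = 1"
    proof -
      have "c mod int q \<in> {0..<int q}" using q by auto
      then have "c mod int q = 1 \<or> (q = 3 \<and> c mod int q = 2)" using q r(2) by (auto simp: c_def)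
      then show ?thesis using q by auto
    qed
    then have cc: "[c * c = 1] (mod int q)"
      using q by (auto simp: cong_def power2_eq_square mod_mult_eq)
    have len: "length (f r') = n" if "r' \<in> set rs" for r' using tl that r(1) by (simp add: f_def)
    have f: "[dot (f r') x = dot (tl r') x - hd r' * c * dot (tl r) x] (mod int q)"
      if "r' \<in> set rs" "length x = n" for r' x
      unfolding f_def using tl that r(1) by (intro dot_diff_scale) auto
    have iff: "y # x \<in> solutions (int q) (Suc n) rs \<longleftrightarrow>
        x \<in> solutions (int q) n (map f rs) \<and> y = (- c * dot (tl r) x) mod int q" for y x
    proof -
      let ?D = "dot (tl r) x"
      have row: "int q dvd dot r' (y # x) \<longleftrightarrow> int q dvd dot (f r') x"
        if "r' \<in> set rs" "length x = n" "[y = - c * ?D] (mod int q)" for r'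
      proof -
        have "[hd r' * y + dot (tl r') x = hd r' * (- c * ?D) + dot (tl r') x] (mod int q)"
          using that(3) by (intro cong_add cong_mult cong_refl)
        also have "hd r' * (- c * ?D) + dot (tl r') x = dot (tl r') x - hd r' * c * ?D" by simp
        also have "[\<dots> = dot (f r') x] (mod int q)" using f[OF that(1,2)] by (rule cong_sym)
        finally show ?thesis using dot[OF that(1)] cong_dvd_iff by simp
      qed
      have pivot: "[y = - c * ?D] (mod int q)" if "int q dvd dot r (y # x)"
      proof -
        have "[c * (c * y + ?D) = c * 0] (mod int q)"
          using that dot[OF r(1)] by (intro cong_mult cong_refl) (simp add: c_def cong_0_iff)
        then have 1: "[c * c * y + c * ?D = 0] (mod int q)" by (simp add: algebra_simps)
        have 2: "[c * c * y + c * ?D = 1 * y + c * ?D] (mod int q)"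
          using cc by (intro cong_add cong_mult cong_refl)
        have "[y + c * ?D = 0] (mod int q)" using cong_trans[OF cong_sym[OF 2] 1] by simp
        then have "[y + c * ?D - c * ?D = 0 - c * ?D] (mod int q)" by (intro cong_diff cong_refl)
        then show ?thesis by simp
      qed
      have range: "y = k mod int q \<longleftrightarrow> [y = k] (mod int q)" if "y \<in> {0..<int q}" for k
        using that by (auto simp: cong_def)
      have mod: "k mod int q \<in> {0..<int q}" for k using q by auto
      show ?thesis
      proof
        assume yx: "y # x \<in> solutions (int q) (Suc n) rs"
        then have x: "length x = n" "set x \<subseteq> {0..<int q}" "y \<in> {0..<int q}"
            and dvd: "\<And>r'. r' \<in> set rs \<Longrightarrow> int q dvd dot r' (y # x)"
          by (auto simp: solutions_def)
        have y: "[y = - c * ?D] (mod int q)" using pivot dvd r(1) by blast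
        then have "int q dvd dot (f r') x" if "r' \<in> set rs" for r'
          using row[OF that x(1)] dvd[OF that] by blast
        with x y range show "x \<in> solutions (int q) n (map f rs) \<and> y = (- c * ?D) mod int q"
          by (auto simp: solutions_def simp del: mult_minus_left)
      next
        assume "x \<in> solutions (int q) n (map f rs) \<and> y = (- c * ?D) mod int q"
        then have x: "length x = n" "set x \<subseteq> {0..<int q}" "y \<in> {0..<int q}" "[y = - c * ?D] (mod int q)"
            and dvd: "\<And>r'. r' \<in> set rs \<Longrightarrow> int q dvd dot (f r') x"
          using mod by (auto simp: solutions_def cong_def)
        then have "int q dvd dot r' (y # x)" if "r' \<in> set rs" for r'
          using row[OF that x(1,4)] dvd[OF that] by blast
        with x show "y # x \<in> solutions (int q) (Suc n) rs" by (auto simp: solutions_def)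
      qed
    qed
    have "bij_betw tl (solutions (int q) (Suc n) rs) (solutions (int q) n (map f rs))"
    proof (rule bij_betwI[where g = "\<lambda>x. (- c * dot (tl r) x) mod int q # x"])
      show "tl \<in> solutions (int q) (Suc n) rs \<rightarrow> solutions (int q) n (map f rs)"
      proof
        fix z assume z: "z \<in> solutions (int q) (Suc n) rs"
        then obtain y x where "z = y # x" by (cases z) (auto simp: solutions_def)
        with z iff[of y x] show "tl z \<in> solutions (int q) n (map f rs)" by simp
      qed
      show "(- c * dot (tl r) (tl z)) mod int q # tl z = z" if z: "z \<in> solutions (int q) (Suc n) rs" for z
      proof -
        obtain y x where "z = y # x" using z by (cases z) (auto simp: solutions_def)
        with z iff[of y x] show ?thesis by simp
      qed
    qed (use iff in auto)
    then have "card (solutions (int q) (Suc n) rs) = card (solutions (int q) n (map f rs))"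
      by (rule bij_betw_same_card)
    also have "\<dots> = count_solutions q n (map f rs)" by (rule Suc.IH) (use len in auto)
    finally show ?thesis using Some by (simp add: f_def[abs_def] c_def)
  qed
qed

definition list6 :: "Z6 \<Rightarrow> int list" where
  "list6 = (\<lambda>(p, q, r, s, t, u). [p, q, r, s, t, u])"

text \<open>The matrix of \<open>N\<close> minus the identity, whose kernel modulo q consists of the
  fixed residues.\<close>

definition rows :: "(Z6 \<Rightarrow> Z6) \<Rightarrow> int list list" where
  "rows N = map (\<lambda>i. map (\<lambda>e. list6 (N e) ! i - list6 e ! i) unit6) [0..<6]"

definition fixed_count :: "nat \<Rightarrow> (Z6 \<Rightarrow> Z6) \<Rightarrow> nat" where
  "fixed_count q N = count_solutions q 6 (rows N)"

lemma additive_map_int: "additive_map (f :: int \<Rightarrow> int) \<Longrightarrow> f a = a * f 1"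
proof -
  assume "additive_map f"
  then interpret additive_map f .
  show ?thesis
  proof (cases "a \<ge> 0")
    case True
    then show ?thesis using nsmul[of "nat a" 1] by simp
  next
    case False
    then show ?thesis using nsmul[of "nat (- a)" 1] diff[of 0 "- a"] by simp
  qed
qed

lemma rows_apply:
  assumes N: "additive_map N" and "i < 6"
  shows "dot (rows N ! i) (list6 x) = list6 (N x) ! i - list6 x ! i"
proof -
  interpret N: additive_map N by fact
  obtain p q r s t u where x: "x = (p, q, r, s, t, u)" by (cases x)
  define c where "c y = list6 y ! i" for y
  have c_add: "c (y + z) = c y + c z" for y z
    using \<open>i < 6\<close> by (cases y; cases z) (auto simp: c_def list6_def nth_Cons' zero_prod_def)
  have lin: "c (N (g a)) = a * c (N (g 1))" if "\<And>a b. g (a + b) = g a + g b" for g :: "int \<Rightarrow> Z6" and a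
    by (rule additive_map_int) (unfold_locales, simp add: that N.add c_add)
  have "x = (p, 0, 0, 0, 0, 0) + ((0, q, 0, 0, 0, 0) + ((0, 0, r, 0, 0, 0) + ((0, 0, 0, s, 0, 0)
      + ((0, 0, 0, 0, t, 0) + (0, 0, 0, 0, 0, u)))))"
    by (simp add: x)
  then have "c (N x) = c (N (p, 0, 0, 0, 0, 0)) + (c (N (0, q, 0, 0, 0, 0)) + (c (N (0, 0, r, 0, 0, 0))
      + (c (N (0, 0, 0, s, 0, 0)) + (c (N (0, 0, 0, 0, t, 0)) + c (N (0, 0, 0, 0, 0, u))))))"
    by (simp only: N.add c_add)
  also have "\<dots> = p * c (N (1, 0, 0, 0, 0, 0)) + (q * c (N (0, 1, 0, 0, 0, 0)) + (r * c (N (0, 0, 1, 0, 0, 0))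
      + (s * c (N (0, 0, 0, 1, 0, 0)) + (t * c (N (0, 0, 0, 0, 1, 0)) + u * c (N (0, 0, 0, 0, 0, 1))))))"
    using lin[of "\<lambda>a. (a, 0, 0, 0, 0, 0)" p] lin[of "\<lambda>a. (0, a, 0, 0, 0, 0)" q]
      lin[of "\<lambda>a. (0, 0, a, 0, 0, 0)" r] lin[of "\<lambda>a. (0, 0, 0, a, 0, 0)" s]
      lin[of "\<lambda>a. (0, 0, 0, 0, a, 0)" t] lin[of "\<lambda>a. (0, 0, 0, 0, 0, a)" u] by simp
  finally have N: "c (N x) = \<dots>" .
  have "c x = p * c (1, 0, 0, 0, 0, 0) + (q * c (0, 1, 0, 0, 0, 0) + (r * c (0, 0, 1, 0, 0, 0)
      + (s * c (0, 0, 0, 1, 0, 0) + (t * c (0, 0, 0, 0, 1, 0) + u * c (0, 0, 0, 0, 0, 1)))))"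
    using \<open>i < 6\<close> by (auto simp: c_def x list6_def nth_Cons')
  moreover have "list6 x = [p, q, r, s, t, u]" by (simp add: x list6_def)
  moreover have "rows N ! i = map (\<lambda>e. c (N e) - c e) unit6" using \<open>i < 6\<close> by (simp add: rows_def c_def)
  ultimately have "dot (rows N ! i) (list6 x) = c (N x) - c x"
    using N by (simp add: unit6_def algebra_simps)
  then show ?thesis by (simp only: c_def)
qed

lemma card_fixed_residues_eq:
  assumes N: "additive_map N" and q: "q = 2 \<or> q = 3"
  shows "card (fixed_residues q N) = fixed_count q N"
proof -
  have len: "length (list6 x) = 6" for x by (cases x) (simp add: list6_def)
  have range: "x \<in> range (mod6 (int q)) \<longleftrightarrow> set (list6 x) \<subseteq> {0..<int q}" for x
  proof
    assume "x \<in> range (mod6 (int q))"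
    then obtain y where "x = mod6 (int q) y" by (rule rangeE)
    then show "set (list6 x) \<subseteq> {0..<int q}" using q by (cases y) (auto simp: mod6_def list6_def)
  next
    assume "set (list6 x) \<subseteq> {0..<int q}"
    then have "x = mod6 (int q) x" by (cases x) (auto simp: mod6_def list6_def)
    then show "x \<in> range (mod6 (int q))" by (rule range_eqI)
  qed
  have dvd: "mod6 (int q) y = x \<longleftrightarrow> (\<forall>i<6. int q dvd list6 y ! i - list6 x ! i)"
    if "set (list6 x) \<subseteq> {0..<int q}" for x y
  proof -
    have "x = mod6 (int q) x" using that by (cases x) (auto simp: mod6_def list6_def)
    then have "mod6 (int q) y = x \<longleftrightarrow> mod6 (int q) y = mod6 (int q) x" by simp
    also have "\<dots> \<longleftrightarrow> (\<forall>i<6. int q dvd list6 y ! i - list6 x ! i)"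
      by (cases x; cases y) (auto simp: mod6_def list6_def mod_eq_dvd_iff numeral_eq_Suc All_less_Suc)
    finally show ?thesis .
  qed
  have rows: "(\<forall>r\<in>set (rows N). int q dvd dot r (list6 x)) \<longleftrightarrow> (\<forall>i<6. int q dvd list6 (N x) ! i - list6 x ! i)" for x
  proof -
    have "length (rows N) = 6" by (simp add: rows_def)
    then have "(\<forall>r\<in>set (rows N). int q dvd dot r (list6 x)) \<longleftrightarrow> (\<forall>i<6. int q dvd dot (rows N ! i) (list6 x))"
      by (simp add: all_set_conv_all_nth)
    then show ?thesis by (simp add: rows_apply[OF N, of _ x])
  qed
  have mem: "x \<in> fixed_residues q N \<longleftrightarrow> list6 x \<in> solutions (int q) 6 (rows N)" for x
    unfolding fixed_residues_def solutions_def mem_Collect_eq range rows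
    using dvd[of x "N x"] len[of x] by blast
  have "list6 ` fixed_residues q N = solutions (int q) 6 (rows N)"
  proof (intro subset_antisym subsetI)
    fix z assume "z \<in> list6 ` fixed_residues q N"
    then show "z \<in> solutions (int q) 6 (rows N)" using mem by blast
  next
    fix z assume z: "z \<in> solutions (int q) 6 (rows N)"
    then obtain x1 x2 x3 x4 x5 x6 where "z = list6 (x1, x2, x3, x4, x5, x6)"
      by (auto simp: solutions_def list6_def numeral_eq_Suc length_Suc_conv)
    then show "z \<in> list6 ` fixed_residues q N"
      using z mem by blast
  qed
  moreover have "inj list6" by (auto simp: inj_def list6_def)
  ultimately have "card (fixed_residues q N) = card (solutions (int q) 6 (rows N))"
    by (metis card_image inj_on_subset subset_UNIV)
  also have "\<dots> = fixed_count q N"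
    unfolding fixed_count_def using q by (rule card_solutions) (auto simp: rows_def unit6_def)
  finally show ?thesis .
qed

text \<open>For even m the middle power is an involution, whose fixed residues modulo 2 measure how
  its eigenlattices are glued; it alone separates \<open>lattice_8_c\<close> from
  \<open>lattice_8_e\<close>. The square modulo 3 alone separates \<open>lattice_6_d\<close> from
  \<open>lattice_6_f\<close>.\<close>

definition map_invariant :: "nat \<Rightarrow> (Z6 \<Rightarrow> Z6) \<Rightarrow> nat list" where
  "map_invariant m M =
     [m, fixed_count 2 M, fixed_count 3 M, fixed_count 2 (M ^^ (m div 2)), fixed_count 3 (M ^^ 2)]"

fun lattice_invariant :: "lattice_data \<Rightarrow> nat list" where
  "lattice_invariant (m, a, b, c, M, P) = map_invariant m M"

lemma (in isomorphic_maps) map_invariant: "map_invariant m M = map_invariant m M'"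
proof -
  have "fixed_count q (M ^^ d) = fixed_count q (M' ^^ d)" if "q = 2 \<or> q = 3" for d q
    using that card_fixed_residues[of q d] additive_map_funpow[OF A.additive_map_axioms]
      additive_map_funpow[OF B.additive_map_axioms]
    by (auto simp: card_fixed_residues_eq)
  from this[of 2 1] this[of 3 1] this[of 2 "m div 2"] this[of 3 2] show ?thesis
    by (simp add: map_invariant_def)
qed

section \<open>The ring of integers of the seventh cyclotomic field\<close>

definition heptagon_sum :: "complex \<Rightarrow> R6_coordinates \<Rightarrow> complex" where
  "heptagon_sum z = (\<lambda>(p, q, r, s, t, u). of_real p + of_real q * z + of_real r * z ^ 2 + of_real s * z ^ 3
     + of_real t * z ^ 4 + of_real u * z ^ 5)"

text \<open>The embeddings with exponents 1, 2 and 4, one from each conjugate pair. The last angle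
  is 8 pi / 7 lowered by a full turn, which makes the three angles add up to 0.\<close>

definition heptagon :: "R6_coordinates \<Rightarrow> R6" where
  "heptagon x = vec6 (Re (heptagon_sum (cis (2 * pi / 7)) x)) (Im (heptagon_sum (cis (2 * pi / 7)) x))
     (Re (heptagon_sum (cis (4 * pi / 7)) x)) (Im (heptagon_sum (cis (4 * pi / 7)) x))
     (Re (heptagon_sum (cis (- (6 * pi / 7))) x)) (Im (heptagon_sum (cis (- (6 * pi / 7))) x))"

lemma heptagon_sum_linear:
  "heptagon_sum z (x + y) = heptagon_sum z x + heptagon_sum z y"
  "heptagon_sum z (k *\<^sub>R x) = k *\<^sub>R heptagon_sum z x"
  by (cases x; cases y; simp add: heptagon_sum_def algebra_simps scaleR_conv_of_real)+

lemma cnj_heptagon_sum: "heptagon_sum (cnj z) x = cnj (heptagon_sum z x)"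
  by (cases x) (simp add: heptagon_sum_def)

text \<open>Multiplication by z shifts the coefficients, and z^6 is replaced by minus the sum of the
  lower powers. This is the origin of the matrix of order 7.\<close>

lemma heptagon_sum_rotate:
  assumes "z ^ 7 = 1" "z \<noteq> 1"
  shows "z * heptagon_sum z (p, q, r, s, t, u) = heptagon_sum z (- u, p - u, q - u, r - u, s - u, t - u)"
proof -
  have "(z - 1) * (1 + z + z ^ 2 + z ^ 3 + z ^ 4 + z ^ 5 + z ^ 6) = z ^ 7 - 1" by algebra
  then have "1 + z + z ^ 2 + z ^ 3 + z ^ 4 + z ^ 5 + z ^ 6 = 0" using assms by simp
  then show ?thesis unfolding heptagon_sum_def prod.case of_real_diff of_real_minus by algebra
qed

lemma cis_seventh:
  assumes "j \<in> {1..6}" shows "cis (2 * pi * real j / 7) ^ 7 = 1" "cis (2 * pi * real j / 7) \<noteq> 1"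
proof -
  have bij: "bij_betw (\<lambda>k. cis (2 * pi * real k / real 7)) {..<7} {z. z ^ 7 = 1}"
    using Complex.bij_betw_roots_unity[of 7] by simp
  show "cis (2 * pi * real j / 7) ^ 7 = 1"
    using bij_betw_apply[OF bij, of j] assms by simp
  show "cis (2 * pi * real j / 7) \<noteq> 1"
    using bij_betw_imp_inj_on[OF bij, THEN inj_onD, of j 0] assms by auto
qed

lemma cis_shift: "cis (- (6 * pi / 7)) = cis (8 * pi / 7)"
proof -
  have "cis (8 * pi / 7) = cis (- (6 * pi / 7) + 2 * pi)" by (intro arg_cong[of _ _ cis]) simp
  also have "\<dots> = cis (- (6 * pi / 7)) * cis (2 * pi)" by (rule cis_mult[symmetric])
  finally show ?thesis by simp
qed

text \<open>The six conditions say that the polynomial of degree at most 5 with coefficients \<open>x\<close> vanishes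
  at three primitive seventh roots of unity, hence also at their conjugates.\<close>

lemma heptagon_kernel:
  assumes "heptagon (p, q, r, s, t, u) = 0"
  shows "p = 0 \<and> q = 0 \<and> r = 0 \<and> s = 0 \<and> t = 0 \<and> u = 0"
proof -
  define f where "f z = heptagon_sum z (p, q, r, s, t, u)" for z
  have f0: "f (cis (2 * pi / 7)) = 0" "f (cis (4 * pi / 7)) = 0" "f (cis (- (6 * pi / 7))) = 0"
    using assms by (simp_all add: heptagon_def f_def complex_eq_iff)
  have cnj: "f (cnj z) = 0" if "f z = 0" for z using that by (simp add: f_def cnj_heptagon_sum)
  have neg: "cnj (cis (2 * pi * real j / 7)) = cis (2 * pi * real (7 - j) / 7)" if "j \<le> 7" for j
  proof -
    have "cis (2 * pi * real (7 - j) / 7) = cis (2 * pi + - (2 * pi * real j / 7))"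
      using that by (intro arg_cong[of _ _ cis]) (simp add: of_nat_diff field_simps)
    also have "\<dots> = cis (2 * pi) * cis (- (2 * pi * real j / 7))" by (rule cis_mult[symmetric])
    finally show ?thesis by (simp add: cis_cnj)
  qed
  have f1: "f (cis (2 * pi * real 1 / 7)) = 0" "f (cis (2 * pi * real 2 / 7)) = 0" "f (cis (2 * pi * real 4 / 7)) = 0"
    using f0 cis_shift by simp_all
  have f2: "f (cis (2 * pi * real 6 / 7)) = 0" "f (cis (2 * pi * real 5 / 7)) = 0" "f (cis (2 * pi * real 3 / 7)) = 0"
    using f1[THEN cnj] neg[of 1] neg[of 2] neg[of 4] by simp_all
  define g where "g = [:complex_of_real p, of_real q, of_real r, of_real s, of_real t, of_real u:]"
  have fg: "poly g z = f z" for z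
    by (simp add: g_def f_def heptagon_sum_def algebra_simps power_numeral_reduce)
  have "g = 0"
  proof (rule ccontr)
    assume "g \<noteq> 0"
    let ?R = "(\<lambda>j. cis (2 * pi * real j / 7)) ` {1..6}"
    have "inj_on (\<lambda>k. cis (2 * pi * real k / real 7)) {..<7}"
      using Complex.bij_betw_roots_unity[of 7] by (simp add: bij_betw_def)
    then have "inj_on (\<lambda>k. cis (2 * pi * real k / real 7)) {1..6}" by (rule inj_on_subset) auto
    then have "card ?R = 6" by (simp add: card_image)
    moreover have "?R \<subseteq> {z. poly g z = 0}"
    proof -
      have "{1..6} = {1, 2, 3, 4, 5, 6::nat}" by auto
      then show ?thesis using f1 f2 by (simp add: fg)
    qed
    ultimately have "6 \<le> card {z. poly g z = 0}"
      using card_mono[OF poly_roots_finite[OF \<open>g \<noteq> 0\<close>]] by metis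
    also have "\<dots> \<le> degree g" using \<open>g \<noteq> 0\<close> by (rule card_poly_roots_bound)
    also have "\<dots> \<le> 5" by (simp add: g_def degree_pCons_eq_if)
    finally show False by simp
  qed
  then show ?thesis by (simp add: g_def)
qed

lemma rot_action_heptagon:
  "rot_action (2 * pi / 7) (4 * pi / 7) (- (6 * pi / 7)) 1 (heptagon (p, q, r, s, t, u)) =
   heptagon (- u, p - u, q - u, r - u, s - u, t - u)"
proof -
  have rot: "cos \<theta> * Re z - sin \<theta> * Im z = Re (cis \<theta> * z)" "sin \<theta> * Re z + cos \<theta> * Im z = Im (cis \<theta> * z)" for \<theta> z
    by simp_all
  have "cis \<theta> * heptagon_sum (cis \<theta>) (p, q, r, s, t, u) = heptagon_sum (cis \<theta>) (- u, p - u, q - u, r - u, s - u, t - u)"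
    if "cis \<theta> = cis (2 * pi * real j / 7)" "j \<in> {1..6}" for \<theta> j
    unfolding that(1) using cis_seventh[OF that(2)] by (rule heptagon_sum_rotate)
  from this[of "2 * pi / 7" 1] this[of "4 * pi / 7" 2] this[of "- (6 * pi / 7)" 4] cis_shift
  show ?thesis unfolding heptagon_def rot_action_vec6 rot by simp
qed

text \<open>In \<open>lattice_m_x = (m, a, b, c, M, P)\<close> the matrix \<open>M\<close> has order \<open>m\<close>, and \<open>P\<close> maps the standard basis to
  a basis of a lattice on which \<open>R = \<phi>(1)\<close> acts as \<open>M\<close>. Apart from \<open>lattice_8_e\<close>, the lattice is a direct sum of cyclic
  modules \<open>\<int>[R] g\<close>, where \<open>g \<in> \<complex>\<^sup>3\<close> has entries \<open>0\<close>, \<open>1\<close> and \<open>\<i>\<close>, with the bases \<open>g, R g, R\<^sup>2 g, \<dots>\<close>. The lattice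
  \<open>lattice_8_e\<close> is the fibre product of \<open>\<int>[\<zeta>\<^sub>8]\<close> and \<open>\<int>[\<i>]\<close> over their common residue field with two elements.\<close>

definition "lattice_1_a =
   (1, 2 * pi, - (2 * pi), 0,
    \<lambda>(p, q, r, s, t, u). (p, q, r, s, t, u),
    \<lambda>(p, q, r, s, t, u). vec6 p q r s t u)"

text \<open>With the angle 2 pi the rotations are trivial at integer times: the group is not
  abelian, but its lattice is, and the quotient is a torus.\<close>

lemma valid_lattices_1:
  "valid_lattice lattice_1_a"
  unfolding lattice_1_a_def
  by (rule valid_latticeI, (simp only: split_paired_all, simp), simp, code_simp,
      (rule linearI; auto simp: algebra_simps add_divide_distrib),
      (simp only: prod.case vec6_eq_0_iff; use half_sqrt_squares(1,3) in algebra),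
      (simp add: real6_def cos_sin_values;
       simp add: algebra_simps add_divide_distrib diff_divide_distrib), simp, simp)+

lemma lattice_invariants_1:
  "lattice_invariant lattice_1_a = [1, 64, 729, 64, 729]"
  unfolding lattice_1_a_def lattice_invariant.simps
  by code_simp+

section \<open>Order 2\<close>

definition "lattice_2_a =
   (2, pi, - pi, 0,
    \<lambda>(p, q, r, s, t, u). (- p, - q, - r, - s, t, u),
    \<lambda>(p, q, r, s, t, u). vec6 p q r s t u)"

definition "lattice_2_b =
   (2, pi, - pi, 0,
    \<lambda>(p, q, r, s, t, u). (q, p, - r, - s, - t, u),
    \<lambda>(p, q, r, s, t, u). vec6 (p - q) r s t (p + q) u)"

definition "lattice_2_c =
   (2, pi, - pi, 0,
    \<lambda>(p, q, r, s, t, u). (q, p, s, r, - t, - u),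
    \<lambda>(p, q, r, s, t, u). vec6 (p - q) (r - s) t u (p + q) (r + s))"

lemma valid_lattices_2:
  "valid_lattice lattice_2_a"
  "valid_lattice lattice_2_b"
  "valid_lattice lattice_2_c"
  unfolding lattice_2_a_def lattice_2_b_def lattice_2_c_def
  by (rule valid_latticeI, (simp only: split_paired_all, simp), simp, code_simp,
      (rule linearI; auto simp: algebra_simps add_divide_distrib),
      (simp only: prod.case vec6_eq_0_iff; use half_sqrt_squares(1,3) in algebra),
      (simp add: real6_def cos_sin_values;
       simp add: algebra_simps add_divide_distrib diff_divide_distrib), simp, simp)+

text \<open>Each exchange of two coordinates glues an eigenvalue 1 to an eigenvalue -1 and halves
  the number of fixed residues modulo 2.\<close>

lemma lattice_invariants_2:
  "lattice_invariant lattice_2_a = [2, 64, 9, 64, 729]"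
  "lattice_invariant lattice_2_b = [2, 32, 9, 32, 729]"
  "lattice_invariant lattice_2_c = [2, 16, 9, 16, 729]"
  unfolding lattice_2_a_def lattice_2_b_def lattice_2_c_def lattice_invariant.simps
  by code_simp+

section \<open>Order 3\<close>

definition "lattice_3_a =
   (3, 2 * pi / 3, - (2 * pi / 3), 0,
    \<lambda>(p, q, r, s, t, u). (- q, p - q, - s, r - s, t, u),
    \<lambda>(p, q, r, s, t, u). vec6 (p - q / 2) (half_sqrt3 * q) (r - s / 2) (- half_sqrt3 * s) t
    u)"

definition "lattice_3_b =
   (3, 2 * pi / 3, - (2 * pi / 3), 0,
    \<lambda>(p, q, r, s, t, u). (r, p, q, - t, s - t, u),
    \<lambda>(p, q, r, s, t, u). vec6 (p - q / 2 - r / 2) (half_sqrt3 * q - half_sqrt3 * r)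
    (s - t / 2) (- half_sqrt3 * t) (p + q + r) u)"

definition "lattice_3_c =
   (3, 2 * pi / 3, - (2 * pi / 3), 0,
    \<lambda>(p, q, r, s, t, u). (r, p, q, u, s, t),
    \<lambda>(p, q, r, s, t, u). vec6 (p - q / 2 - r / 2) (half_sqrt3 * q - half_sqrt3 * r)
    (s - t / 2 - u / 2) (- half_sqrt3 * t + half_sqrt3 * u) (p + q + r) (s + t + u))"

definition "lattice_3_d =
   (3, 2 * pi / 3, 2 * pi / 3, - (4 * pi / 3),
    \<lambda>(p, q, r, s, t, u). (- q, p - q, - s, r - s, - u, t - u),
    \<lambda>(p, q, r, s, t, u). vec6 (p - q / 2) (half_sqrt3 * q) (r - s / 2) (half_sqrt3 * s)
    (t - u / 2) (half_sqrt3 * u))"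

lemma valid_lattices_3:
  "valid_lattice lattice_3_a"
  "valid_lattice lattice_3_b"
  "valid_lattice lattice_3_c"
  "valid_lattice lattice_3_d"
  unfolding lattice_3_a_def lattice_3_b_def lattice_3_c_def lattice_3_d_def
  by (rule valid_latticeI, (simp only: split_paired_all, simp), simp, code_simp,
      (rule linearI; auto simp: algebra_simps add_divide_distrib),
      (simp only: prod.case vec6_eq_0_iff; use half_sqrt_squares(1,3) in algebra),
      (simp add: real6_def cos_sin_values;
       simp add: algebra_simps add_divide_distrib diff_divide_distrib), simp, simp)+

text \<open>Modulo 3, the ring generated by a cube root of unity and the trivial module have 3 fixed
  residues each; fused into a cyclic permutation of three coordinates they have 3 together. Modulo 2
  only the eigenvalue 1 contributes, which separates \<open>lattice_3_b\<close> from
  \<open>lattice_3_d\<close>.\<close>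

lemma lattice_invariants_3:
  "lattice_invariant lattice_3_a = [3, 4, 81, 4, 81]"
  "lattice_invariant lattice_3_b = [3, 4, 27, 4, 27]"
  "lattice_invariant lattice_3_c = [3, 4, 9, 4, 9]"
  "lattice_invariant lattice_3_d = [3, 1, 27, 1, 27]"
  unfolding lattice_3_a_def lattice_3_b_def lattice_3_c_def lattice_3_d_def lattice_invariant.simps
  by code_simp+

section \<open>Order 4\<close>

definition "lattice_4_a =
   (4, pi / 2, - (pi / 2), 0,
    \<lambda>(p, q, r, s, t, u). (- q, p, - s, r, t, u),
    \<lambda>(p, q, r, s, t, u). vec6 p q r (- s) t u)"

definition "lattice_4_b =
   (4, pi / 2, - (pi / 2), 0,
    \<lambda>(p, q, r, s, t, u). (r, p - r, q + r, - t, s, u),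
    \<lambda>(p, q, r, s, t, u). vec6 (p - r) q s (- t) (p + q + r) u)"

definition "lattice_4_c =
   (4, pi / 2, - (pi / 2), 0,
    \<lambda>(p, q, r, s, t, u). (r, p - r, q + r, u, s - u, t + u),
    \<lambda>(p, q, r, s, t, u). vec6 (p - r) q (s - u) (- t) (p + q + r) (s + t + u))"

definition "lattice_4_d =
   (4, pi / 2, pi / 2, - pi,
    \<lambda>(p, q, r, s, t, u). (- q, p, - s, r, - t, - u),
    \<lambda>(p, q, r, s, t, u). vec6 p q r s t u)"

definition "lattice_4_e =
   (4, pi / 2, pi / 2, - pi,
    \<lambda>(p, q, r, s, t, u). (- r, p - r, q - r, - t, s, - u),
    \<lambda>(p, q, r, s, t, u). vec6 (p - r) q s t (p - q + r) u)"

definition "lattice_4_f =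
   (4, pi / 2, pi / 2, - pi,
    \<lambda>(p, q, r, s, t, u). (- r, p - r, q - r, - u, s - u, t - u),
    \<lambda>(p, q, r, s, t, u). vec6 (p - r) q (s - u) t (p - q + r) (s - t + u))"

lemma valid_lattices_4:
  "valid_lattice lattice_4_a"
  "valid_lattice lattice_4_b"
  "valid_lattice lattice_4_c"
  "valid_lattice lattice_4_d"
  "valid_lattice lattice_4_e"
  "valid_lattice lattice_4_f"
  unfolding lattice_4_a_def lattice_4_b_def lattice_4_c_def lattice_4_d_def lattice_4_e_def lattice_4_f_def
  by (rule valid_latticeI, (simp only: split_paired_all, simp), simp, code_simp,
      (rule linearI; auto simp: algebra_simps add_divide_distrib),
      (simp only: prod.case vec6_eq_0_iff; use half_sqrt_squares(1,3) in algebra),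
      (simp add: real6_def cos_sin_values;
       simp add: algebra_simps add_divide_distrib diff_divide_distrib), simp, simp)+

text \<open>Fixed residues modulo 3 tell the third eigenvalue 1 from -1. Each gluing of Z[i] with a
  module of rank one halves the number modulo 2.\<close>

lemma lattice_invariants_4:
  "lattice_invariant lattice_4_a = [4, 16, 9, 64, 9]"
  "lattice_invariant lattice_4_b = [4, 8, 9, 32, 9]"
  "lattice_invariant lattice_4_c = [4, 4, 9, 16, 9]"
  "lattice_invariant lattice_4_d = [4, 16, 1, 64, 9]"
  "lattice_invariant lattice_4_e = [4, 8, 1, 32, 9]"
  "lattice_invariant lattice_4_f = [4, 4, 1, 16, 9]"
  unfolding lattice_4_a_def lattice_4_b_def lattice_4_c_def lattice_4_d_def lattice_4_e_def lattice_4_f_def lattice_invariant.simps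
  by code_simp+

section \<open>Order 6\<close>

definition "lattice_6_a =
   (6, pi / 3, - (pi / 3), 0,
    \<lambda>(p, q, r, s, t, u). (- q, p + q, - s, r + s, t, u),
    \<lambda>(p, q, r, s, t, u). vec6 (p + q / 2) (half_sqrt3 * q) (r + s / 2) (- half_sqrt3 * s) t
    u)"

definition "lattice_6_b =
   (6, pi / 3, pi / 3, - (2 * pi / 3),
    \<lambda>(p, q, r, s, t, u). (- q, p + q, - s, r + s, - u, t - u),
    \<lambda>(p, q, r, s, t, u). vec6 (p + q / 2) (half_sqrt3 * q) (r + s / 2) (half_sqrt3 * s)
    (t - u / 2) (- half_sqrt3 * u))"

definition "lattice_6_c =
   (6, pi / 3, pi / 3, - (2 * pi / 3),
    \<lambda>(p, q, r, s, t, u). (- s, p, q - s, r, - u, t + u),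
    \<lambda>(p, q, r, s, t, u). vec6 (p + q / 2 - r / 2 - s) (half_sqrt3 * q + half_sqrt3 * r)
    (t + u / 2) (half_sqrt3 * u) (p - q / 2 - r / 2 + s) (- half_sqrt3 * q + half_sqrt3 * r))"

definition "lattice_6_d =
   (6, pi / 3, 2 * pi / 3, - pi,
    \<lambda>(p, q, r, s, t, u). (- q, p + q, - s, r - s, - t, - u),
    \<lambda>(p, q, r, s, t, u). vec6 (p + q / 2) (half_sqrt3 * q) (r - s / 2) (half_sqrt3 * s) t u)"

definition "lattice_6_e =
   (6, pi / 3, 2 * pi / 3, - pi,
    \<lambda>(p, q, r, s, t, u). (- s, p, q - s, r, - t, - u),
    \<lambda>(p, q, r, s, t, u). vec6 (p + q / 2 - r / 2 - s) (half_sqrt3 * q + half_sqrt3 * r)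
    (p - q / 2 - r / 2 + s) (half_sqrt3 * q - half_sqrt3 * r) t u)"

definition "lattice_6_f =
   (6, pi / 3, 2 * pi / 3, - pi,
    \<lambda>(p, q, r, s, t, u). (- r, p, q, - t, s - t, - u),
    \<lambda>(p, q, r, s, t, u). vec6 (p + q / 2 - r / 2) (half_sqrt3 * q + half_sqrt3 * r)
    (s - t / 2) (half_sqrt3 * t) (p - q + r) u)"

definition "lattice_6_g =
   (6, pi / 3, 2 * pi / 3, - pi,
    \<lambda>(p, q, r, s, t, u). (- t, p - t, q - t, r - t, s - t, - u),
    \<lambda>(p, q, r, s, t, u). vec6 (p + q / 2 - r / 2 - s - t / 2)
    (half_sqrt3 * q + half_sqrt3 * r - half_sqrt3 * t) (p - q / 2 - r / 2 + s - t / 2)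
    (half_sqrt3 * q - half_sqrt3 * r + half_sqrt3 * t) (p - q + r - s + t) u)"

lemma valid_lattices_6:
  "valid_lattice lattice_6_a"
  "valid_lattice lattice_6_b"
  "valid_lattice lattice_6_c"
  "valid_lattice lattice_6_d"
  "valid_lattice lattice_6_e"
  "valid_lattice lattice_6_f"
  "valid_lattice lattice_6_g"
  unfolding lattice_6_a_def lattice_6_b_def lattice_6_c_def lattice_6_d_def lattice_6_e_def lattice_6_f_def lattice_6_g_def
  by (rule valid_latticeI, (simp only: split_paired_all, simp), simp, code_simp,
      (rule linearI; auto simp: algebra_simps add_divide_distrib),
      (simp only: prod.case vec6_eq_0_iff; use half_sqrt_squares(1,3) in algebra),
      (simp add: real6_def cos_sin_values;
       simp add: algebra_simps add_divide_distrib diff_divide_distrib), simp, simp)+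

text \<open>Eigenvalues of orders 3 and 6 are glued modulo 2, which the cube of M detects: 16 in
  place of 64. Eigenvalues of orders 2 and 6 are glued modulo 3, which the square of M detects: 27
  in place of 81 among the last four.\<close>

lemma lattice_invariants_6:
  "lattice_invariant lattice_6_a = [6, 4, 9, 64, 81]"
  "lattice_invariant lattice_6_b = [6, 1, 3, 64, 27]"
  "lattice_invariant lattice_6_c = [6, 1, 3, 16, 27]"
  "lattice_invariant lattice_6_d = [6, 4, 3, 64, 81]"
  "lattice_invariant lattice_6_e = [6, 4, 3, 16, 81]"
  "lattice_invariant lattice_6_f = [6, 4, 3, 64, 27]"
  "lattice_invariant lattice_6_g = [6, 4, 3, 16, 27]"
  unfolding lattice_6_a_def lattice_6_b_def lattice_6_c_def lattice_6_d_def lattice_6_e_def lattice_6_f_def lattice_6_g_def lattice_invariant.simps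
  by code_simp+

section \<open>Order 7\<close>

definition "lattice_7_a =
   (7, 2 * pi / 7, 4 * pi / 7, - (6 * pi / 7),
    \<lambda>(p, q, r, s, t, u). (- u, p - u, q - u, r - u, s - u, t - u),
    heptagon)"

lemma valid_lattices_7: "valid_lattice lattice_7_a"
  unfolding lattice_7_a_def
  by (rule valid_latticeI, (simp only: split_paired_all, simp), simp, code_simp,
      (rule linearI; simp add: heptagon_def heptagon_sum_linear), rule heptagon_kernel, assumption,
      simp add: real6_def rot_action_heptagon, simp_all)

lemma lattice_invariants_7:
  "lattice_invariant lattice_7_a = [7, 1, 1, 1, 1]"
  unfolding lattice_7_a_def lattice_invariant.simps
  by code_simp+

section \<open>Order 8\<close>

definition "lattice_8_a =
   (8, pi / 4, 3 * pi / 4, - pi,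
    \<lambda>(p, q, r, s, t, u). (- s, p, q, r, - t, - u),
    \<lambda>(p, q, r, s, t, u). vec6 (p + half_sqrt2 * q - half_sqrt2 * s)
    (half_sqrt2 * q + r + half_sqrt2 * s) (p - half_sqrt2 * q + half_sqrt2 * s)
    (half_sqrt2 * q - r + half_sqrt2 * s) t u)"

definition "lattice_8_b =
   (8, pi / 4, 3 * pi / 4, - pi,
    \<lambda>(p, q, r, s, t, u). (- t, p - t, q, r, s - t, - u),
    \<lambda>(p, q, r, s, t, u). vec6 (p + half_sqrt2 * q - half_sqrt2 * s - t)
    (half_sqrt2 * q + r + half_sqrt2 * s) (p - half_sqrt2 * q + half_sqrt2 * s - t)
    (half_sqrt2 * q - r + half_sqrt2 * s) (p - q + r - s + t) u)"

definition "lattice_8_c =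
   (8, pi / 4, - (3 * pi / 4), pi / 2,
    \<lambda>(p, q, r, s, t, u). (- s, p, q, r, - u, t),
    \<lambda>(p, q, r, s, t, u). vec6 (p + half_sqrt2 * q - half_sqrt2 * s)
    (half_sqrt2 * q + r + half_sqrt2 * s) (p - half_sqrt2 * q + half_sqrt2 * s)
    (- half_sqrt2 * q + r - half_sqrt2 * s) t u)"

definition "lattice_8_d =
   (8, pi / 4, - (3 * pi / 4), pi / 2,
    \<lambda>(p, q, r, s, t, u). (- u, p, q - u, r, s - u, t),
    \<lambda>(p, q, r, s, t, u). vec6 (p + half_sqrt2 * q - half_sqrt2 * s - t - half_sqrt2 * u)
    (half_sqrt2 * q + r + half_sqrt2 * s - half_sqrt2 * u)
    (p - half_sqrt2 * q + half_sqrt2 * s - t + half_sqrt2 * u)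
    (- half_sqrt2 * q + r - half_sqrt2 * s + half_sqrt2 * u) (p - r + t) (q - s + u))"

text \<open>The first four basis vectors are g, R g, R^2 g, R^3 g with g = (1, 1, 1); the last two
  are 1 - i and 1 + i in the third coordinate and span the prime ideal over 2 of Z[i].\<close>

definition "lattice_8_e =
   (8, pi / 4, - (3 * pi / 4), pi / 2,
    \<lambda>(p, q, r, s, t, u). (- s, p, q, r, s - u, s + t),
    \<lambda>(p, q, r, s, t, u). vec6 (p + half_sqrt2 * q - half_sqrt2 * s)
    (half_sqrt2 * q + r + half_sqrt2 * s) (p - half_sqrt2 * q + half_sqrt2 * s)
    (- half_sqrt2 * q + r - half_sqrt2 * s) (p - r + t + u) (q - s - t + u))"

lemma valid_lattices_8:
  "valid_lattice lattice_8_a"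
  "valid_lattice lattice_8_b"
  "valid_lattice lattice_8_c"
  "valid_lattice lattice_8_d"
  "valid_lattice lattice_8_e"
  unfolding lattice_8_a_def lattice_8_b_def lattice_8_c_def lattice_8_d_def lattice_8_e_def
  by (rule valid_latticeI, (simp only: split_paired_all, simp), simp, code_simp,
      (rule linearI; auto simp: algebra_simps add_divide_distrib),
      (simp only: prod.case vec6_eq_0_iff; use half_sqrt_squares(1,3) in algebra),
      (simp add: real6_def cos_sin_values;
       simp add: algebra_simps add_divide_distrib diff_divide_distrib), simp, simp)+

text \<open>The polynomial x^4 + 1 takes the value 2 at i, so that Z[i] can be glued to the ring of
  eighth roots of unity along Z[i]/2, as in \<open>lattice_8_d\<close>, or along its residue field,
  as in \<open>lattice_8_e\<close>. The fourth power of M then has 16 or 32 fixed residues modulo 2,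
  against 64 for the direct sum.\<close>

lemma lattice_invariants_8:
  "lattice_invariant lattice_8_a = [8, 8, 1, 64, 9]"
  "lattice_invariant lattice_8_b = [8, 4, 1, 32, 9]"
  "lattice_invariant lattice_8_c = [8, 4, 1, 64, 1]"
  "lattice_invariant lattice_8_d = [8, 2, 1, 16, 1]"
  "lattice_invariant lattice_8_e = [8, 4, 1, 32, 1]"
  unfolding lattice_8_a_def lattice_8_b_def lattice_8_c_def lattice_8_d_def lattice_8_e_def lattice_invariant.simps
  by code_simp+

section \<open>Order 12\<close>

definition "lattice_12_a =
   (12, pi / 6, - (5 * pi / 6), 2 * pi / 3,
    \<lambda>(p, q, r, s, t, u). (- s, p, q + s, r, - u, t - u),
    \<lambda>(p, q, r, s, t, u). vec6 (p + half_sqrt3 * q + r / 2) (q / 2 + half_sqrt3 * r + s)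
    (p - half_sqrt3 * q + r / 2) (- q / 2 + half_sqrt3 * r - s) (t - u / 2) (half_sqrt3 * u))"

definition "lattice_12_b =
   (12, pi / 6, - (5 * pi / 6), 2 * pi / 3,
    \<lambda>(p, q, r, s, t, u). (- u, p - u, q, r + u, s, t - u),
    \<lambda>(p, q, r, s, t, u). vec6 (p + half_sqrt3 * q + r / 2 - t / 2 - half_sqrt3 * u)
    (q / 2 + half_sqrt3 * r + s + half_sqrt3 * t + u / 2)
    (p - half_sqrt3 * q + r / 2 - t / 2 + half_sqrt3 * u)
    (- q / 2 + half_sqrt3 * r - s + half_sqrt3 * t - u / 2) (p - q / 2 - r / 2 + s - t / 2 - u / 2)
    (half_sqrt3 * q - half_sqrt3 * r + half_sqrt3 * t - half_sqrt3 * u))"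

definition "lattice_12_c =
   (12, pi / 6, 5 * pi / 6, - pi,
    \<lambda>(p, q, r, s, t, u). (- s, p, q + s, r, - t, - u),
    \<lambda>(p, q, r, s, t, u). vec6 (p + half_sqrt3 * q + r / 2) (q / 2 + half_sqrt3 * r + s)
    (p - half_sqrt3 * q + r / 2) (q / 2 - half_sqrt3 * r + s) t u)"

lemma valid_lattices_12:
  "valid_lattice lattice_12_c"
  unfolding lattice_12_c_def
  by (rule valid_latticeI, (simp only: split_paired_all, simp), simp, code_simp,
      (rule linearI; auto simp: algebra_simps add_divide_distrib),
      (simp only: prod.case vec6_eq_0_iff; use half_sqrt_squares(1,3) in algebra),
      (simp add: real6_def cos_sin_values;
       simp add: algebra_simps add_divide_distrib diff_divide_distrib), simp, simp)+

lemma valid_lattice_12_a: "valid_lattice lattice_12_a"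
  unfolding lattice_12_a_def
proof (rule valid_latticeI, goal_cases)
  case (1 x y) then show ?case by (cases x; cases y) simp
next
  case 3 show ?case by code_simp
next
  case 4 show ?case by (rule linearI) (auto simp: algebra_simps add_divide_distrib)
next
  case (5 p q r s t u)
  note eqs = 5[unfolded prod.case vec6_eq_0_iff]
  \<comment> \<open>From the difference of the first and third equations and the sum of the second
    and fourth.\<close>
  then have "half_sqrt3 * q = 0" "half_sqrt3 * r = 0" "half_sqrt3 * u = 0"
    by (elim conjE; linarith)+
  then have "q = 0" "r = 0" "u = 0" by (simp_all add: half_sqrt3_def)
  with 5 show ?case by simp
next
  case (6 p q r s t u) show ?case
    by (simp add: real6_def cos_sin_values)
       (simp add: algebra_simps add_divide_distrib diff_divide_distrib)
qed simp_all

lemma valid_lattice_12_b: "valid_lattice lattice_12_b"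
  unfolding lattice_12_b_def
proof (rule valid_latticeI, goal_cases)
  case (1 x y) then show ?case by (cases x; cases y) simp
next
  case 3 show ?case by code_simp
next
  case 4 show ?case by (rule linearI) (auto simp: algebra_simps add_divide_distrib)
next
  case (5 p q r s t u)
  note eqs = 5[unfolded prod.case vec6_eq_0_iff]
  \<comment> \<open>The difference of the first and third equations relates q and u; the sum of the
    second and fourth gives r + t, and the sixth then gives t - r, up to the irrational
    factor.\<close>
  then have "half_sqrt3 * r = 0" "half_sqrt3 * t = 0" "half_sqrt3 * q = half_sqrt3 * u"
    by (elim conjE; linarith)+
  then have "r = 0" "t = 0" "q = u" by (simp_all add: half_sqrt3_def)
  with 5 show ?case by simp
next
  case (6 p q r s t u) show ?case
    by (simp add: real6_def cos_sin_values)
       (simp add: algebra_simps add_divide_distrib diff_divide_distrib)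
qed simp_all

text \<open>Eigenvalues of orders 3 and 12 are glued modulo 2 in \<open>lattice_12_b\<close>, which
  the sixth power of M detects. Orders 2 and 12 have a ratio with two prime factors and admit no
  gluing.\<close>

lemma lattice_invariants_12:
  "lattice_invariant lattice_12_a = [12, 1, 3, 64, 3]"
  "lattice_invariant lattice_12_b = [12, 1, 3, 16, 3]"
  "lattice_invariant lattice_12_c = [12, 4, 1, 64, 9]"
  unfolding lattice_12_a_def lattice_12_b_def lattice_12_c_def lattice_invariant.simps
  by code_simp+

section \<open>Assembly of the thirty examples\<close>

lemmas valid_lattice_lemmas =
  valid_lattices_1 valid_lattices_2 valid_lattices_3 valid_lattices_4 valid_lattices_6 valid_lattices_7 valid_lattices_8 valid_lattices_12
  valid_lattice_12_a valid_lattice_12_b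

lemmas lattice_invariant_lemmas =
  lattice_invariants_1 lattice_invariants_2 lattice_invariants_3 lattice_invariants_4 lattice_invariants_6
  lattice_invariants_7 lattice_invariants_8 lattice_invariants_12

definition lattices :: "lattice_data list" where
  "lattices = [lattice_1_a, lattice_2_a, lattice_2_b, lattice_2_c, lattice_3_a, lattice_3_b,
     lattice_3_c, lattice_3_d, lattice_4_a, lattice_4_b, lattice_4_c, lattice_4_d,
     lattice_4_e, lattice_4_f, lattice_6_a, lattice_6_b, lattice_6_c, lattice_6_d,
     lattice_6_e, lattice_6_f, lattice_6_g, lattice_7_a, lattice_8_a, lattice_8_b,
     lattice_8_c, lattice_8_d, lattice_8_e, lattice_12_a, lattice_12_b, lattice_12_c]"

lemma valid_lattices: "i < 30 \<Longrightarrow> valid_lattice (lattices ! i)"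
proof -
  assume "i < 30"
  then have "lattices ! i \<in> set lattices" by (intro nth_mem) (simp add: lattices_def)
  moreover have "\<forall>d\<in>set lattices. valid_lattice d"
    unfolding lattices_def list.set ball_simps by (intro conjI TrueI valid_lattice_lemmas)
  ultimately show ?thesis by blast
qed

lemma distinct_lattice_invariants: "distinct (map lattice_invariant lattices)"
  by (simp add: lattices_def lattice_invariant_lemmas)

lemma valid_lattice_geometry:
  assumes "rotation_lattice M m a b c P" "a + b + c = 0"
  shows "flat_almost_abelian_solvmanifold a b c (rotation_lattice.\<Gamma> P) \<and> splittable (rotation_lattice.\<Gamma> P) \<and>
    (\<exists>\<phi> g \<nu>. invariant_G2_structure (almost_abelian a b c) \<phi> \<and> torsion_free_G2 \<phi> \<and> G2_metric \<phi> g \<nu> \<and>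
       (\<forall>p. let Hol = holonomy_group (almost_abelian a b c) (rotation_lattice.\<Gamma> P) g p in
          finite (carrier Hol) \<and> cyclic_group Hol \<and> carrier Hol \<subseteq> G2_group (\<phi> p)))"
proof -
  interpret rotation_lattice M m a b c P by fact
  have N: "N \<noteq> {}" by (simp add: N_def)
  have "finite (carrier Hol) \<and> cyclic_group Hol \<and> carrier Hol \<subseteq> G2_group G2_constant_form"
    if "Hol = holonomy_group (almost_abelian a b c) \<Gamma> (\<lambda>p. (\<bullet>)) p" for Hol p
  proof (intro conjI)
    show "finite (carrier Hol)" "cyclic_group Hol"
      using holonomy_finite_cyclic[OF \<Gamma>_def N m_pos rot_action_m, of p] by (simp_all only: that)
    show "carrier Hol \<subseteq> G2_group G2_constant_form"
      unfolding that carrier_holonomy_group[OF \<Gamma>_def N]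
      by (intro image_subsetI rotate7_in_G2_group assms(2))
  qed
  then show ?thesis
    using flat_solvmanifold splittable_\<Gamma>
    by (intro conjI exI[of _ "\<lambda>p. G2_constant_form"] exI[of _ "\<lambda>p. (\<bullet>)"] exI[of _ "\<lambda>p. volume7"] allI
        invariant_G2_structure_constant assms(2) torsion_free_constant G2_metric_constant) (auto simp: Let_def)
qed

theorem mainTheorem3:
  shows "\<exists>(a :: nat \<Rightarrow> real) b c (\<Gamma> :: nat \<Rightarrow> R7 set).
    (\<forall>i<30.
       flat_almost_abelian_solvmanifold (a i) (b i) (c i) (\<Gamma> i) \<and> splittable (\<Gamma> i) \<and>
       (\<exists>\<phi> g \<nu>.
          invariant_G2_structure (almost_abelian (a i) (b i) (c i)) \<phi> \<and>
          torsion_free_G2 \<phi> \<and> G2_metric \<phi> g \<nu> \<and>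
          (\<forall>p. let Hol = holonomy_group (almost_abelian (a i) (b i) (c i)) (\<Gamma> i) g p in
             finite (carrier Hol) \<and> cyclic_group Hol \<and> carrier Hol \<subseteq> G2_group (\<phi> p)))) \<and>
    (\<forall>i<30. \<forall>j<30. i \<noteq> j \<longrightarrow>
       \<not> diffeomorphic_quotients
           (almost_abelian (a i) (b i) (c i)) (\<Gamma> i) (almost_abelian (a j) (b j) (c j)) (\<Gamma> j))"
proof -
  define m where "m i = fst (lattices ! i)" for i
  define a where "a i = fst (snd (lattices ! i))" for i
  define b where "b i = fst (snd (snd (lattices ! i)))" for i
  define c where "c i = fst (snd (snd (snd (lattices ! i))))" for i
  define M where "M i = fst (snd (snd (snd (snd (lattices ! i)))))" for i
  define P where "P i = snd (snd (snd (snd (snd (lattices ! i)))))" for i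
  have nth: "lattices ! i = (m i, a i, b i, c i, M i, P i)" for i
    by (simp add: m_def a_def b_def c_def M_def P_def)
  have valid: "rotation_lattice (M i) (m i) (a i) (b i) (c i) (P i)" "a i + b i + c i = 0" if "i < 30" for i
    using valid_lattices[OF that] by (simp_all add: nth)
  define \<Gamma> where "\<Gamma> i = rotation_lattice.\<Gamma> (P i)" for i
  have distinct: "\<not> diffeomorphic_quotients (almost_abelian (a i) (b i) (c i)) (\<Gamma> i) (almost_abelian (a j) (b j) (c j)) (\<Gamma> j)"
    if ij: "i < 30" "j < 30" "i \<noteq> j" for i j
  proof
    assume "diffeomorphic_quotients (almost_abelian (a i) (b i) (c i)) (\<Gamma> i) (almost_abelian (a j) (b j) (c j)) (\<Gamma> j)"
    then have "m i = m j \<and> (\<exists>\<theta>. isomorphic_maps (M i) (M j) (m i) \<theta>)"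
      unfolding \<Gamma>_def by (rule diffeomorphic_imp_isomorphic_maps[OF valid(1)[OF ij(1)] valid(1)[OF ij(2)]])
    then obtain \<theta> where m: "m i = m j" and \<theta>: "isomorphic_maps (M i) (M j) (m i) \<theta>" by (elim conjE exE)
    then have "lattice_invariant (lattices ! i) = lattice_invariant (lattices ! j)"
      using isomorphic_maps.map_invariant[OF \<theta>] by (simp add: nth)
    moreover have "length lattices = 30" by (simp add: lattices_def)
    ultimately show False
      using distinct_lattice_invariants ij nth_eq_iff_index_eq[of "map lattice_invariant lattices" i j] by simp
  qed
  show ?thesis
    by (rule exI[of _ a], rule exI[of _ b], rule exI[of _ c], rule exI[of _ \<Gamma>], rule conjI, intro allI impI)
       (rule valid_lattice_geometry[OF valid, folded \<Gamma>_def], assumption, assumption, intro allI impI distinct)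
qed

end
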